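(* Let $V$ be a real vector space of finite dimension $n\ge2$. Let $(F_i)_{i=1}^\infty$ and $(H_i)_{i=1}^\infty$ be sequences of flags in $\mathcal F(V)$ and let $K\in\mathcal F(V)$ be such that for all integers $l\ge2$, $(F_1,\dots,F_l,H_l,\dots,H_1,K)$ is a positive tuple of flags. If there is some $D>1$ such that $B_k(H_i,F_i,F_{i+1},H_{i+1})\le D$ for all integers $i>0$ and all $k=1,\dots,n-1$, then $\lim_{i\to\infty}\overline{\mathfrak U(F_i,H_i,K)}$ is a point.
   Context: Positive tuples of flags. A (complete) flag $F$ in $V$ is a nested sequence $F^{(1)}\subset\dots\subset F^{(n-1)}$ of subspaces with $\dim F^{(k)}=k$; $F^{(0)}=\{0\}$, $F^{(n)}=V$. $\mathcal F(V)$ is the (compact) space of flags, with its natural $\mathrm{PGL}(V)$-action. Flags $F,H$ are transverse if $F^{(k)}\cap H^{(n-k)}=\{0\}$ for all $k$. For an ordered basis $\mathcal B$ of $V$, $U_{>0}(\mathcal B)\subset\mathrm{PGL}(V)$ is the set of unipotent elements represented in $\mathcal B$ by an upper triangular matrix with ones on the diagonal all of whose minors are positive, except those forced to be zero by upper triangularity. For $l\ge3$, a tuple $(F_1,\dots,F_l)$ of flags is positive if $F_1,F_l$ are transverse and there are a basis $\mathcal B=(e_1,\dots,e_n)$ with $e_k\in F_1^{(n-k+1)}\cap F_l^{(k)}$ for all $k$ and $u_1,\dots,u_{l-2}\in U_{>0}(\mathcal B)$ with $(F_1,\dots,F_l)=(F_1,u_1\cdot F_1,u_1u_2\cdot F_1,\dots,u_1\cdots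 u_{l-2}\cdot F_1,F_l)$. For a positive triple $(F,H,K)$, $\mathfrak U(F,H,K)=\{G\in\mathcal F(V):(F,G,H,K)\text{ is positive}\}$; the bar denotes closure in $\mathcal F(V)$. Flags in a positive tuple are pairwise transverse. Labourie cross ratio. Fix a linear identification $\Omega:\bigwedge^nV\to\mathbb R$. For pairwise transverse flags $F_1,F_2,F_3,F_4$ and $k\in\{1,\dots,n-1\}$, let $u_i\in\bigwedge^{n-k}V$ be the wedge of a basis of $F_i^{(n-k)}$ for $i=1,2$ and $w_j\in\bigwedge^kV$ the wedge of a basis of $F_j^{(k)}$ for $j=3,4$. Then $B_k(F_1,F_2,F_3,F_4)=\dfrac{\Omega(u_2\wedge w_4)\,\Omega(u_1\wedge w_3)}{\Omega(u_2\wedge w_3)\,\Omega(u_1\wedge w_4)}$, independent of all choices. Convergence of sets. $\lim_{i\to\infty}\overline{\mathfrak U(F_i,H_i,K)}$ being a point means that there is $G\in\mathcal F(V)$ such that these closed sets converge to $\{G\}$ in the Hausdorff sense, i.e. every sequence $G_i\in\overline{\mathfrak U(F_i,H_i,K)}$ converges to $G$. *)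

theory Defs
  imports "HOL-Analysis.Analysis" "Jordan_Normal_Form.Determinant" "Jordan_Normal_Form.DL_Submatrix"
begin

text \<open>
  \<open>'a::euclidean_space\<close> plays the role of the real vector space \<open>V\<close>, with \<open>n = DIM('a)\<close>. The inner
  product is never used; the norm only enters through the topology of the space of linear maps,
  which does not depend on it in finite dimension.
\<close>

definition ordered_basis :: "'a::real_vector list \<Rightarrow> 'a set \<Rightarrow> bool" where
  "ordered_basis bs S \<longleftrightarrow> distinct bs \<and> independent (set bs) \<and> span (set bs) = S"


section \<open>Flags\<close>

text \<open>
  The subspace \<open>F\<^sup>(\<^sup>k\<^sup>)\<close> is indexed by all natural numbers \<open>k\<close>; the dimension condition
  gives \<open>F\<^sup>(\<^sup>0\<^sup>) = {0}\<close> and the normalisation \<open>F\<^sup>(\<^sup>k\<^sup>) = V\<close> for \<open>k \<ge> n\<close>.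
\<close>

typedef (overloaded) ('a::euclidean_space) flag =
  "{F :: nat \<Rightarrow> 'a set.
      \<forall>k. subspace (F k) \<and> dim (F k) = min k DIM('a) \<and> F k \<subseteq> F (Suc k)}"
  morphisms flag_space Abs_flag
proof -
  obtain bs :: "'a list" where bs: "set bs = Basis" "distinct bs"
    using finite_distinct_list[OF finite_Basis] by blast
  have len: "length bs = DIM('a)"
    using bs distinct_card by metis
  have "dim (span (set (take k bs))) = min k DIM('a)" for k
  proof -
    have "independent (set (take k bs))"
      using independent_Basis independent_mono set_take_subset bs(1) by metis
    then have "dim (span (set (take k bs))) = card (set (take k bs))"
      by (simp add: dim_eq_card_independent)
    also have "\<dots> = min k DIM('a)"
      using bs(2) len by (simp add: distinct_card min.commute)
    finally show ?thesis .
  qed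
  moreover have "span (set (take k bs)) \<subseteq> span (set (take (Suc k) bs))" for k
    by (intro span_mono set_take_subset_set_take) simp
  ultimately show ?thesis
    by (intro exI[of _ "\<lambda>k. span (set (take k bs))"]) (simp del: dim_span)
qed

definition transverse :: "'a::euclidean_space flag \<Rightarrow> 'a flag \<Rightarrow> bool" where
  "transverse F H \<longleftrightarrow> (\<forall>k\<le>DIM('a). flag_space F k \<inter> flag_space H (DIM('a) - k) = {0})"

text \<open>
  The action of the class in \<open>PGL(V)\<close> of a linear automorphism \<open>g\<close>; it is only meaningful for
  linear bijections \<open>g\<close>.
\<close>

definition flag_act :: "('a \<Rightarrow> 'a) \<Rightarrow> 'a::euclidean_space flag \<Rightarrow> 'a flag" where
  "flag_act g F = Abs_flag (\<lambda>k. g ` flag_space F k)"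

lemma flag_space_flag_act:
  assumes "linear g" "bij g"
  shows "flag_space (flag_act g F) k = g ` flag_space F k"
proof -
  have F: "\<forall>k. subspace (flag_space F k) \<and> dim (flag_space F k) = min k DIM('a) \<and>
      flag_space F k \<subseteq> flag_space F (Suc k)"
    using flag_space[of F] by (rule CollectD)
  have inj: "inj g"
    using assms(2) by (rule bij_is_inj)
  have "(\<lambda>k. g ` flag_space F k) \<in> {F :: nat \<Rightarrow> 'a set.
      \<forall>k. subspace (F k) \<and> dim (F k) = min k DIM('a) \<and> F k \<subseteq> F (Suc k)}"
  proof (intro CollectI allI conjI)
    fix k
    show "subspace (g ` flag_space F k)"
      using assms(1) F by (blast intro: linear_subspace_image)
    have "dim (g ` flag_space F k) = dim (flag_space F k)"
      using assms(1) inj by (rule dim_image_eq[OF _ inj_on_subset[OF _ subset_UNIV]])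
    then show "dim (g ` flag_space F k) = min k DIM('a)"
      using F by metis
    show "g ` flag_space F k \<subseteq> g ` flag_space F (Suc k)"
      using F by (blast intro: image_mono)
  qed
  then show ?thesis
    unfolding flag_act_def by (subst Abs_flag_inverse) (assumption, rule refl)
qed

text \<open>
  The flag space is homogeneous under \<open>GL(V)\<close> and carries the quotient topology: a set of flags is
  open iff its preimage under every orbit map \<open>g \<mapsto> g \<cdot> F\<close>, defined on \<open>GL(V) \<subseteq> End(V)\<close>, is open.
\<close>

instantiation flag :: (euclidean_space) topological_space
begin

definition open_flag :: "'a flag set \<Rightarrow> bool" where
  "open_flag U \<longleftrightarrow>
    (\<forall>F. openin (top_of_set {g :: 'a \<Rightarrow>\<^sub>L 'a. bij (blinfun_apply g)})
           {g. bij (blinfun_apply g) \<and> flag_act (blinfun_apply g) F \<in> U})"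

instance
proof
  show "open (UNIV :: 'a flag set)"
    unfolding open_flag_def by (simp only: UNIV_I simp_thms openin_subtopology_self)
next
  fix S T :: "'a flag set"
  assume ST: "open S" "open T"
  show "open (S \<inter> T)"
    unfolding open_flag_def
  proof
    fix F :: "'a flag"
    have eq: "{g :: 'a \<Rightarrow>\<^sub>L 'a. bij (blinfun_apply g) \<and> flag_act (blinfun_apply g) F \<in> S \<inter> T} =
        {g. bij (blinfun_apply g) \<and> flag_act (blinfun_apply g) F \<in> S} \<inter>
        {g. bij (blinfun_apply g) \<and> flag_act (blinfun_apply g) F \<in> T}"
      by blast
    show "openin (top_of_set {g :: 'a \<Rightarrow>\<^sub>L 'a. bij (blinfun_apply g)})
        {g. bij (blinfun_apply g) \<and> flag_act (blinfun_apply g) F \<in> S \<inter> T}"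
      unfolding eq
      by (rule openin_Int; rule ST[unfolded open_flag_def, rule_format])
  qed
next
  fix K :: "'a flag set set"
  assume K: "\<forall>S\<in>K. open S"
  show "open (\<Union>K)"
    unfolding open_flag_def
  proof
    fix F :: "'a flag"
    have eq: "{g :: 'a \<Rightarrow>\<^sub>L 'a. bij (blinfun_apply g) \<and> flag_act (blinfun_apply g) F \<in> \<Union>K} =
        \<Union> ((\<lambda>S. {g. bij (blinfun_apply g) \<and> flag_act (blinfun_apply g) F \<in> S}) ` K)"
      by blast
    show "openin (top_of_set {g :: 'a \<Rightarrow>\<^sub>L 'a. bij (blinfun_apply g)})
        {g. bij (blinfun_apply g) \<and> flag_act (blinfun_apply g) F \<in> \<Union>K}"
      unfolding eq
    proof (rule openin_Union, erule imageE, hypsubst)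
      fix S assume "S \<in> K"
      with K have "open S" by (rule bspec)
      then show "openin (top_of_set {g :: 'a \<Rightarrow>\<^sub>L 'a. bij (blinfun_apply g)})
          {g. bij (blinfun_apply g) \<and> flag_act (blinfun_apply g) F \<in> S}"
        unfolding open_flag_def by (rule spec)
    qed
  qed
qed

end


section \<open>Positive tuples of flags\<close>

definition minor :: "real mat \<Rightarrow> nat set \<Rightarrow> nat set \<Rightarrow> real" where
  "minor A I J = Determinant.det (submatrix A I J)"

definition minor_forced_zero :: "nat \<Rightarrow> nat set \<Rightarrow> nat set \<Rightarrow> bool" where
  "minor_forced_zero n I J \<longleftrightarrow>
    (\<forall>A \<in> carrier_mat n n. upper_triangular A \<longrightarrow> minor A I J = 0)"

text \<open>
  Every unipotent element of \<open>PGL(V)\<close> has a unique unipotent lift to \<open>GL(V)\<close>;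
  \<open>U\<^sub>>\<^sub>0(\<B>)\<close> is represented by the set of these lifts. Rows, columns and the basis
  \<open>\<B> = (e\<^sub>1, \<dots>, e\<^sub>n)\<close> are indexed from 0 here, so that \<open>es ! i\<close> is \<open>e\<^sub>i\<^sub>+\<^sub>1\<close>.
\<close>

definition U_pos :: "'a::euclidean_space list \<Rightarrow> ('a \<Rightarrow> 'a) set" where
  "U_pos es = {u. linear u \<and>
    (\<exists>A \<in> carrier_mat DIM('a) DIM('a).
      (\<forall>j<DIM('a). u (es ! j) = (\<Sum>i<DIM('a). A $$ (i, j) *\<^sub>R es ! i)) \<and>
      upper_triangular A \<and>
      (\<forall>i<DIM('a). A $$ (i, i) = 1) \<and>
      (\<forall>I J. I \<subseteq> {..<DIM('a)} \<and> J \<subseteq> {..<DIM('a)} \<and> card I = card J \<and>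
             \<not> minor_forced_zero DIM('a) I J \<longrightarrow> minor A I J > 0))}"

text \<open>
  With \<open>us = [u\<^sub>1, \<dots>, u\<^sub>l\<^sub>-\<^sub>2]\<close>, the map \<open>foldr (\<circ>) (take j us) id\<close> is \<open>u\<^sub>1 \<circ> \<dots> \<circ> u\<^sub>j\<close>.
\<close>

definition positive_tuple :: "'a::euclidean_space flag list \<Rightarrow> bool" where
  "positive_tuple Fs \<longleftrightarrow>
    length Fs \<ge> 3 \<and>
    transverse (hd Fs) (last Fs) \<and>
    (\<exists>es us.
      ordered_basis es UNIV \<and>
      (\<forall>i<DIM('a). es ! i \<in> flag_space (hd Fs) (DIM('a) - i) \<inter> flag_space (last Fs) (Suc i)) \<and>
      length us = length Fs - 2 \<and>
      set us \<subseteq> U_pos es \<and>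
      (\<forall>j<length Fs - 1. Fs ! j = flag_act (foldr (\<circ>) (take j us) id) (hd Fs)))"

definition flag_interval :: "'a::euclidean_space flag \<Rightarrow> 'a flag \<Rightarrow> 'a flag \<Rightarrow> 'a flag set" where
  "flag_interval F H K = {G. positive_tuple [F, G, H, K]}"


section \<open>The Labourie cross ratio\<close>

text \<open>
  A linear identification \<open>\<Omega> : \<And>\<^sup>n V \<rightarrow> \<real>\<close> is given, through the universal property of the
  exterior power, by a nonzero alternating \<open>n\<close>-linear form, here a function on lists of length \<open>n\<close>:
  \<open>\<Omega> [v\<^sub>1, \<dots>, v\<^sub>n]\<close> stands for \<open>\<Omega>(v\<^sub>1 \<and> \<dots> \<and> v\<^sub>n)\<close>.
\<close>

definition volume_form :: "('a::euclidean_space list \<Rightarrow> real) \<Rightarrow> bool" where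
  "volume_form \<Omega> \<longleftrightarrow>
    (\<forall>vs i. length vs = DIM('a) \<and> i < DIM('a) \<longrightarrow> linear (\<lambda>x. \<Omega> (vs[i := x]))) \<and>
    (\<forall>vs. length vs = DIM('a) \<and> \<not> distinct vs \<longrightarrow> \<Omega> vs = 0) \<and>
    (\<exists>vs. length vs = DIM('a) \<and> \<Omega> vs \<noteq> 0)"

definition some_basis :: "'a::real_vector set \<Rightarrow> 'a list" where
  "some_basis S = (SOME bs. ordered_basis bs S)"

text \<open>
  The bases chosen here represent \<open>u\<^sub>1, u\<^sub>2 \<in> \<And>\<^sup>n\<^sup>-\<^sup>k V\<close> and \<open>w\<^sub>3, w\<^sub>4 \<in> \<And>\<^sup>k V\<close>. Another choice rescales each
  of these by a nonzero factor, which cancels in the quotient.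
\<close>

definition cross_ratio ::
  "('a::euclidean_space list \<Rightarrow> real) \<Rightarrow> nat \<Rightarrow> 'a flag \<Rightarrow> 'a flag \<Rightarrow> 'a flag \<Rightarrow> 'a flag \<Rightarrow> real" where
  "cross_ratio \<Omega> k F1 F2 F3 F4 =
    (let u1 = some_basis (flag_space F1 (DIM('a) - k));
         u2 = some_basis (flag_space F2 (DIM('a) - k));
         w3 = some_basis (flag_space F3 k);
         w4 = some_basis (flag_space F4 k)
     in (\<Omega> (u2 @ w4) * \<Omega> (u1 @ w3)) / (\<Omega> (u2 @ w3) * \<Omega> (u1 @ w4)))"


section \<open>Convergence of sets to a point\<close>

text \<open>
  Sequences are indexed from 1. Hausdorff convergence concerns nonempty sets; without that
  requirement the condition on sequences would be vacuous as soon as one set is empty.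
\<close>

definition sets_converge_to_point :: "(nat \<Rightarrow> 'b::topological_space set) \<Rightarrow> 'b \<Rightarrow> bool" where
  "sets_converge_to_point C G \<longleftrightarrow>
    (\<forall>i\<ge>1. C i \<noteq> {}) \<and>
    (\<forall>Gs. (\<forall>i\<ge>1. Gs i \<in> C i) \<longrightarrow> Gs \<longlonglongrightarrow> G)"

end

theory Submission
  imports Defs
begin

text \<open>
  In a basis adapted to the pair \<open>(F 1, K)\<close>, a flag that is transverse to \<open>K\<close> is \<open>u \<cdot> F 1\<close> for exactly
  one linear map \<open>u\<close> with unitriangular matrix. Write \<open>F i = g i \<cdot> F 1\<close> and \<open>H i = h i \<cdot> F 1\<close> in this way.
  Positivity of the given tuples means that consecutive elements differ by totally positive
  factors: \<open>g (i+1) = g i a i\<close>, \<open>h i = g i b i\<close> and \<open>b i = a i b (i+1) c i\<close>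
  (\<open>nested_tuples_coordinates\<close>). Multiplying a nonnegative matrix by a totally positive unitriangular
  one does not decrease any entry, so the matrices \<open>g i\<close> increase, the matrices \<open>h i\<close> decrease, and every
  flag between \<open>F i\<close> and \<open>H i\<close> is \<open>x \<cdot> F 1\<close> with \<open>g i \<le> x \<le> h i\<close> entry by entry. The set of flags
  given by such a box of matrices is closed. The intervals therefore shrink to a
  point as soon as \<open>b i\<close> tends to the identity (\<open>nested_flag_intervals_converge\<close>). The entries of a
  totally positive unitriangular matrix are bounded by products of its superdiagonal entries, so it
  suffices that each superdiagonal entry of \<open>b i\<close> tends to zero.

  The cross ratios control exactly these entries. Fix \<open>k\<close>, put \<open>j = n - k\<close>, and let \<open>\<alpha> i\<close>, \<open>\<beta> i\<close>, \<open>\<gamma> i\<close> be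
  the entries of \<open>a i\<close>, \<open>b i\<close>, \<open>c i\<close> at the superdiagonal position in row \<open>j\<close> (counted from 1). With
  \<open>\<Delta>\<^sub>m\<close> the minor of the first \<open>m\<close> rows and last \<open>m\<close> columns, the \<open>i\<close>-th cross ratio is
  \<open>\<Delta>\<^sub>k(a i b (i+1)) / \<Delta>\<^sub>k(a i)\<close> times \<open>\<Delta>\<^sub>j(b (i+1) c i) / \<Delta>\<^sub>j(c i)\<close>. By the Cauchy-Binet formula the second
  factor is at least 1. Two terms of the same formula, together with a comparison of minors
  (\<open>tpos_last_columns_ratio\<close>) that rests on a three-term Pluecker relation, bound the first factor
  below by \<open>1 + \<beta> (i+1) / \<alpha> i\<close>. Superdiagonal entries add up under multiplication, so
  \<open>\<beta> i = \<alpha> i + \<beta> (i+1) + \<gamma> i\<close>. If the cross ratios are at most \<open>D\<close>, then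
  \<open>\<beta> (i+1) \<le> (D - 1) (\<beta> i - \<beta> (i+1))\<close>. As \<open>\<beta>\<close> is decreasing and positive, its differences tend to zero,
  and hence so does \<open>\<beta>\<close> (\<open>gap_tendsto_zero\<close>).
\<close>

section \<open>Determinants of functions of two indices\<close>

text \<open>
  Matrices are functions here, so that choosing rows and columns is composition with index maps.
\<close>

definition fdet :: "nat \<Rightarrow> (nat \<Rightarrow> nat \<Rightarrow> real) \<Rightarrow> real" where
  "fdet m f = Determinant.det (Matrix.mat m m (\<lambda>(i, j). f i j))"

lemma fdet_cong:
  assumes "\<And>i j. i < m \<Longrightarrow> j < m \<Longrightarrow> f i j = g i j"
  shows "fdet m f = fdet m g"
  unfolding fdet_def by (rule arg_cong[where f = Determinant.det], rule eq_matI) (use assms in auto)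

lemma fdet_leibniz:
  "fdet m f = (\<Sum>p | p permutes {..<m}. of_int (sign p) * (\<Prod>i<m. f i (p i)))"
proof -
  have "(\<Prod>i = 0..<m. Matrix.mat m m (\<lambda>(i, j). f i j) $$ (i, p i)) = (\<Prod>i<m. f i (p i))"
    if "p permutes {..<m}" for p
    unfolding lessThan_atLeast0[symmetric]
    by (intro prod.cong refl) (use permutes_in_image[OF that] in auto)
  then show ?thesis
    unfolding fdet_def det_def'[OF mat_carrier] lessThan_atLeast0[symmetric]
    by (intro sum.cong refl) auto
qed

lemma fdet_transpose: "fdet m (\<lambda>i j. f j i) = fdet m f"
proof -
  have "Matrix.mat m m (\<lambda>(i, j). f j i) = transpose_mat (Matrix.mat m m (\<lambda>(i, j). f i j))"
    by (rule eq_matI) auto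
  then show ?thesis
    unfolding fdet_def by (metis det_transpose mat_carrier)
qed

lemma fdet_scale: "fdet m (\<lambda>i j. r i * f i j * s j) = (\<Prod>i<m. r i) * (\<Prod>j<m. s j) * fdet m f"
proof -
  have "(\<Prod>i<m. r i * f i (p i) * s (p i)) = (\<Prod>i<m. r i) * (\<Prod>j<m. s j) * (\<Prod>i<m. f i (p i))"
    if "p permutes {..<m}" for p
    using prod.permute[OF that, of s] by (simp add: prod.distrib o_def)
  then show ?thesis
    unfolding fdet_leibniz sum_distrib_left by (intro sum.cong refl) auto
qed

text \<open>
  The cofactors along a column do not depend on that column, hence the determinant is a linear
  functional of it.
\<close>

lemma fdet_column:
  assumes "j < m"
  obtains w where "\<And>x. fdet m (\<lambda>i k. if k = j then x i else f i k) = (\<Sum>i<m. x i * w i)"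
proof
  fix x :: "nat \<Rightarrow> real"
  let ?M = "\<lambda>x. Matrix.mat m m (\<lambda>(i, k). if k = j then x i else f i k)"
  have "mat_delete (?M x) i j = mat_delete (?M (\<lambda>_. 0)) i j" if "i < m" for i
    using that assms unfolding mat_delete_def by (intro eq_matI) auto
  then have "cofactor (?M x) i j = cofactor (?M (\<lambda>_. 0)) i j" if "i < m" for i
    using that unfolding cofactor_def by simp
  then show "fdet m (\<lambda>i k. if k = j then x i else f i k) = (\<Sum>i<m. x i * cofactor (?M (\<lambda>_. 0)) i j)"
    unfolding fdet_def laplace_expansion_column[OF mat_carrier assms]
    using assms by (intro sum.cong refl) auto
qed

lemma fdet_eq_columns:
  assumes "j < m" "k < m" "j \<noteq> k" "\<And>i. i < m \<Longrightarrow> f i j = f i k"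
  shows "fdet m f = 0"
  unfolding fdet_def
  by (rule det_identical_columns[OF mat_carrier assms(3,1,2)], rule eq_vecI) (use assms in auto)

lemma fdet_eq_rows:
  assumes "j < m" "k < m" "j \<noteq> k" "\<And>i. i < m \<Longrightarrow> f j i = f k i"
  shows "fdet m f = 0"
proof -
  have "fdet m (\<lambda>i j. f j i) = 0"
    using assms by (intro fdet_eq_columns[of j m k]) auto
  then show ?thesis using fdet_transpose[of m f] by linarith
qed

lemma fdet_row:
  "fdet (Suc m) f = (\<Sum>c\<le>m. (-1) ^ c * f 0 c * fdet m (\<lambda>i j. f (Suc i) (if j < c then j else Suc j)))"
  unfolding fdet_def
  by (subst laplace_expansion_row[OF mat_carrier, of 0])
     (auto simp: lessThan_Suc_atMost cofactor_def mat_delete_def intro!: sum.cong arg_cong[where f = Determinant.det] eq_matI)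

section \<open>Alternating forms and the Cauchy-Binet formula\<close>

definition unit_column :: "nat \<Rightarrow> nat \<Rightarrow> real" where
  "unit_column i = (\<lambda>k. if k = i then 1 else 0)"

lemma sum_unit_column: "r < n \<Longrightarrow> (\<Sum>s<n. a s * unit_column r s) = a r"
  by (simp add: unit_column_def if_distrib[of "\<lambda>x. _ * x"] cong: if_cong)

text \<open>
  \<open>\<Psi> c\<close> depends on the columns \<open>c 0, \<dots>, c (m - 1)\<close>. Linearity is stated as expansion of one column in
  the first \<open>n\<close> unit columns, which makes the entries of a column beyond the first \<open>n\<close> irrelevant. Both
  determinants of matrix products and volume forms are of this kind.
\<close>

definition alternating_form :: "nat \<Rightarrow> nat \<Rightarrow> ((nat \<Rightarrow> nat \<Rightarrow> real) \<Rightarrow> real) \<Rightarrow> bool" where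
  "alternating_form n m \<Psi> \<longleftrightarrow>
    (\<forall>c x j. j < m \<longrightarrow> \<Psi> (c(j := x)) = (\<Sum>i<n. x i * \<Psi> (c(j := unit_column i)))) \<and>
    (\<forall>c j k. j < m \<and> k < m \<and> j \<noteq> k \<and> c j = c k \<longrightarrow> \<Psi> c = 0)"

text \<open>
  Put the sum of the two columns in both places and expand.
\<close>

lemma alternating_form_swap:
  assumes \<Psi>: "alternating_form n m \<Psi>" and ab: "a < m" "b < m" "a \<noteq> b"
  shows "\<Psi> (c \<circ> Transposition.transpose a b) = - \<Psi> c"
proof -
  have lin: "\<Psi> (d(j := x)) = (\<Sum>i<n. x i * \<Psi> (d(j := unit_column i)))" if "j < m" for d x j
    using \<Psi> that unfolding alternating_form_def by blast
  have add: "\<Psi> (d(j := \<lambda>i. x i + y i)) = \<Psi> (d(j := x)) + \<Psi> (d(j := y))" if "j < m" for d x y j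
    using lin[OF that, of d "\<lambda>i. x i + y i"] lin[OF that, of d x] lin[OF that, of d y]
    by (simp only: sum.distrib distrib_right)
  have zero: "\<Psi> d = 0" if "d a = d b" for d
    using \<Psi> ab that unfolding alternating_form_def by blast
  let ?s = "\<lambda>i. c a i + c b i"
  have "0 = \<Psi> (c(a := ?s, b := ?s))"
    by (subst zero) (use ab in auto)
  also have "\<dots> = \<Psi> (c(a := ?s, b := c a)) + \<Psi> (c(a := ?s, b := c b))"
    using add[OF ab(2), of "c(a := ?s)"] by simp
  also have "\<dots> = \<Psi> (c(b := c a, a := ?s)) + \<Psi> (c(b := c b, a := ?s))"
    by (simp only: fun_upd_twist[OF ab(3)])
  also have "\<dots> = \<Psi> (c(b := c a, a := c a)) + \<Psi> (c(b := c a, a := c b))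
      + (\<Psi> (c(b := c b, a := c a)) + \<Psi> (c(b := c b, a := c b)))"
    unfolding add[OF ab(1)] ..
  also have "\<dots> = \<Psi> (c(b := c a, a := c b)) + \<Psi> c"
    using ab by (simp add: zero)
  also have "c(b := c a, a := c b) = c \<circ> Transposition.transpose a b"
    using ab by (auto simp: fun_eq_iff Transposition.transpose_def)
  finally show ?thesis by linarith
qed

lemma alternating_form_permute:
  assumes \<Psi>: "alternating_form n m \<Psi>" and p: "p permutes {..<m}"
  shows "\<Psi> (c \<circ> p) = of_int (sign p) * \<Psi> c"
  using p finite_lessThan[of m]
proof (induction p arbitrary: c rule: permutes_induct)
  case id
  then show ?case by simp
next
  case (swap a b p)
  have "\<Psi> (c \<circ> (Transposition.transpose a b \<circ> p)) = of_int (sign p) * \<Psi> (c \<circ> Transposition.transpose a b)"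
    using swap.IH[of "c \<circ> Transposition.transpose a b"] by (simp only: o_assoc)
  moreover have "sign (Transposition.transpose a b \<circ> p) = sign (Transposition.transpose a b) * sign p"
    using swap by (intro sign_compose permutation_swap_id permutes_imp_permutation[of "{..<m}"]) auto
  ultimately show ?case
    using alternating_form_swap[OF \<Psi>, of a b c] swap by (simp add: sign_swap_id del: o_apply comp_apply)
qed

lemma alternating_form_expand_columns:
  assumes \<Psi>: "alternating_form n m \<Psi>" and "l \<le> m"
  shows "\<Psi> c = (\<Sum>f\<in>{..<l} \<rightarrow>\<^sub>E {..<n}. (\<Prod>j<l. c j (f j)) *
      \<Psi> (\<lambda>j. if j < l then unit_column (f j) else c j))"
  using \<open>l \<le> m\<close>
proof (induction l)
  case 0
  then show ?case by simp
next
  case (Suc l)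
  have lin: "\<Psi> (d(l := x)) = (\<Sum>i<n. x i * \<Psi> (d(l := unit_column i)))" for d x
    using \<Psi> Suc.prems unfolding alternating_form_def by (meson Suc_le_lessD)
  let ?d = "\<lambda>l f j. if j < l then unit_column (f j) else c j"
  have inj: "inj_on (\<lambda>(y, g). g(l := y)) ({..<n} \<times> ({..<l} \<rightarrow>\<^sub>E {..<n}))"
    using inj_combinator[of l "{..<l}" "\<lambda>_. {..<n}"] by simp
  have "(\<Sum>f\<in>{..<Suc l} \<rightarrow>\<^sub>E {..<n}. (\<Prod>j<Suc l. c j (f j)) * \<Psi> (?d (Suc l) f))
      = (\<Sum>(y, g)\<in>{..<n} \<times> ({..<l} \<rightarrow>\<^sub>E {..<n}).
          (\<Prod>j<Suc l. c j ((g(l := y)) j)) * \<Psi> (?d (Suc l) (g(l := y))))"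
    unfolding lessThan_Suc PiE_insert_eq sum.reindex[OF inj]
    by (simp add: case_prod_unfold del: lessThan_Suc)
  also have "\<dots> = (\<Sum>g\<in>{..<l} \<rightarrow>\<^sub>E {..<n}. \<Sum>y<n. 
          (\<Prod>j<l. c j (g j)) * (c l y * \<Psi> ((?d l g)(l := unit_column y))))"
    unfolding sum.cartesian_product[symmetric]
  proof (subst sum.swap, intro sum.cong refl, goal_cases)
    case (1 g y)
    have "?d (Suc l) (g(l := y)) = (?d l g)(l := unit_column y)"
      by (auto simp: fun_eq_iff)
    then show ?case by simp
  qed
  also have "\<dots> = (\<Sum>g\<in>{..<l} \<rightarrow>\<^sub>E {..<n}. (\<Prod>j<l. c j (g j)) * \<Psi> (?d l g))"
  proof (intro sum.cong refl)
    fix g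
    have "?d l g = (?d l g)(l := c l)"
      by auto
    then have "\<Psi> (?d l g) = (\<Sum>y<n. c l y * \<Psi> ((?d l g)(l := unit_column y)))"
      using lin by metis
    then show "(\<Sum>y<n. (\<Prod>j<l. c j (g j)) * (c l y * \<Psi> ((?d l g)(l := unit_column y)))) =
        (\<Prod>j<l. c j (g j)) * \<Psi> (?d l g)"
      by (simp add: sum_distrib_left)
  qed
  finally show ?case
    using Suc by simp
qed

text \<open>
  After expanding all columns, only injective choices of unit columns survive. They are grouped by
  their image \<open>J\<close>; the choices with image \<open>J\<close> are the permutations of the increasing enumeration of \<open>J\<close>,
  and their signed sum is the determinant in the Leibniz formula.
\<close>

theorem alternating_form_expand:
  assumes \<Psi>: "alternating_form n m \<Psi>"
    and local: "\<And>c d. (\<And>j. j < m \<Longrightarrow> c j = d j) \<Longrightarrow> \<Psi> c = \<Psi> d"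
  shows "\<Psi> c = (\<Sum>J | J \<subseteq> {..<n} \<and> card J = m. fdet m (\<lambda>i j. c j (pick J i)) *
      \<Psi> (\<lambda>j. unit_column (pick J j)))"
proof -
  let ?E = "{..<m} \<rightarrow>\<^sub>E {..<n}"
  let ?S = "{J. J \<subseteq> {..<n} \<and> card J = m}"
  let ?t = "\<lambda>f. (\<Prod>j<m. c j (f j)) * \<Psi> (\<lambda>j. unit_column (f j))"
  have fin: "finite ?E" "finite ?S"
    by (auto intro: finite_PiE finite_subset[of _ "Pow {..<n}"])
  have "\<Psi> c = (\<Sum>f\<in>?E. (\<Prod>j<m. c j (f j)) * \<Psi> (\<lambda>j. if j < m then unit_column (f j) else c j))"
    by (rule alternating_form_expand_columns[OF \<Psi> order_refl])
  also have "\<dots> = sum ?t ?E"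
    by (intro sum.cong refl arg_cong2[where f = "(*)"] local) auto
  also have "\<dots> = sum ?t {f \<in> ?E. inj_on f {..<m}}"
  proof (rule sum.mono_neutral_right[OF fin(1)]; safe)
    fix f assume "f \<in> ?E" and ni: "?t f \<noteq> 0"
    show "inj_on f {..<m}"
    proof (rule inj_onI, rule ccontr)
      fix x y assume "x \<in> {..<m}" "y \<in> {..<m}" "f x = f y" "x \<noteq> y"
      then have "\<Psi> (\<lambda>j. unit_column (f j)) = 0"
        using \<Psi> unfolding alternating_form_def by (metis lessThan_iff)
      with ni show False by simp
    qed
  qed
  also have "\<dots> = (\<Sum>J\<in>?S. sum ?t {f \<in> {f \<in> ?E. inj_on f {..<m}}. f ` {..<m} = J})"
  proof (rule sum.group[symmetric])
    show "finite {f \<in> ?E. inj_on f {..<m}}" "finite ?S"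
      using fin by simp_all
    show "(\<lambda>f. f ` {..<m}) ` {f \<in> ?E. inj_on f {..<m}} \<subseteq> ?S"
    proof safe
      fix f x assume "f \<in> ?E" "x < m"
      then show "f x < n" by (auto simp: PiE_def Pi_def)
    qed (simp add: card_image)
  qed
  also have "\<dots> = (\<Sum>J\<in>?S. fdet m (\<lambda>i j. c j (pick J i)) * \<Psi> (\<lambda>j. unit_column (pick J j)))"
  proof (rule sum.cong[OF refl])
    fix J assume "J \<in> ?S"
    then have J: "J \<subseteq> {..<n}" "card J = m" by auto
    have finJ: "finite J" using J finite_subset by blast
    have pin: "pick J i \<in> J" if "i < m" for i
      using pick_in_set J that by auto
    have pinj: "inj_on (pick J) {..<m}"
    proof (rule inj_onI)
      fix x y assume "x \<in> {..<m}" "y \<in> {..<m}" "pick J x = pick J y"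
      then show "x = y"
        using pick_mono[of y J x] pick_mono[of x J y] J(2) by (metis lessThan_iff nat_neq_iff)
    qed
    have pim: "pick J ` {..<m} = J"
      using pin pinj J finJ by (intro card_subset_eq) (auto simp: card_image)
    have perm: "(\<lambda>x. if x < m then inv_into {..<m} (pick J) (f x) else x) permutes {..<m}"
      if f: "f ` {..<m} = J" "inj_on f {..<m}" for f
    proof -
      have "bij_betw (inv_into {..<m} (pick J) \<circ> f) {..<m} {..<m}"
        using bij_betw_trans[of f "{..<m}" J] bij_betw_inv_into[of "pick J" "{..<m}" J] f pinj pim
        by (simp add: bij_betw_def)
      then have "bij_betw (\<lambda>x. if x < m then inv_into {..<m} (pick J) (f x) else x) {..<m} {..<m}"
        by (rule bij_betw_cong[THEN iffD1, rotated]) simp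
      then show ?thesis
        by (rule bij_imp_permutes) simp
    qed
    have "sum ?t {f \<in> {f \<in> ?E. inj_on f {..<m}}. f ` {..<m} = J}
        = (\<Sum>p | p permutes {..<m}. of_int (sign p) * (\<Prod>j<m. c j (pick J (p j))) * \<Psi> (\<lambda>j. unit_column (pick J j)))"
    proof (rule sum.reindex_bij_witness[where
          i = "\<lambda>p. restrict (pick J \<circ> p) {..<m}" and
          j = "\<lambda>f x. if x < m then inv_into {..<m} (pick J) (f x) else x"], goal_cases)
      case (1 f)
      then show ?case
        using f_inv_into_f[of _ "pick J" "{..<m}"] pim
        by (auto simp: fun_eq_iff restrict_def PiE_def extensional_def)
    next
      case (2 f)
      have f: "f ` {..<m} = J" "inj_on f {..<m}" using 2 by auto
      show ?case
        using perm[OF f] by simp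
    next
      case (3 p)
      then have p: "p permutes {..<m}" by simp
      show ?case
        using permutes_in_image[OF p] permutes_not_in[OF p] pinj
        by (auto simp: fun_eq_iff inv_into_f_f)
    next
      case (4 p)
      then have p: "p permutes {..<m}" by simp
      have pm: "p x < m" if "x < m" for x
        using permutes_in_image[OF p, of x] that by simp
      have "(pick J \<circ> p) ` {..<m} = J"
        using permutes_image[OF p] pim by (simp only: image_comp[symmetric])
      moreover have "inj_on (pick J \<circ> p) {..<m}"
        using p pinj by (intro comp_inj_on) (auto simp: permutes_inj_on permutes_image)
      ultimately show ?case
        using pm pin J by (auto simp: inj_on_def)
    next
      case (5 f)
      have f: "f ` {..<m} = J" "inj_on f {..<m}" using 5 by auto
      let ?p = "\<lambda>x. if x < m then inv_into {..<m} (pick J) (f x) else x"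
      have p: "?p permutes {..<m}"
        by (rule perm[OF f])
      have pf: "pick J (?p x) = f x" if "x < m" for x
        using f_inv_into_f[of "f x" "pick J" "{..<m}"] pim f(1) that by auto
      have "\<Psi> (\<lambda>j. unit_column (f j)) = \<Psi> ((\<lambda>j. unit_column (pick J j)) \<circ> ?p)"
        by (rule local, subst o_apply, subst pf) simp_all
      also have "\<dots> = of_int (sign ?p) * \<Psi> (\<lambda>j. unit_column (pick J j))"
        by (rule alternating_form_permute[OF \<Psi> p])
      moreover have "(\<Prod>j<m. c j (pick J (?p j))) = (\<Prod>j<m. c j (f j))"
        by (intro prod.cong refl) (use pf in auto)
      ultimately show ?case by (simp add: mult_ac)
    qed
    also have "\<dots> = fdet m (\<lambda>i j. c i (pick J j)) * \<Psi> (\<lambda>j. unit_column (pick J j))"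
      unfolding fdet_leibniz sum_distrib_right by (simp add: mult_ac)
    finally show "sum ?t {f \<in> {f \<in> ?E. inj_on f {..<m}}. f ` {..<m} = J} =
        fdet m (\<lambda>i j. c j (pick J i)) * \<Psi> (\<lambda>j. unit_column (pick J j))"
      using fdet_transpose[of m "\<lambda>i j. c i (pick J j)"] by simp
  qed
  finally show ?thesis .
qed

text \<open>
  For fixed \<open>X\<close> the left-hand side is an alternating form in the columns of \<open>Y\<close>, whose value on the unit
  columns indexed by \<open>J\<close> is the minor of \<open>X\<close> with columns \<open>J\<close>.
\<close>

theorem Cauchy_Binet:
  "fdet m (\<lambda>i j. \<Sum>s<n. X i s * Y s j) =
    (\<Sum>J | J \<subseteq> {..<n} \<and> card J = m.
      fdet m (\<lambda>i j. X i (pick J j)) * fdet m (\<lambda>i j. Y (pick J i) j))"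
proof -
  define \<Psi> where "\<Psi> = (\<lambda>c :: nat \<Rightarrow> nat \<Rightarrow> real. fdet m (\<lambda>i j. \<Sum>s<n. X i s * c j s))"
  have "alternating_form n m \<Psi>"
    unfolding alternating_form_def
  proof (intro conjI allI impI)
    fix c :: "nat \<Rightarrow> nat \<Rightarrow> real" and x j assume j: "j < m"
    obtain w where w: "\<And>y. fdet m (\<lambda>i k. if k = j then y i else (\<Sum>s<n. X i s * c k s)) = (\<Sum>i<m. y i * w i)"
      using fdet_column[OF j, of "\<lambda>i k. \<Sum>s<n. X i s * c k s"] by blast
    have \<Psi>: "\<Psi> (c(j := y)) = (\<Sum>i<m. (\<Sum>s<n. X i s * y s) * w i)" for y
      unfolding \<Psi>_def w[symmetric] by (intro fdet_cong) simp
    have "\<Psi> (c(j := x)) = (\<Sum>s<n. x s * (\<Sum>i<m. X i s * w i))"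
      unfolding \<Psi> sum_distrib_right sum_distrib_left by (subst sum.swap) (simp add: mult_ac)
    also have "\<dots> = (\<Sum>s<n. x s * \<Psi> (c(j := unit_column s)))"
      unfolding \<Psi> by (intro sum.cong refl) (simp add: sum_unit_column)
    finally show "\<Psi> (c(j := x)) = (\<Sum>s<n. x s * \<Psi> (c(j := unit_column s)))" .
  next
    fix c :: "nat \<Rightarrow> nat \<Rightarrow> real" and j k assume "j < m \<and> k < m \<and> j \<noteq> k \<and> c j = c k"
    then show "\<Psi> c = 0"
      unfolding \<Psi>_def by (intro fdet_eq_columns[of j m k]) auto
  qed
  moreover have "\<Psi> c = \<Psi> d" if "\<And>j. j < m \<Longrightarrow> c j = d j" for c d
    unfolding \<Psi>_def by (intro fdet_cong) (simp add: that)
  ultimately have "\<Psi> (\<lambda>j s. Y s j) = (\<Sum>J | J \<subseteq> {..<n} \<and> card J = m.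
      fdet m (\<lambda>i j. Y (pick J i) j) * \<Psi> (\<lambda>j. unit_column (pick J j)))"
    by (rule alternating_form_expand)
  also have "\<dots> = (\<Sum>J | J \<subseteq> {..<n} \<and> card J = m.
      fdet m (\<lambda>i j. X i (pick J j)) * fdet m (\<lambda>i j. Y (pick J i) j))"
  proof (intro sum.cong refl)
    fix J assume J: "J \<in> {J. J \<subseteq> {..<n} \<and> card J = m}"
    have "(\<Sum>s<n. X i s * unit_column (pick J j) s) = X i (pick J j)" if "j < m" for i j
    proof -
      have "pick J j \<in> J" using pick_in_set[of j J] J that by auto
      then show ?thesis using J by (intro sum_unit_column) auto
    qed
    then have "\<Psi> (\<lambda>j. unit_column (pick J j)) = fdet m (\<lambda>i j. X i (pick J j))"
      unfolding \<Psi>_def by (intro fdet_cong) auto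
    then show "fdet m (\<lambda>i j. Y (pick J i) j) * \<Psi> (\<lambda>j. unit_column (pick J j)) =
        fdet m (\<lambda>i j. X i (pick J j)) * fdet m (\<lambda>i j. Y (pick J i) j)"
      by simp
  qed
  finally show ?thesis unfolding \<Psi>_def by simp
qed

section \<open>A Pluecker relation\<close>

text \<open>
  The \<open>m + 2\<close> columns of \<open>X\<close> satisfy one linear relation in dimension \<open>m + 1\<close>, given by Cramer's rule.
  Forget the last row and apply to this relation the determinant whose other columns are \<open>2, \<dots>, m\<close>.
  This kills the columns \<open>2, \<dots>, m\<close> and leaves three terms.
\<close>

lemma Pluecker_three_term:
  fixes X :: "nat \<Rightarrow> nat \<Rightarrow> real"
  assumes m: "1 \<le> m"
  shows "fdet (Suc m) (\<lambda>r c. X r (Suc c)) * fdet m (\<lambda>r c. X r (if c = 0 then 0 else Suc c))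
    - fdet (Suc m) (\<lambda>r c. X r (if c = 0 then 0 else Suc c)) * fdet m (\<lambda>r c. X r (Suc c))
    = - fdet (Suc m) X * fdet m (\<lambda>r c. X r (Suc (Suc c)))"
proof -
  define D where "D = (\<lambda>c. fdet (Suc m) (\<lambda>r j. X r (if j < c then j else Suc j)))"
  \<comment> \<open>repeating the row \<open>r\<close> gives a square matrix with two equal rows\<close>
  have cramer: "(\<Sum>c\<le>Suc m. (-1) ^ c * X r c * D c) = 0" if "r < Suc m" for r
  proof -
    have "fdet (Suc (Suc m)) (\<lambda>i j. case i of 0 \<Rightarrow> X r j | Suc i \<Rightarrow> X i j) = 0"
      by (rule fdet_eq_rows[of 0 _ "Suc r"]) (use that in auto)
    then show ?thesis
      unfolding D_def by (subst (asm) fdet_row) simp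
  qed
  obtain w where w: "\<And>x. fdet m (\<lambda>i k. if k = 0 then x i else X i (Suc k)) = (\<Sum>i<m. x i * w i)"
    using fdet_column[of 0 m "\<lambda>i k. X i (Suc k)"] m by auto
  define L where "L = (\<lambda>c. fdet m (\<lambda>i k. if k = 0 then X i c else X i (Suc k)))"
  have "(\<Sum>c\<le>Suc m. (-1) ^ c * D c * L c) = (\<Sum>i<m. (\<Sum>c\<le>Suc m. (-1) ^ c * X i c * D c) * w i)"
    unfolding L_def w sum_distrib_left sum_distrib_right by (subst sum.swap) (simp add: mult_ac)
  also have "\<dots> = 0"
    using cramer by simp
  finally have "(\<Sum>c\<le>Suc m. (-1) ^ c * D c * L c) = 0" .
  moreover have "L c = 0" if "2 \<le> c" "c \<le> m" for c
    unfolding L_def by (rule fdet_eq_columns[of 0 m "c - 1"]) (use that in auto)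
  then have "\<forall>c\<in>{..Suc m} - {0, 1, Suc m}. (-1) ^ c * D c * L c = 0"
    by (simp add: Suc_le_eq numeral_2_eq_2)
  then have "(\<Sum>c\<le>Suc m. (-1) ^ c * D c * L c) = (\<Sum>c\<in>{0, 1, Suc m}. (-1) ^ c * D c * L c)"
    by (intro sum.mono_neutral_right) auto
  ultimately have main: "D 0 * L 0 - D 1 * L 1 + (-1) ^ Suc m * D (Suc m) * L (Suc m) = 0"
    using m by simp
  \<comment> \<open>moving the column \<open>m + 1\<close> from the first to the last place is a cycle of length \<open>m\<close>\<close>
  have "L (Suc m) = (-1) ^ (m - 1) * fdet m (\<lambda>r c. X r (Suc (Suc c)))"
  proof -
    let ?A = "Matrix.mat m m (\<lambda>(i, k). if k = 0 then X i (Suc m) else X i (Suc k))"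
    have "L (Suc m) = Determinant.det ?A"
      unfolding L_def fdet_def ..
    also have "\<dots> = (- 1) ^ (1 * (m - 1)) * Determinant.det (Matrix.mat m m (\<lambda>(i, j). ?A $$
        (i, if j < m - 1 then j + 1 else if j < 1 + (m - 1) then j - (m - 1) else j)))"
      by (rule det_swap_initial_cols[OF mat_carrier]) (use m in simp)
    also have "Matrix.mat m m (\<lambda>(i, j). ?A $$
        (i, if j < m - 1 then j + 1 else if j < 1 + (m - 1) then j - (m - 1) else j)) =
        Matrix.mat m m (\<lambda>(i, j). X i (Suc (Suc j)))"
    proof (rule eq_matI, goal_cases)
      case (1 i j)
      then have "Suc (Suc j) = Suc m" if "\<not> j < m - 1"
        using that by simp
      then show ?case using 1 by auto
    qed auto
    finally show ?thesis unfolding fdet_def by simp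
  qed
  then have "(-1) ^ Suc m * L (Suc m) = ((-1) ^ Suc m * (-1) ^ (m - 1)) * fdet m (\<lambda>r c. X r (Suc (Suc c)))"
    by (simp only: mult.assoc)
  also have "(-1 :: real) ^ Suc m * (-1) ^ (m - 1) = 1"
    using m by (cases m) auto
  finally have "D (Suc m) * ((-1) ^ Suc m * L (Suc m)) = D (Suc m) * fdet m (\<lambda>r c. X r (Suc (Suc c)))"
    by simp
  with main have "D 0 * L 0 - D 1 * L 1 = - (D (Suc m) * fdet m (\<lambda>r c. X r (Suc (Suc c))))"
    by (simp only: mult_ac)
  moreover have "D (Suc m) = fdet (Suc m) X"
    unfolding D_def by (intro fdet_cong) auto
  moreover have "D 0 = fdet (Suc m) (\<lambda>r c. X r (Suc c))"
    unfolding D_def by (intro fdet_cong) auto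
  moreover have "D 1 = fdet (Suc m) (\<lambda>r c. X r (if c = 0 then 0 else Suc c))"
    unfolding D_def by (intro fdet_cong) auto
  moreover have "L 0 = fdet m (\<lambda>r c. X r (if c = 0 then 0 else Suc c))"
    unfolding L_def by (intro fdet_cong) auto
  moreover have "L 1 = fdet m (\<lambda>r c. X r (Suc c))"
    unfolding L_def by (intro fdet_cong) auto
  ultimately show ?thesis
    by simp
qed

section \<open>Totally positive unitriangular matrices\<close>

definition mat_times :: "nat \<Rightarrow> (nat \<Rightarrow> nat \<Rightarrow> real) \<Rightarrow> (nat \<Rightarrow> nat \<Rightarrow> real) \<Rightarrow> nat \<Rightarrow> nat \<Rightarrow> real" where
  "mat_times n A B = (\<lambda>i j. \<Sum>s<n. A i s * B s j)"

definition unitriangular :: "nat \<Rightarrow> (nat \<Rightarrow> nat \<Rightarrow> real) \<Rightarrow> bool" where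
  "unitriangular n A \<longleftrightarrow> (\<forall>i<n. (\<forall>j<i. A i j = 0) \<and> A i i = 1)"

text \<open>
  The matrix condition in \<open>U_pos\<close>, freed from the linear map.
\<close>

definition tpos :: "nat \<Rightarrow> (nat \<Rightarrow> nat \<Rightarrow> real) \<Rightarrow> bool" where
  "tpos n A \<longleftrightarrow> unitriangular n A \<and>
    (\<forall>I J. I \<subseteq> {..<n} \<and> J \<subseteq> {..<n} \<and> card I = card J \<and> \<not> minor_forced_zero n I J \<longrightarrow>
      minor (Matrix.mat n n (\<lambda>(i, j). A i j)) I J > 0)"

lemma tpos_unitriangular: "tpos n A \<Longrightarrow> unitriangular n A"
  by (simp add: tpos_def)

lemma unitriangular_mult:
  assumes "unitriangular n A" "unitriangular n B"
  shows "unitriangular n (mat_times n A B)"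
  unfolding unitriangular_def
proof (intro allI impI conjI)
  fix i j assume "i < n" "j < i"
  then have "A i s * B s j = 0" if "s < n" for s
    using assms that by (cases "s < i") (auto simp: unitriangular_def)
  then show "mat_times n A B i j = 0"
    unfolding mat_times_def by (intro sum.neutral) simp
next
  fix i assume i: "i < n"
  have "A i s * B s i = 0" if "s < n" "s \<noteq> i" for s
    using assms that i by (cases "s < i") (auto simp: unitriangular_def)
  then have "(\<Sum>s<n. A i s * B s i) = (\<Sum>s\<in>{i}. A i s * B s i)"
    by (intro sum.mono_neutral_right) (use i in auto)
  then show "mat_times n A B i i = 1"
    using assms i by (simp add: mat_times_def unitriangular_def)
qed

lemma superdiagonal_mult:
  assumes "unitriangular n A" "unitriangular n B" "Suc i < n"
  shows "mat_times n A B i (Suc i) = A i (Suc i) + B i (Suc i)"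
proof -
  have "A i s * B s (Suc i) = 0" if "s < n" "s \<noteq> i" "s \<noteq> Suc i" for s
    using assms that by (cases "s < i") (auto simp: unitriangular_def)
  then have "(\<Sum>s<n. A i s * B s (Suc i)) = (\<Sum>s\<in>{i, Suc i}. A i s * B s (Suc i))"
    by (intro sum.mono_neutral_right) (use assms in auto)
  then show ?thesis
    using assms by (simp add: mat_times_def unitriangular_def)
qed

lemma minor_eq_fdet:
  assumes "I \<subseteq> {..<n}" "J \<subseteq> {..<n}" "card I = m" "card J = m"
  shows "minor (Matrix.mat n n (\<lambda>(i, j). A i j)) I J = fdet m (\<lambda>i j. A (pick I i) (pick J j))"
proof -
  have eq: "{i. i < n \<and> i \<in> I} = I" "{i. i < n \<and> i \<in> J} = J"
    using assms by auto
  have p: "pick I i < n" "pick J i < n" if "i < m" for i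
    using assms pick_in_set[of i I] pick_in_set[of i J] that by auto
  have "submatrix (Matrix.mat n n (\<lambda>(i, j). A i j)) I J =
      Matrix.mat m m (\<lambda>(i, j). A (pick I i) (pick J j))"
    unfolding submatrix_def using p by (intro eq_matI) (simp_all add: eq assms)
  then show ?thesis
    by (simp add: minor_def fdet_def)
qed

lemma pick_image_strict_mono:
  assumes c: "strict_mono_on {..<m} (c :: nat \<Rightarrow> nat)"
  shows "card (c ` {..<m}) = m" and "i < m \<Longrightarrow> pick (c ` {..<m}) i = c i"
proof -
  have inj: "inj_on c {..<m}"
    using c by (rule strict_mono_on_imp_inj_on)
  then show "card (c ` {..<m}) = m"
    by (simp add: card_image)
  assume i: "i < m"
  have "{a \<in> c ` {..<m}. a < c i} = c ` {..<i}"
    using c i by (auto simp: strict_mono_on_def strict_mono_on_less image_iff)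
      (metis lessThan_iff strict_mono_on_less[OF c])
  then have "card {a \<in> c ` {..<m}. a < c i} = i"
    using inj i by (simp add: card_image inj_on_subset)
  then show "pick (c ` {..<m}) i = c i"
    using pick_card_in_set[of "c i" "c ` {..<m}"] i by auto
qed

lemma pick_strict_mono: "strict_mono_on {..<card J} (pick J)"
  by (rule strict_mono_onI) (auto intro: pick_mono)

lemma minor_image_eq_fdet:
  assumes "strict_mono_on {..<m} r" "strict_mono_on {..<m} c"
    and "r ` {..<m} \<subseteq> {..<n}" "c ` {..<m} \<subseteq> {..<n}"
  shows "minor (Matrix.mat n n (\<lambda>(i, j). A i j)) (r ` {..<m}) (c ` {..<m}) =
    fdet m (\<lambda>i j. A (r i) (c j))"
  using assms by (subst minor_eq_fdet[where m = m])
    (auto simp: pick_image_strict_mono intro!: fdet_cong)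

lemma fdet_upper_triangular:
  assumes "\<And>i j. i < m \<Longrightarrow> j < i \<Longrightarrow> f i j = 0"
  shows "fdet m f = (\<Prod>i<m. f i i)"
proof -
  have "fdet m f = prod_list (diag_mat (Matrix.mat m m (\<lambda>(i, j). f i j)))"
    unfolding fdet_def by (rule det_upper_triangular) (use assms in \<open>auto intro!: upper_triangularI\<close>)
  also have "diag_mat (Matrix.mat m m (\<lambda>(i, j). f i j)) = map (\<lambda>i. f i i) [0..<m]"
    by (auto simp: diag_mat_def)
  finally show ?thesis
    by (simp add: prod.distinct_set_conv_list[symmetric] lessThan_atLeast0)
qed

text \<open>
  The matrix with a 1 at each position \<open>(r i, c i)\<close> and zeros elsewhere is upper triangular, and this
  minor of it is 1.
\<close>

lemma not_minor_forced_zero: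
  fixes m :: nat
  assumes r: "strict_mono_on {..<m} r" and c: "strict_mono_on {..<m} c"
    and rn: "r ` {..<m} \<subseteq> {..<n}" and cn: "c ` {..<m} \<subseteq> {..<n}"
    and le: "\<And>i. i < m \<Longrightarrow> r i \<le> c i"
  shows "\<not> minor_forced_zero n (r ` {..<m}) (c ` {..<m})"
proof
  assume fz: "minor_forced_zero n (r ` {..<m}) (c ` {..<m})"
  define E where "E = (\<lambda>a b. if \<exists>i<m. a = r i \<and> b = c i then 1 else 0 :: real)"
  have "upper_triangular (Matrix.mat n n (\<lambda>(i, j). E i j))"
    using le by (fastforce intro!: upper_triangularI simp: E_def)
  then have "fdet m (\<lambda>i j. E (r i) (c j)) = 0"
    using fz minor_image_eq_fdet[OF r c rn cn] unfolding minor_forced_zero_def by (metis mat_carrier)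
  moreover have E: "E (r i) (c j) = (if i = j then 1 else 0)" if "i < m" "j < m" for i j
    using that strict_mono_on_imp_inj_on[OF r] strict_mono_on_imp_inj_on[OF c]
    unfolding E_def inj_on_def by (metis lessThan_iff)
  have "fdet m (\<lambda>i j. E (r i) (c j)) = (\<Prod>i<m. E (r i) (c i))"
    by (rule fdet_upper_triangular) (simp add: E)
  moreover have "\<dots> = 1"
    by (rule prod.neutral) (simp add: E)
  ultimately show False by simp
qed

lemma tpos_minor_nonneg:
  assumes A: "tpos n A" and "I \<subseteq> {..<n}" "J \<subseteq> {..<n}" "card I = card J"
  shows "0 \<le> minor (Matrix.mat n n (\<lambda>(i, j). A i j)) I J"
proof (cases "minor_forced_zero n I J")
  case True
  moreover have "upper_triangular (Matrix.mat n n (\<lambda>(i, j). A i j))"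
    using A by (auto intro!: upper_triangularI simp: tpos_def unitriangular_def)
  ultimately show ?thesis
    unfolding minor_forced_zero_def by (metis mat_carrier order_refl)
next
  case False
  then show ?thesis using assms by (auto simp: tpos_def intro: less_imp_le)
qed

lemma tpos_fdet_nonneg:
  assumes "tpos n A" "strict_mono_on {..<m} r" "strict_mono_on {..<m} c"
    and "r ` {..<m} \<subseteq> {..<n}" "c ` {..<m} \<subseteq> {..<n}"
  shows "0 \<le> fdet m (\<lambda>i j. A (r i) (c j))"
  using tpos_minor_nonneg[OF assms(1,4,5)] assms
  by (simp add: minor_image_eq_fdet pick_image_strict_mono)

lemma tpos_fdet_pos:
  assumes "tpos n A" "strict_mono_on {..<m} r" "strict_mono_on {..<m} c"
    and "r ` {..<m} \<subseteq> {..<n}" "c ` {..<m} \<subseteq> {..<n}" "\<And>i. i < m \<Longrightarrow> r i \<le> c i"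
  shows "0 < fdet m (\<lambda>i j. A (r i) (c j))"
proof -
  have "0 < minor (Matrix.mat n n (\<lambda>(i, j). A i j)) (r ` {..<m}) (c ` {..<m})"
    using assms not_minor_forced_zero[OF assms(2-6)]
    by (simp add: tpos_def pick_image_strict_mono)
  then show ?thesis
    using assms by (simp add: minor_image_eq_fdet)
qed

lemma fdet_1: "fdet (Suc 0) f = f 0 0"
  by (simp add: fdet_row) (simp add: fdet_def)

lemma fdet_2: "fdet (Suc (Suc 0)) f = f 0 0 * f 1 1 - f 0 1 * f 1 0"
  by (simp add: fdet_row[of "Suc 0"] fdet_1 atMost_Suc)

lemma tpos_entry_pos:
  assumes "tpos n A" "i \<le> j" "j < n"
  shows "0 < A i j"
proof -
  have "0 < fdet (Suc 0) (\<lambda>_ _. A i j)"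
    by (rule tpos_fdet_pos[OF assms(1), of "Suc 0" "\<lambda>_. i" "\<lambda>_. j"])
      (use assms in \<open>auto simp: strict_mono_on_def\<close>)
  then show ?thesis by (simp add: fdet_1)
qed

lemma tpos_entry_nonneg:
  assumes "tpos n A" "i < n" "j < n"
  shows "0 \<le> A i j"
  using tpos_entry_pos[of n A i j] assms
  by (cases "i \<le> j") (auto simp: tpos_def unitriangular_def less_imp_le)

lemma tpos_minor_2:
  assumes "tpos n A" "i < k" "k < n" "j < l" "l < n"
  shows "A i l * A k j \<le> A i j * A k l"
proof -
  have "0 \<le> fdet (Suc (Suc 0)) (\<lambda>a b. A (if a = 0 then i else k) (if b = 0 then j else l))"
    by (rule tpos_fdet_nonneg[OF assms(1)]) (use assms in \<open>auto simp: strict_mono_on_def\<close>)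
  then show ?thesis by (simp add: fdet_2)
qed

text \<open>
  For \<open>i < c\<close> this is the minor of the rows \<open>i < c\<close> and the columns \<open>c, c + 1\<close>, in which the diagonal entry of
  row \<open>c\<close> is 1.
\<close>

lemma tpos_entry_submult:
  assumes "tpos n A" "i \<le> c" "Suc c < n"
  shows "A i (Suc c) \<le> A i c * A c (Suc c)"
proof (cases "i = c")
  case True
  then show ?thesis using assms by (simp add: tpos_def unitriangular_def)
next
  case False
  have "A c c = 1" using assms by (simp add: tpos_def unitriangular_def)
  then show ?thesis
    using tpos_minor_2[of n A i c c "Suc c"] assms False by simp
qed

text \<open>
  All terms of the Cauchy-Binet sum are nonnegative, and the term with intermediate index set \<open>I\<close> is
  positive.
\<close>

lemma tpos_mult:
  assumes A: "tpos n A" and B: "tpos n B"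
  shows "tpos n (mat_times n A B)"
  unfolding tpos_def
proof (intro conjI allI impI)
  show "unitriangular n (mat_times n A B)"
    using A B by (simp add: unitriangular_mult tpos_def)
  fix I J assume *: "I \<subseteq> {..<n} \<and> J \<subseteq> {..<n} \<and> card I = card J \<and> \<not> minor_forced_zero n I J"
  let ?A = "Matrix.mat n n (\<lambda>(i, j). A i j)" and ?B = "Matrix.mat n n (\<lambda>(i, j). B i j)"
  let ?S = "{S. S \<subseteq> {..<n} \<and> card S = card J}"
  have fin: "finite ?S" by (rule finite_subset[of _ "Pow {..<n}"]) auto
  have "minor (Matrix.mat n n (\<lambda>(i, j). mat_times n A B i j)) I J = (\<Sum>S\<in>?S. minor ?A I S * minor ?B S J)"
    using * by (subst minor_eq_fdet[where m = "card J"])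
      (auto simp: mat_times_def Cauchy_Binet minor_eq_fdet[where m = "card J"] intro!: sum.cong)
  moreover have "(\<Sum>S\<in>{I}. minor ?A I S * minor ?B S J) \<le> (\<Sum>S\<in>?S. minor ?A I S * minor ?B S J)"
    using * by (intro sum_mono2 fin mult_nonneg_nonneg tpos_minor_nonneg A B) auto
  moreover have "minor ?A I I * minor ?B I J > 0"
  proof (rule mult_pos_pos)
    have "pick I i < n" if "i < card I" for i
      using * pick_in_set[of i I] that by auto
    then show "minor ?A I I > 0"
      using tpos_fdet_pos[OF A pick_strict_mono[of I] pick_strict_mono[of I]] *
      by (auto simp: minor_eq_fdet)
    show "minor ?B I J > 0"
      using B * by (simp add: tpos_def)
  qed
  ultimately show "minor (Matrix.mat n n (\<lambda>(i, j). mat_times n A B i j)) I J > 0"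
    by simp
qed

text \<open>
  If all \<open>d i\<close> have the same sign, the sign cancels in the conjugation and every minor is multiplied by
  a positive number.
\<close>

lemma tpos_diagonal_conjugate:
  assumes A: "tpos n A" and d: "\<And>i. i < n \<Longrightarrow> d i \<noteq> 0"
    and sgn: "\<And>i. i < n \<Longrightarrow> sgn (d i) = sgn (d 0)"
  shows "tpos n (\<lambda>i j. d i * A i j / d j)"
proof -
  define e where "e = (\<lambda>i. sgn (d 0) * d i)"
  have e: "0 < e i" if "i < n" for i
    using d[OF that] sgn[OF that] by (simp add: e_def) (metis mult.commute sgn_mult_self_eq abs_sgn zero_less_abs_iff abs_mult_sgn mult_sgn_abs)
  have eq: "d i * A i j / d j = e i * A i j * inverse (e j)" if "j < n" for i j
    using d[of j] d[of 0] that by (auto simp: e_def field_simps sgn_if split: if_splits)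
  show ?thesis
    unfolding tpos_def
  proof (intro conjI allI impI)
    show "unitriangular n (\<lambda>i j. d i * A i j / d j)"
      using A d by (simp add: tpos_def unitriangular_def)
    fix I J assume *: "I \<subseteq> {..<n} \<and> J \<subseteq> {..<n} \<and> card I = card J \<and> \<not> minor_forced_zero n I J"
    let ?m = "card J"
    have p: "pick I i < n" "pick J i < n" if "i < ?m" for i
      using * pick_in_set[of i I] pick_in_set[of i J] that by auto
    have "minor (Matrix.mat n n (\<lambda>(i, j). d i * A i j / d j)) I J =
        fdet ?m (\<lambda>i j. e (pick I i) * A (pick I i) (pick J j) * inverse (e (pick J j)))"
      using * p by (subst minor_eq_fdet[where m = ?m]) (auto simp: eq intro!: fdet_cong)
    also have "\<dots> = (\<Prod>i<?m. e (pick I i)) * (\<Prod>j<?m. inverse (e (pick J j))) *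
        minor (Matrix.mat n n (\<lambda>(i, j). A i j)) I J"
      using * by (simp add: fdet_scale minor_eq_fdet[where m = ?m])
    also have "\<dots> > 0"
      using A * p e by (intro mult_pos_pos prod_pos) (auto simp: tpos_def)
    finally show "minor (Matrix.mat n n (\<lambda>(i, j). d i * A i j / d j)) I J > 0" .
  qed
qed

text \<open>
  The quotient of the two minors (columns \<open>j, j+1, \<dots>\<close> against columns \<open>j-1, j+1, \<dots>\<close>) decreases
  when a row and a column are added, because the third product in the Pluecker relation has a sign. For
  a single row the quotient is at most the superdiagonal entry.
\<close>

lemma tpos_last_columns_ratio:
  assumes A: "tpos n A" and j: "0 < j" and m: "0 < m" "j + m \<le> n"
  shows "fdet m (\<lambda>r c. A r (j + c)) \<le>
    A (j - 1) j * fdet m (\<lambda>r c. A r (if c = 0 then j - 1 else j + c))"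
  using m
proof (induction m rule: nat_induct_non_zero)
  case 1
  have "A 0 j \<le> A 0 (j - 1) * A (j - 1) j"
    using tpos_entry_submult[OF A, of 0 "j - 1"] 1 j by simp
  then show ?case by (simp add: fdet_1 mult.commute)
next
  case (Suc m)
  let ?P = "\<lambda>m. fdet m (\<lambda>r c. A r (j + c))"
  let ?Q = "\<lambda>m. fdet m (\<lambda>r c. A r (if c = 0 then j - 1 else j + c))"
  let ?X = "\<lambda>r c. A r (j - 1 + c)"
  have nonneg: "0 \<le> fdet k (\<lambda>r c. A r (a + c))" if "k + a \<le> n" for k a
    by (rule tpos_fdet_nonneg[OF A, of k "\<lambda>i. i" "\<lambda>c. a + c"])
      (use that in \<open>auto simp: strict_mono_on_def\<close>)
  have Q: "0 < ?Q m"
    by (rule tpos_fdet_pos[OF A, of m "\<lambda>i. i" "\<lambda>c. if c = 0 then j - 1 else j + c"])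
      (use Suc j in \<open>auto simp: strict_mono_on_def\<close>)
  have PX: "?P k = fdet k (\<lambda>r c. ?X r (Suc c))" for k
    using j by (intro fdet_cong) simp
  have QX: "?Q k = fdet k (\<lambda>r c. ?X r (if c = 0 then 0 else Suc c))" for k
    using j by (intro fdet_cong) auto
  have RX: "fdet m (\<lambda>r c. ?X r (Suc (Suc c))) = fdet m (\<lambda>r c. A r (Suc j + c))"
    using j by (intro fdet_cong) simp
  have "?P (Suc m) * ?Q m - ?Q (Suc m) * ?P m =
      - fdet (Suc m) ?X * fdet m (\<lambda>r c. ?X r (Suc (Suc c)))"
    unfolding PX QX using Suc.hyps by (intro Pluecker_three_term) simp
  moreover have "0 \<le> fdet (Suc m) ?X * fdet m (\<lambda>r c. ?X r (Suc (Suc c)))"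
    unfolding RX using Suc.prems j by (intro mult_nonneg_nonneg nonneg) auto
  ultimately have "?P (Suc m) * ?Q m \<le> ?Q (Suc m) * ?P m"
    by simp
  also have "\<dots> \<le> ?Q (Suc m) * (A (j - 1) j * ?Q m)"
  proof (rule mult_left_mono)
    show "?P m \<le> A (j - 1) j * ?Q m" using Suc by simp
    show "0 \<le> ?Q (Suc m)"
      by (rule tpos_fdet_nonneg[OF A, of _ "\<lambda>i. i" "\<lambda>c. if c = 0 then j - 1 else j + c"])
        (use Suc.prems j in \<open>auto simp: strict_mono_on_def\<close>)
  qed
  finally have "?P (Suc m) * ?Q m \<le> (A (j - 1) j * ?Q (Suc m)) * ?Q m"
    by (simp only: mult_ac)
  then show ?case
    using Q by (rule mult_right_le_imp_le)
qed

section \<open>Corner minors\<close>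

text \<open>
  For unipotent \<open>u\<close>, the corner minor of size \<open>k\<close> of its matrix vanishes exactly when the subspace of
  dimension \<open>n - k\<close> in \<open>F\<close> meets the subspace of dimension \<open>k\<close> in \<open>u \<cdot> F\<close> nontrivially. The cross ratio
  is a quotient of such minors.
\<close>

definition corner_minor :: "nat \<Rightarrow> nat \<Rightarrow> (nat \<Rightarrow> nat \<Rightarrow> real) \<Rightarrow> real" where
  "corner_minor n k A = fdet k (\<lambda>r c. A r (n - k + c))"

lemma corner_minor_pos:
  assumes "tpos n A" "k \<le> n"
  shows "0 < corner_minor n k A"
  unfolding corner_minor_def
  by (rule tpos_fdet_pos[OF assms(1), of k "\<lambda>i. i" "\<lambda>c. n - k + c"])
    (use assms in \<open>auto simp: strict_mono_on_def\<close>)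

text \<open>
  Total positivity makes any part of the Cauchy-Binet sum a lower bound. The parts are given by
  increasing index maps \<open>c\<close> instead of their images.
\<close>

lemma corner_minor_mult:
  assumes A: "tpos n A" and B: "tpos n B" and k: "k \<le> n"
    and C: "finite C" "\<And>c. c \<in> C \<Longrightarrow> strict_mono_on {..<k} c \<and> c ` {..<k} \<subseteq> {..<n}"
      "inj_on (\<lambda>c. c ` {..<k}) C"
  shows "(\<Sum>c\<in>C. fdet k (\<lambda>i j. A i (c j)) * fdet k (\<lambda>i j. B (c i) (n - k + j)))
    \<le> corner_minor n k (mat_times n A B)"
proof -
  let ?S = "{S. S \<subseteq> {..<n} \<and> card S = k}"
  let ?t = "\<lambda>S. fdet k (\<lambda>i j. A i (pick S j)) * fdet k (\<lambda>i j. B (pick S i) (n - k + j))"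
  have "(\<Sum>c\<in>C. fdet k (\<lambda>i j. A i (c j)) * fdet k (\<lambda>i j. B (c i) (n - k + j))) =
      (\<Sum>c\<in>C. ?t (c ` {..<k}))"
    using C(2) by (intro sum.cong refl arg_cong2[where f = "(*)"] fdet_cong) (simp_all add: pick_image_strict_mono)
  also have "\<dots> = sum ?t ((\<lambda>c. c ` {..<k}) ` C)"
    using C(3) by (simp add: sum.reindex)
  also have "\<dots> \<le> sum ?t ?S"
  proof (rule sum_mono2)
    show "finite ?S" by (rule finite_subset[of _ "Pow {..<n}"]) auto
    show "(\<lambda>c. c ` {..<k}) ` C \<subseteq> ?S"
      using C(2) by (auto simp: pick_image_strict_mono)
    fix S assume "S \<in> ?S - (\<lambda>c. c ` {..<k}) ` C"
    then have S: "S \<subseteq> {..<n}" "card S = k" by auto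
    have p: "pick S ` {..<k} \<subseteq> {..<n}"
      using S pick_in_set[of _ S] by auto
    show "0 \<le> ?t S"
      using pick_strict_mono[of S] S p k
      by (intro mult_nonneg_nonneg tpos_fdet_nonneg[OF A, of k "\<lambda>i. i" "pick S"]
          tpos_fdet_nonneg[OF B, of k "pick S" "\<lambda>j. n - k + j"])
        (auto simp: strict_mono_on_def)
  qed
  also have "\<dots> = corner_minor n k (mat_times n A B)"
    unfolding corner_minor_def mat_times_def Cauchy_Binet ..
  finally show ?thesis .
qed

lemma corner_minor_mult_ge_right:
  assumes A: "tpos n A" and B: "tpos n B" and k: "k \<le> n"
  shows "corner_minor n k B \<le> corner_minor n k (mat_times n A B)"
proof -
  have "fdet k A = 1"
    using A k by (subst fdet_upper_triangular) (auto simp: tpos_def unitriangular_def)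
  then show ?thesis
    using corner_minor_mult[OF A B k, of "{\<lambda>i. i}"] k
    by (auto simp: corner_minor_def strict_mono_on_def)
qed

text \<open>
  Two terms of the Cauchy-Binet sum suffice: the last \<open>k\<close> indices, and these with the first of them
  lowered by one. The second term carries the factor \<open>B (j - 1) j\<close>, and \<open>tpos_last_columns_ratio\<close>
  compares its other factor with the corner minor of \<open>A\<close>.
\<close>

lemma corner_minor_mult_growth:
  assumes A: "tpos n A" and B: "tpos n B" and k: "0 < k" "k < n" and j: "j = n - k"
  shows "corner_minor n k A * (1 + B (j - 1) j / A (j - 1) j) \<le> corner_minor n k (mat_times n A B)"
proof -
  let ?c = "\<lambda>c. j + c" and ?d = "\<lambda>c. if c = 0 then j - 1 else j + c"
  have jn: "0 < j" "j < n" "n - k = j" using k j by auto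
  have ne: "?c ` {..<k} \<noteq> ?d ` {..<k}"
  proof -
    have "j \<in> ?c ` {..<k}" using k by (auto intro: image_eqI[of _ _ 0])
    moreover have "j \<notin> ?d ` {..<k}" using jn by auto
    ultimately show ?thesis by metis
  qed
  then have cd: "?c \<noteq> ?d" by metis
  have "fdet k (\<lambda>r c. A r (j + c)) * fdet k (\<lambda>i c. B (j + i) (j + c)) +
      fdet k (\<lambda>r c. A r (?d c)) * fdet k (\<lambda>i c. B (?d i) (j + c))
      \<le> corner_minor n k (mat_times n A B)"
  proof -
    have c: "strict_mono_on {..<k} ?c \<and> ?c ` {..<k} \<subseteq> {..<n}"
      using k j by (auto simp: strict_mono_on_def)
    have d: "strict_mono_on {..<k} ?d \<and> ?d ` {..<k} \<subseteq> {..<n}"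
      using k j by (auto simp: strict_mono_on_def)
    have "inj_on (\<lambda>c. c ` {..<k}) {?c, ?d}"
      by (rule inj_onI, elim insertE emptyE) (simp_all only: ne ne[symmetric])
    then have "(\<Sum>c\<in>{?c, ?d}. fdet k (\<lambda>i j. A i (c j)) * fdet k (\<lambda>i j. B (c i) (n - k + j)))
        \<le> corner_minor n k (mat_times n A B)"
      using c d k by (intro corner_minor_mult[OF A B]) auto
    then show ?thesis
      using cd unfolding jn(3) by (simp only: sum.insert_if finite.intros insert_iff empty_iff simp_thms if_False sum.empty add_0_right)
  qed
  moreover have "fdet k (\<lambda>i c. B (j + i) (j + c)) = 1"
    using B jn k by (subst fdet_upper_triangular) (auto simp: tpos_def unitriangular_def)
  moreover have "fdet k (\<lambda>i c. B (?d i) (j + c)) = B (j - 1) j"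
  proof -
    have "fdet k (\<lambda>i c. B (?d i) (j + c)) = (\<Prod>i<k. B (?d i) (j + i))"
      using B jn k by (subst fdet_upper_triangular) (auto simp: tpos_def unitriangular_def)
    also have "\<dots> = (\<Prod>i<k. if i = 0 then B (j - 1) j else 1)"
      using B jn k by (intro prod.cong refl) (auto simp: tpos_def unitriangular_def)
    also have "\<dots> = B (j - 1) j"
      using k by simp
    finally show ?thesis .
  qed
  moreover have "corner_minor n k A \<le> A (j - 1) j * fdet k (\<lambda>r c. A r (?d c))"
    unfolding corner_minor_def jn(3) by (rule tpos_last_columns_ratio[OF A jn(1) k(1)]) (use k j in simp)
  then have "corner_minor n k A / A (j - 1) j \<le> fdet k (\<lambda>r c. A r (?d c))"
    using tpos_entry_pos[OF A, of "j - 1" j] jn by (simp add: divide_le_eq mult.commute)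
  then have "corner_minor n k A / A (j - 1) j * B (j - 1) j \<le> fdet k (\<lambda>r c. A r (?d c)) * B (j - 1) j"
    using tpos_entry_nonneg[OF B, of "j - 1" j] jn by (intro mult_right_mono) auto
  ultimately show ?thesis
    by (simp add: corner_minor_def jn(3) distrib_left)
qed

section \<open>Coordinates with respect to a basis\<close>

definition coordinate :: "'a::euclidean_space list \<Rightarrow> nat \<Rightarrow> 'a \<Rightarrow> real" where
  "coordinate es i x = representation (set es) x (es ! i)"

definition entries :: "'a::euclidean_space list \<Rightarrow> ('a \<Rightarrow> 'a) \<Rightarrow> nat \<Rightarrow> nat \<Rightarrow> real" where
  "entries es u i j = coordinate es i (u (es ! j))"

lemma ordered_basis_length:
  assumes "ordered_basis es (UNIV :: 'a::euclidean_space set)"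
  shows "length es = DIM('a)"
  using assms basis_card_eq_dim[of "set es" "UNIV :: 'a set"]
  by (simp add: ordered_basis_def distinct_card)

lemma bounded_linear_coordinate:
  "ordered_basis es UNIV \<Longrightarrow> bounded_linear (coordinate es i)"
  unfolding coordinate_def ordered_basis_def by (simp add: bounded_linear_representation)

lemma linear_coordinate: "ordered_basis es UNIV \<Longrightarrow> linear (coordinate es i)"
  by (simp add: bounded_linear.linear bounded_linear_coordinate)

lemma coordinate_basis:
  fixes es :: "'a::euclidean_space list"
  assumes "ordered_basis es UNIV" "i < DIM('a)" "j < DIM('a)"
  shows "coordinate es i (es ! j) = (if i = j then 1 else 0)"
  using assms ordered_basis_length[OF assms(1)]
  by (simp add: coordinate_def ordered_basis_def real_vector.representation_basis nth_eq_iff_index_eq)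

lemma sum_ordered_basis:
  fixes es :: "'a::euclidean_space list"
  assumes "ordered_basis es (UNIV :: 'a set)"
  shows "(\<Sum>b\<in>set es. f b) = (\<Sum>i<DIM('a). f (es ! i))"
proof -
  have "bij_betw ((!) es) {..<DIM('a)} (set es)"
    using assms ordered_basis_length[OF assms] by (intro bij_betw_nth) (auto simp: ordered_basis_def)
  then show ?thesis
    by (rule sum.reindex_bij_betw[symmetric])
qed

lemma coordinate_expansion:
  fixes es :: "'a::euclidean_space list"
  assumes "ordered_basis es UNIV"
  shows "x = (\<Sum>i<DIM('a). coordinate es i x *\<^sub>R es ! i)"
  using assms real_vector.sum_representation_eq[of "set es" x "set es"]
  unfolding coordinate_def sum_ordered_basis[OF assms, symmetric, of "\<lambda>b. representation (set es) x b *\<^sub>R b"]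
  by (simp add: ordered_basis_def)

lemma coordinate_eqI:
  fixes es :: "'a::euclidean_space list"
  assumes "ordered_basis es UNIV" "\<And>i. i < DIM('a) \<Longrightarrow> coordinate es i x = coordinate es i y"
  shows "x = y"
  using coordinate_expansion[OF assms(1), of x] coordinate_expansion[OF assms(1), of y] assms(2)
  by simp

lemma coordinate_sum:
  fixes es :: "'a::euclidean_space list"
  assumes es: "ordered_basis es UNIV" and "i < DIM('a)"
  shows "coordinate es i (\<Sum>j<DIM('a). c j *\<^sub>R es ! j) = c i"
proof -
  have "coordinate es i (\<Sum>j<DIM('a). c j *\<^sub>R es ! j) = (\<Sum>j<DIM('a). c j * coordinate es i (es ! j))"
    using linear_coordinate[OF es, of i] by (simp add: linear_sum linear_scale)
  also have "\<dots> = (\<Sum>j<DIM('a). if j = i then c j else 0)"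
    using assms by (intro sum.cong refl) (simp add: coordinate_basis)
  finally show ?thesis using assms by simp
qed

lemma coordinate_linear_image:
  fixes es :: "'a::euclidean_space list"
  assumes es: "ordered_basis es UNIV" and u: "linear u"
  shows "coordinate es i (u x) = (\<Sum>j<DIM('a). entries es u i j * coordinate es j x)"
proof -
  have "u x = (\<Sum>j<DIM('a). coordinate es j x *\<^sub>R u (es ! j))"
    using u by (subst coordinate_expansion[OF es, of x]) (simp add: linear_sum linear_scale)
  then show ?thesis
    using linear_coordinate[OF es, of i] by (simp add: linear_sum linear_scale entries_def mult.commute)
qed

lemma entries_comp:
  fixes es :: "'a::euclidean_space list"
  assumes "ordered_basis es UNIV" "linear u"
  shows "entries es (u \<circ> v) = mat_times DIM('a) (entries es u) (entries es v)"
  by (simp add: fun_eq_iff mat_times_def entries_def[of _ "u \<circ> v"] coordinate_linear_image[OF assms])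
    (simp add: entries_def)

lemma linear_eq_on_basis:
  fixes es :: "'a::euclidean_space list"
  assumes es: "ordered_basis es UNIV" and "linear u" "linear v"
    and "\<And>j. j < DIM('a) \<Longrightarrow> u (es ! j) = v (es ! j)"
  shows "u = v"
proof
  fix x
  show "u x = v x"
    by (subst (1 2) coordinate_expansion[OF es, of x]) (simp add: assms linear_sum linear_scale)
qed

lemma ordered_basis_map:
  fixes es :: "'a::euclidean_space list" and g :: "'a \<Rightarrow> 'a"
  assumes "ordered_basis es UNIV" "linear g" "bij g"
  shows "ordered_basis (map g es) UNIV"
  using assms unfolding ordered_basis_def
  by (simp add: distinct_map bij_is_inj inj_on_subset[OF bij_is_inj] linear_independent_injective_image
      span_linear_image bij_is_surj)

lemma coordinate_map:
  fixes es :: "'a::euclidean_space list" and g :: "'a \<Rightarrow> 'a"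
  assumes es: "ordered_basis es UNIV" and g: "linear g" "bij g" and i: "i < DIM('a)"
  shows "coordinate (map g es) i (g x) = coordinate es i x"
proof -
  have "g x = (\<Sum>j<DIM('a). coordinate es j x *\<^sub>R map g es ! j)"
    using g ordered_basis_length[OF es]
    by (subst coordinate_expansion[OF es, of x]) (simp add: linear_sum linear_scale)
  then show ?thesis
    using coordinate_sum[OF ordered_basis_map[OF es g] i] by simp
qed

lemma span_basis_subset:
  fixes es :: "'a::euclidean_space list"
  assumes es: "ordered_basis es UNIV" and I: "I \<subseteq> {..<DIM('a)}"
  shows "span ((!) es ` I) = {x. \<forall>i<DIM('a). i \<notin> I \<longrightarrow> coordinate es i x = 0}"
    and "dim (span ((!) es ` I)) = card I"
proof -
  have len: "length es = DIM('a)" by (rule ordered_basis_length[OF es])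
  have sub: "(!) es ` I \<subseteq> set es" using I len by auto
  have inj: "inj_on ((!) es) I"
    using es I len by (intro inj_on_nth) (auto simp: ordered_basis_def)
  have "independent ((!) es ` I)"
    using es sub independent_mono[of "set es" "(!) es ` I"] by (simp add: ordered_basis_def)
  then show "dim (span ((!) es ` I)) = card I"
    using inj by (simp add: dim_eq_card_independent card_image)
  show "span ((!) es ` I) = {x. \<forall>i<DIM('a). i \<notin> I \<longrightarrow> coordinate es i x = 0}"
  proof (intro subset_antisym subsetI CollectI allI impI)
    fix x i assume x: "x \<in> span ((!) es ` I)" and i: "i < DIM('a)" "i \<notin> I"
    have "coordinate es i y = 0" if "y \<in> (!) es ` I" for y
      using that I i coordinate_basis[OF es, of i] by auto
    then show "coordinate es i x = 0"
      by (rule linear_eq_0_on_span[OF linear_coordinate[OF es] _ x])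
  next
    fix x assume x: "x \<in> {x. \<forall>i<DIM('a). i \<notin> I \<longrightarrow> coordinate es i x = 0}"
    have "coordinate es i x *\<^sub>R es ! i \<in> span ((!) es ` I)" if "i < DIM('a)" for i
      using x that by (cases "i \<in> I") (auto intro: span_scale span_base span_zero)
    then show "x \<in> span ((!) es ` I)"
      by (subst coordinate_expansion[OF es, of x]) (auto intro: span_sum)
  qed
qed

section \<open>Unitriangular maps\<close>

text \<open>
  Back substitution from the last coordinate downwards.
\<close>

lemma unitriangular_solve:
  fixes es :: "'a::euclidean_space list"
  assumes es: "ordered_basis es UNIV" and u: "linear u" "unitriangular DIM('a) (entries es u)"
    and zero: "\<And>i. m < i \<Longrightarrow> i < DIM('a) \<Longrightarrow> coordinate es i (u x) = 0" and m: "m < DIM('a)"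
  shows "(\<forall>i. m < i \<and> i < DIM('a) \<longrightarrow> coordinate es i x = 0) \<and> coordinate es m (u x) = coordinate es m x"
proof -
  have step: "coordinate es i (u x) = coordinate es i x"
    if i: "i < DIM('a)" and above: "\<And>s. i < s \<Longrightarrow> s < DIM('a) \<Longrightarrow> coordinate es s x = 0" for i
  proof -
    have "coordinate es i (u x) = (\<Sum>s<DIM('a). entries es u i s * coordinate es s x)"
      by (rule coordinate_linear_image[OF es u(1)])
    also have "\<dots> = (\<Sum>s\<in>{i}. entries es u i s * coordinate es s x)"
    proof (rule sum.mono_neutral_right)
      show "\<forall>s\<in>{..<DIM('a)} - {i}. entries es u i s * coordinate es s x = 0"
      proof
        fix s assume "s \<in> {..<DIM('a)} - {i}"
        then consider "s < i" | "i < s" "s < DIM('a)" by force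
        then show "entries es u i s * coordinate es s x = 0"
          using u(2) above i by cases (auto simp: unitriangular_def)
      qed
    qed (use i in auto)
    finally show ?thesis using u(2) i by (simp add: unitriangular_def)
  qed
  have "coordinate es i x = 0" if "m < i" "i < DIM('a)" for i
    using that
  proof (induction "DIM('a) - i" arbitrary: i rule: less_induct)
    case less
    have "coordinate es i (u x) = coordinate es i x"
      by (rule step) (use less in auto)
    then show ?case using zero less by simp
  qed
  then show ?thesis using step[OF m] by blast
qed

lemma unitriangular_bij:
  fixes es :: "'a::euclidean_space list"
  assumes es: "ordered_basis es UNIV" and u: "linear u" "unitriangular DIM('a) (entries es u)"
  shows "bij u"
proof -
  have "x = 0" if ux: "u x = 0" for x
  proof (rule coordinate_eqI[OF es])
    fix i assume "i < DIM('a)"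
    moreover have "coordinate es k (u x) = 0" for k
      using linear_0[OF linear_coordinate[OF es]] by (simp add: ux)
    ultimately show "coordinate es i x = coordinate es i 0"
      using unitriangular_solve[OF es u, of i x] linear_0[OF linear_coordinate[OF es, of i]] by simp
  qed
  then have "inj u"
    using u(1) by (simp add: linear_injective_0)
  then show ?thesis
    using u(1) linear_injective_imp_surjective by (auto simp: bij_def)
qed

lemma U_pos_iff:
  fixes es :: "'a::euclidean_space list"
  assumes es: "ordered_basis es UNIV"
  shows "u \<in> U_pos es \<longleftrightarrow> linear u \<and> tpos DIM('a) (entries es u)"
proof -
  let ?n = "DIM('a)"
  let ?M = "Matrix.mat ?n ?n (\<lambda>(i, j). entries es u i j)"
  have eq: "A = ?M" if "A \<in> carrier_mat ?n ?n"
    "\<forall>j<?n. u (es ! j) = (\<Sum>i<?n. A $$ (i, j) *\<^sub>R es ! i)" for A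
    using that by (intro eq_matI) (auto simp: entries_def coordinate_sum[OF es])
  have exp: "\<forall>j<?n. u (es ! j) = (\<Sum>i<?n. ?M $$ (i, j) *\<^sub>R es ! i)"
    using coordinate_expansion[OF es] by (auto simp: entries_def)
  have ut: "upper_triangular ?M \<and> (\<forall>i<?n. ?M $$ (i, i) = 1) \<longleftrightarrow> unitriangular ?n (entries es u)"
    by (auto simp: upper_triangular_def unitriangular_def)
  show ?thesis
    unfolding U_pos_def tpos_def mem_Collect_eq ut[symmetric] using eq exp by (auto simp del: index_mat) 
qed

lemma U_posD:
  fixes es :: "'a::euclidean_space list"
  assumes "ordered_basis es UNIV" "u \<in> U_pos es"
  shows "linear u" "tpos DIM('a) (entries es u)" "unitriangular DIM('a) (entries es u)" "bij u"
  using assms unitriangular_bij[OF assms(1)] by (auto simp: U_pos_iff tpos_unitriangular)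

lemma U_pos_comp:
  assumes es: "ordered_basis es UNIV" and "u \<in> U_pos es" "v \<in> U_pos es"
  shows "u \<circ> v \<in> U_pos es"
  using assms by (auto simp: U_pos_iff[OF es] entries_comp[OF es] tpos_mult linear_compose)

lemma tpos_cong:
  assumes "\<And>i j. i < n \<Longrightarrow> j < n \<Longrightarrow> A i j = B i j"
  shows "tpos n A \<longleftrightarrow> tpos n B"
proof -
  have "Matrix.mat n n (\<lambda>(i, j). A i j) = Matrix.mat n n (\<lambda>(i, j). B i j)"
    using assms by (intro eq_matI) auto
  then show ?thesis
    using assms by (simp add: tpos_def unitriangular_def)
qed

lemma U_pos_map_iff:
  fixes es :: "'a::euclidean_space list" and g u :: "'a \<Rightarrow> 'a"
  assumes es: "ordered_basis es UNIV" and g: "linear g" "bij g" and u: "linear u"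
  shows "g \<circ> u \<circ> inv_into UNIV g \<in> U_pos (map g es) \<longleftrightarrow> u \<in> U_pos es"
proof -
  have lin_inv: "linear (inv_into UNIV g)"
    using g by (intro inj_linear_imp_inv_linear) (auto simp: bij_def)
  have "entries (map g es) (g \<circ> u \<circ> inv_into UNIV g) i j = entries es u i j" if "i < DIM('a)" "j < DIM('a)" for i j
    using that g ordered_basis_length[OF es]
    by (simp add: entries_def coordinate_map[OF es g] inv_f_f[OF bij_is_inj])
  then have "tpos DIM('a) (entries (map g es) (g \<circ> u \<circ> inv_into UNIV g)) \<longleftrightarrow> tpos DIM('a) (entries es u)"
    by (rule tpos_cong)
  then show ?thesis
    using u lin_inv g by (simp add: U_pos_iff[OF es] U_pos_iff[OF ordered_basis_map[OF es g]] linear_compose)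
qed

section \<open>Flags\<close>

lemma flag_space_props:
  fixes F :: "'a::euclidean_space flag"
  shows subspace_flag: "subspace (flag_space F k)"
    and dim_flag: "dim (flag_space F k) = min k DIM('a)"
    and flag_Suc: "flag_space F k \<subseteq> flag_space F (Suc k)"
  using flag_space[of F] by auto

lemma flag_mono: "k \<le> l \<Longrightarrow> flag_space F k \<subseteq> flag_space F l"
  using flag_Suc by (rule lift_Suc_mono_le)

lemma flag_eqI:
  assumes "\<And>k. flag_space F k \<subseteq> flag_space G k"
  shows "F = G"
proof -
  have "flag_space F k = flag_space G k" for k
    using assms[of k] by (intro subspace_dim_equal) (auto simp: subspace_flag dim_flag)
  then show ?thesis
    by (metis ext flag_space_inject)
qed

lemma flag_act_id: "flag_act id F = F"
  by (rule flag_eqI) (simp add: flag_space_flag_act linear_iff)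

lemma flag_act_comp:
  assumes "linear u" "bij u" "linear v" "bij v"
  shows "flag_act (u \<circ> v) F = flag_act u (flag_act v F)"
  by (rule flag_eqI) (use assms in \<open>simp add: flag_space_flag_act linear_compose bij_comp image_comp\<close>)

text \<open>
  \<open>K\<close> is the ascending and \<open>F\<close> the descending coordinate flag of the basis.
\<close>

definition adapted_basis :: "'a::euclidean_space list \<Rightarrow> 'a flag \<Rightarrow> 'a flag \<Rightarrow> bool" where
  "adapted_basis es F K \<longleftrightarrow> ordered_basis es UNIV \<and>
    (\<forall>i<DIM('a). es ! i \<in> flag_space F (DIM('a) - i) \<inter> flag_space K (Suc i))"

lemma adapted_flag_span:
  fixes es :: "'a::euclidean_space list"
  assumes "adapted_basis es F K" "k \<le> DIM('a)"
  shows "flag_space K k = span ((!) es ` {..<k})"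
    and "flag_space F k = span ((!) es ` {DIM('a) - k..<DIM('a)})"
proof -
  have es: "ordered_basis es UNIV"
    and F: "\<And>i. i < DIM('a) \<Longrightarrow> es ! i \<in> flag_space F (DIM('a) - i)"
    and K: "\<And>i. i < DIM('a) \<Longrightarrow> es ! i \<in> flag_space K (Suc i)"
    using assms(1) by (auto simp: adapted_basis_def)
  have "(!) es ` {..<k} \<subseteq> flag_space K k"
    using K assms(2) flag_mono[of "Suc _" k K] by (force simp: Suc_le_eq)
  then show "flag_space K k = span ((!) es ` {..<k})"
    using assms(2) span_basis_subset(2)[OF es, of "{..<k}"]
    by (intro subspace_dim_equal[symmetric] span_minimal)
      (auto simp: subspace_flag dim_flag subspace_span simp del: dim_span)
  have atLeastLessThan_subset: "{DIM('a) - k..<DIM('a)} \<subseteq> {..<DIM('a)}" by auto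
  have "(!) es ` {DIM('a) - k..<DIM('a)} \<subseteq> flag_space F k"
    using F assms(2) flag_mono[of "DIM('a) - _" k F] by (force simp: le_diff_conv)
  then show "flag_space F k = span ((!) es ` {DIM('a) - k..<DIM('a)})"
    using assms(2) span_basis_subset(2)[OF es, of "{DIM('a) - k..<DIM('a)}", OF atLeastLessThan_subset]
    by (intro subspace_dim_equal[symmetric] span_minimal)
      (simp_all add: subspace_flag dim_flag subspace_span del: dim_span)
qed

lemma adapted_flag_mem:
  fixes es :: "'a::euclidean_space list"
  assumes "adapted_basis es F K" "k \<le> DIM('a)"
  shows "x \<in> flag_space K k \<longleftrightarrow> (\<forall>i<DIM('a). k \<le> i \<longrightarrow> coordinate es i x = 0)"
    and "x \<in> flag_space F k \<longleftrightarrow> (\<forall>i<DIM('a) - k. coordinate es i x = 0)"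
proof -
  have es: "ordered_basis es UNIV" using assms by (simp add: adapted_basis_def)
  show "x \<in> flag_space K k \<longleftrightarrow> (\<forall>i<DIM('a). k \<le> i \<longrightarrow> coordinate es i x = 0)"
    unfolding adapted_flag_span(1)[OF assms] using assms(2)
    by (subst span_basis_subset(1)[OF es]) (auto simp: not_less)
  show "x \<in> flag_space F k \<longleftrightarrow> (\<forall>i<DIM('a) - k. coordinate es i x = 0)"
    unfolding adapted_flag_span(2)[OF assms] using assms(2)
    by (subst span_basis_subset(1)[OF es]) (auto simp: not_le)
qed

lemma adapted_transverse:
  fixes F K :: "'a::euclidean_space flag"
  assumes "adapted_basis es F K"
  shows "transverse F K"
  unfolding transverse_def
proof (intro allI impI subset_antisym subsetI)
  have es: "ordered_basis es UNIV" using assms by (simp add: adapted_basis_def)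
  fix k x assume k: "k \<le> DIM('a)" and x: "x \<in> flag_space F k \<inter> flag_space K (DIM('a) - k)"
  have "coordinate es i x = 0" if "i < DIM('a)" for i
  proof (cases "i < DIM('a) - k")
    case True
    then show ?thesis
      using adapted_flag_mem(2)[OF assms k] x by blast
  next
    case False
    then show ?thesis
      using adapted_flag_mem(1)[OF assms diff_le_self] x that by (metis IntD2 not_less)
  qed
  then have "x = 0"
    using linear_0[OF linear_coordinate[OF es]] by (intro coordinate_eqI[OF es]) simp
  then show "x \<in> {0}" by simp
qed (simp add: subspace_0 subspace_flag)

lemma adapted_basis_translate:
  fixes F K :: "'a::euclidean_space flag"
  assumes es: "adapted_basis es F K" and g: "linear g" "unitriangular DIM('a) (entries es g)"
  shows "adapted_basis (map g es) (flag_act g F) K"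
proof -
  have b: "ordered_basis es UNIV" using es by (simp add: adapted_basis_def)
  have g': "bij g" by (rule unitriangular_bij[OF b g])
  have "g (es ! i) \<in> flag_space K (Suc i)" if "i < DIM('a)" for i
    using that g(2) by (subst adapted_flag_mem(1)[OF es]) (auto simp: unitriangular_def entries_def)
  then show ?thesis
    using es ordered_basis_length[OF b]
    by (auto simp: adapted_basis_def ordered_basis_map[OF b g(1) g'] flag_space_flag_act g g')
qed

text \<open>
  For each \<open>j\<close>, the vector \<open>v (es ! j)\<close> is \<open>u x\<close> with \<open>x\<close> in the span of the basis vectors from \<open>j\<close> on. Back
  substitution shows that \<open>x\<close> has no coordinates after \<open>j\<close> and coordinate 1 at \<open>j\<close>.
\<close>

lemma unitriangular_flag_act_inj:
  fixes F K :: "'a::euclidean_space flag"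
  assumes es: "adapted_basis es F K"
    and u: "linear u" "unitriangular DIM('a) (entries es u)"
    and v: "linear v" "unitriangular DIM('a) (entries es v)"
    and eq: "flag_act u F = flag_act v F"
  shows "u = v"
proof (rule linear_eq_on_basis)
  show b: "ordered_basis es UNIV" using es by (simp add: adapted_basis_def)
  fix j assume j: "j < DIM('a)"
  have bij: "bij u" "bij v"
    using unitriangular_bij[OF b u] unitriangular_bij[OF b v] .
  have "v (es ! j) \<in> v ` flag_space F (DIM('a) - j)"
    using es j by (auto simp: adapted_basis_def)
  also have "v ` flag_space F (DIM('a) - j) = u ` flag_space F (DIM('a) - j)"
    using eq bij u v by (metis flag_space_flag_act)
  finally obtain x where x: "v (es ! j) = u x" "x \<in> flag_space F (DIM('a) - j)"
    by blast
  have low: "coordinate es i x = 0" if "i < j" for i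
    using x(2) j that by (subst (asm) adapted_flag_mem(2)[OF es]) auto
  have "coordinate es i (u x) = 0" if "j < i" "i < DIM('a)" for i
    unfolding x(1)[symmetric] using v(2) that by (simp add: unitriangular_def entries_def)
  note solved = unitriangular_solve[OF b u this j]
  have "coordinate es i x = 0" if "j < i" "i < DIM('a)" for i
    using solved that by blast
  moreover have "coordinate es j x = 1"
    using solved v(2) j by (simp add: x(1)[symmetric] unitriangular_def entries_def)
  ultimately have "x = es ! j"
    using low j by (intro coordinate_eqI[OF b]) (metis coordinate_basis[OF b] linorder_neqE_nat)
  then show "u (es ! j) = v (es ! j)"
    using x by simp
qed fact+

text \<open>
  The positive unipotents do not depend on the adapted basis, once some flag is a positive translate of
  \<open>F\<close> in both bases. The two bases differ by nonzero factors \<open>d i\<close>, and the superdiagonal entries of the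
  common element are positive in both, so all \<open>d i\<close> have the same sign.
\<close>

lemma U_pos_adapted_mono:
  fixes F K :: "'a::euclidean_space flag"
  assumes es: "adapted_basis es F K" and es': "adapted_basis es' F K"
    and u: "u \<in> U_pos es" and u': "u' \<in> U_pos es'" and eq: "flag_act u F = flag_act u' F"
  shows "U_pos es' \<subseteq> U_pos es"
proof -
  let ?n = "DIM('a)"
  have b: "ordered_basis es UNIV" and b': "ordered_basis es' UNIV"
    using es es' by (auto simp: adapted_basis_def)
  define d where "d i = coordinate es i (es' ! i)" for i
  have off: "coordinate es k (es' ! i) = (if k = i then d i else 0)" if i: "i < ?n" and k: "k < ?n" for i k
  proof -
    have "es' ! i \<in> flag_space F (?n - i)" "es' ! i \<in> flag_space K (Suc i)"
      using es' i by (auto simp: adapted_basis_def)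
    then have "k < i \<Longrightarrow> coordinate es k (es' ! i) = 0" "i < k \<Longrightarrow> coordinate es k (es' ! i) = 0"
      using i k adapted_flag_mem[OF es] by auto
    then show ?thesis by (cases k i rule: linorder_cases) (auto simp: d_def)
  qed
  have es'_eq: "es' ! i = d i *\<^sub>R es ! i" if "i < ?n" for i
    using that linear_scale[OF linear_coordinate[OF b]]
    by (intro coordinate_eqI[OF b]) (simp add: off coordinate_basis[OF b])
  have d: "d i \<noteq> 0" if "i < ?n" for i
  proof
    assume "d i = 0"
    then have "0 \<in> set es'"
      using es'_eq[OF that] ordered_basis_length[OF b'] that by (metis nth_mem scaleR_zero_left)
    then show False
      using b' dependent_zero by (auto simp: ordered_basis_def)
  qed
  have coord: "coordinate es i x = coordinate es' i x * d i" if "i < ?n" for i x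
  proof -
    have "x = (\<Sum>i<?n. (coordinate es' i x * d i) *\<^sub>R es ! i)"
      using coordinate_expansion[OF b', of x] by (simp add: es'_eq)
    then show ?thesis
      using coordinate_sum[OF b that] by metis
  qed
  have ent: "entries es v i j = d i * entries es' v i j / d j" if "linear v" "i < ?n" "j < ?n" for v i j
    using that d[of j] linear_scale[OF linear_coordinate[OF b']] 
    by (simp add: entries_def es'_eq coord linear_scale)
  have ut: "unitriangular ?n (entries es v)" if "linear v" "unitriangular ?n (entries es' v)" for v
    using that d by (auto simp: unitriangular_def ent)
  have "u = u'"
    by (rule unitriangular_flag_act_inj[OF es _ _ _ _ eq]) (use U_posD[OF b u] U_posD[OF b' u'] ut in auto)
  have sgn: "sgn (d i) = sgn (d 0)" if "i < ?n" for i
    using that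
  proof (induction i)
    case (Suc i)
    have "0 < entries es u i (Suc i)" "0 < entries es' u i (Suc i)"
      using U_posD(2)[OF b u] U_posD(2)[OF b' u'] Suc \<open>u = u'\<close> by (auto intro: tpos_entry_pos)
    moreover have "entries es u i (Suc i) = d i * entries es' u i (Suc i) / d (Suc i)"
      using Suc U_posD[OF b u] by (intro ent) auto
    ultimately have "0 < d i / d (Suc i)"
      by (auto simp: zero_less_divide_iff zero_less_mult_iff mult_less_0_iff)
    then have "sgn (d (Suc i)) = sgn (d i)"
      by (auto simp: zero_less_divide_iff)
    then show ?case using Suc by simp
  qed simp
  show ?thesis
  proof
    fix v assume v: "v \<in> U_pos es'"
    have "tpos ?n (\<lambda>i j. d i * entries es' v i j / d j)"
      using U_posD(2)[OF b' v] d sgn by (rule tpos_diagonal_conjugate)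
    then have "tpos ?n (entries es v)"
      by (subst tpos_cong) (use U_posD[OF b' v] ent in auto)
    then show "v \<in> U_pos es"
      using U_posD[OF b' v] by (simp add: U_pos_iff[OF b])
  qed
qed

section \<open>Volume forms\<close>

text \<open>
  The case \<open>ws = []\<close> evaluates a volume form by a determinant; in general the lemma describes a change of
  basis of the subspace spanned by \<open>bs\<close>.
\<close>

lemma volume_form_expand:
  fixes \<Omega> :: "'a::euclidean_space list \<Rightarrow> real"
  assumes \<Omega>: "volume_form \<Omega>" and m: "length bs = m" "m + length ws = DIM('a)"
  shows "\<Omega> (map (\<lambda>j. \<Sum>i<m. c j i *\<^sub>R bs ! i) [0..<m] @ ws) = fdet m (\<lambda>i j. c j i) * \<Omega> (bs @ ws)"
proof -
  define S where "S = (\<lambda>x. \<Sum>i<m. x i *\<^sub>R bs ! i)"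
  define L where "L = (\<lambda>c :: nat \<Rightarrow> nat \<Rightarrow> real. map (\<lambda>j. S (c j)) [0..<m] @ ws)"
  define \<Psi> where "\<Psi> = (\<lambda>c. \<Omega> (L c))"
  have len: "length (L c) = DIM('a)" for c
    using m by (simp add: L_def)
  have S_unit: "S (unit_column i) = bs ! i" if "i < m" for i
  proof -
    have "S (unit_column i) = (\<Sum>k<m. if k = i then bs ! k else 0)"
      unfolding S_def by (intro sum.cong refl) (simp add: unit_column_def)
    then show ?thesis using that by simp
  qed
  have upd: "L (c(j := x)) = (L c)[j := S x]" if "j < m" for c j x
    using that by (intro nth_equalityI) (auto simp: L_def nth_append nth_list_update)
  have "alternating_form m m \<Psi>"
    unfolding alternating_form_def
  proof (intro conjI allI impI)
    fix c :: "nat \<Rightarrow> nat \<Rightarrow> real" and x j assume j: "j < m"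
    have lin: "linear (\<lambda>y. \<Omega> ((L c)[j := y]))"
      using \<Omega> len j m unfolding volume_form_def by simp
    have "\<Psi> (c(j := x)) = \<Omega> ((L c)[j := S x])"
      unfolding \<Psi>_def upd[OF j] ..
    also have "\<dots> = (\<Sum>i<m. x i * \<Omega> ((L c)[j := bs ! i]))"
      unfolding S_def linear_sum[OF lin] by (simp add: linear_scale[OF lin])
    also have "\<dots> = (\<Sum>i<m. x i * \<Psi> (c(j := unit_column i)))"
      unfolding \<Psi>_def upd[OF j] by (simp add: S_unit)
    finally show "\<Psi> (c(j := x)) = (\<Sum>i<m. x i * \<Psi> (c(j := unit_column i)))" .
  next
    fix c :: "nat \<Rightarrow> nat \<Rightarrow> real" and j k assume jk: "j < m \<and> k < m \<and> j \<noteq> k \<and> c j = c k"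
    then have "L c ! j = L c ! k" "j < length (L c)" "k < length (L c)"
      by (auto simp: L_def nth_append)
    then have "\<not> distinct (L c)"
      using jk nth_eq_iff_index_eq by blast
    then show "\<Psi> c = 0"
      using \<Omega> len unfolding volume_form_def \<Psi>_def by blast
  qed
  moreover have "\<Psi> c = \<Psi> d" if "\<And>j. j < m \<Longrightarrow> c j = d j" for c d
    unfolding \<Psi>_def L_def using that by (intro arg_cong[where f = \<Omega>] arg_cong2[where f = append] map_cong) auto
  ultimately have "\<Psi> c = (\<Sum>J | J \<subseteq> {..<m} \<and> card J = m.
      fdet m (\<lambda>i j. c j (pick J i)) * \<Psi> (\<lambda>j. unit_column (pick J j)))"
    by (rule alternating_form_expand)
  also have "{J. J \<subseteq> {..<m} \<and> card J = m} = {{..<m}}"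
    using card_subset_eq[of "{..<m}"] by auto
  also have "(\<Sum>J\<in>{{..<m}}. fdet m (\<lambda>i j. c j (pick J i)) * \<Psi> (\<lambda>j. unit_column (pick J j))) =
      fdet m (\<lambda>i j. c j i) * \<Omega> (bs @ ws)"
  proof -
    have p: "pick {..<m} i = i" if "i < m" for i
      using pick_image_strict_mono(2)[of m "\<lambda>i. i" i] that by (simp add: strict_mono_on_def)
    have "L (\<lambda>j. unit_column (pick {..<m} j)) = bs @ ws"
      using m by (intro nth_equalityI) (auto simp: L_def nth_append p S_unit)
    moreover have "fdet m (\<lambda>i j. c j (pick {..<m} i)) = fdet m (\<lambda>i j. c j i)"
      by (intro fdet_cong) (simp add: p)
    ultimately show ?thesis by (simp add: \<Psi>_def)
  qed
  finally show ?thesis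
    unfolding \<Psi>_def L_def S_def .
qed

lemma volume_form_eq_fdet:
  fixes \<Omega> :: "'a::euclidean_space list \<Rightarrow> real"
  assumes \<Omega>: "volume_form \<Omega>" and es: "ordered_basis es UNIV" and vs: "length vs = DIM('a)"
  shows "\<Omega> vs = fdet DIM('a) (\<lambda>i j. coordinate es i (vs ! j)) * \<Omega> es"
proof -
  have "map (\<lambda>j. \<Sum>i<DIM('a). coordinate es i (vs ! j) *\<^sub>R es ! i) [0..<DIM('a)] @ [] = vs"
    using vs by (intro nth_equalityI) (auto simp: coordinate_expansion[OF es, symmetric])
  then show ?thesis
    using volume_form_expand[OF \<Omega> ordered_basis_length[OF es], of "[]" "\<lambda>j i. coordinate es i (vs ! j)"]
    by simp
qed

lemma volume_form_nonzero:
  fixes \<Omega> :: "'a::euclidean_space list \<Rightarrow> real"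
  assumes "volume_form \<Omega>" and es: "ordered_basis es UNIV"
  shows "\<Omega> es \<noteq> 0"
proof -
  obtain vs where "length vs = DIM('a)" "\<Omega> vs \<noteq> 0"
    using assms(1) unfolding volume_form_def by blast
  then show ?thesis
    using volume_form_eq_fdet[OF assms, of vs] by auto
qed

lemma volume_form_change_basis:
  fixes \<Omega> :: "'a::euclidean_space list \<Rightarrow> real"
  assumes \<Omega>: "volume_form \<Omega>" and bs: "ordered_basis bs S" and bs': "ordered_basis bs' S"
  obtains \<kappa> where "\<And>ws. length bs + length ws = DIM('a) \<Longrightarrow> \<Omega> (bs @ ws) = \<kappa> * \<Omega> (bs' @ ws)"
proof
  fix ws :: "'a list" assume ws: "length bs + length ws = DIM('a)"
  have dim: "card (set bs) = dim S" "card (set bs') = dim S"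
    using bs bs' dim_eq_card_independent dim_span unfolding ordered_basis_def by metis+
  then have len: "length bs' = length bs"
    using bs bs' by (simp add: ordered_basis_def distinct_card)
  have "bij_betw ((!) bs') {..<length bs} (set bs')"
    using bs' len by (intro bij_betw_nth) (auto simp: ordered_basis_def)
  then have sum: "(\<Sum>i<length bs. f (bs' ! i)) = sum f (set bs')" for f :: "'a \<Rightarrow> 'a"
    by (rule sum.reindex_bij_betw)
  have "(\<Sum>i<length bs. representation (set bs') (bs ! j) (bs' ! i) *\<^sub>R bs' ! i) = bs ! j"
    if "j < length bs" for j
  proof -
    have "bs ! j \<in> span (set bs')"
      using that bs bs' unfolding ordered_basis_def by (metis nth_mem span_base)
    then show ?thesis
      using bs' unfolding sum[of "\<lambda>b. representation (set bs') (bs ! j) b *\<^sub>R b"] by (intro real_vector.sum_representation_eq) (auto simp: ordered_basis_def)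
  qed
  then have "map (\<lambda>j. \<Sum>i<length bs. representation (set bs') (bs ! j) (bs' ! i) *\<^sub>R bs' ! i) [0..<length bs] = bs"
    by (intro nth_equalityI) auto
  then show "\<Omega> (bs @ ws) =
      fdet (length bs) (\<lambda>i j. representation (set bs') (bs ! j) (bs' ! i)) * \<Omega> (bs' @ ws)"
    using volume_form_expand[OF \<Omega> len ws, of "\<lambda>j i. representation (set bs') (bs ! j) (bs' ! i)"]
    by simp
qed

text \<open>
  A rotated form makes it possible to exchange the two blocks of arguments without computing the sign.
\<close>

lemma volume_form_rotate:
  fixes \<Omega> :: "'a::euclidean_space list \<Rightarrow> real"
  assumes \<Omega>: "volume_form \<Omega>" and k: "k \<le> DIM('a)"
  shows "volume_form (\<lambda>vs. \<Omega> (drop k vs @ take k vs))"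
  unfolding volume_form_def
proof (intro conjI allI impI)
  fix vs :: "'a list" and i assume *: "length vs = DIM('a) \<and> i < DIM('a)"
  let ?i = "if i < k then DIM('a) - k + i else i - k"
  have "drop k (vs[i := x]) @ take k (vs[i := x]) = (drop k vs @ take k vs)[?i := x]" for x
    using * k by (cases "i < k")
      (auto simp: drop_update_swap take_update_swap list_update_append not_less intro!: list_update_beyond)
  moreover have "linear (\<lambda>x. \<Omega> ((drop k vs @ take k vs)[?i := x]))"
  proof -
    have "length (drop k vs @ take k vs) = DIM('a) \<and> ?i < DIM('a)"
      using * k by auto
    then show ?thesis
      using \<Omega> unfolding volume_form_def by blast
  qed
  ultimately show "linear (\<lambda>x. \<Omega> (drop k (vs[i := x]) @ take k (vs[i := x])))"
    by simp
next
  fix vs :: "'a list" assume *: "length vs = DIM('a) \<and> \<not> distinct vs"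
  have "distinct (drop k vs @ take k vs) \<longleftrightarrow> distinct (take k vs @ drop k vs)"
    by (simp only: distinct_append Int_commute conj_commute conj_left_commute)
  then have "\<not> distinct (drop k vs @ take k vs)"
    using * by simp
  moreover have "length (drop k vs @ take k vs) = DIM('a)"
    using * k by simp
  ultimately show "\<Omega> (drop k vs @ take k vs) = 0"
    using \<Omega> unfolding volume_form_def by blast
next
  obtain vs where vs: "length vs = DIM('a)" "\<Omega> vs \<noteq> 0"
    using \<Omega> unfolding volume_form_def by blast
  let ?w = "drop (DIM('a) - k) vs @ take (DIM('a) - k) vs"
  have "drop k ?w @ take k ?w = vs"
    using vs k by simp
  then show "\<exists>vs. length vs = DIM('a) \<and> \<Omega> (drop k vs @ take k vs) \<noteq> 0"
    using vs k by (intro exI[of _ ?w]) simp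
qed

lemma volume_form_compose:
  fixes \<Omega> :: "'a::euclidean_space list \<Rightarrow> real" and g :: "'a \<Rightarrow> 'a"
  assumes \<Omega>: "volume_form \<Omega>" and g: "linear g" "bij g"
  shows "volume_form (\<lambda>vs. \<Omega> (map g vs))"
  unfolding volume_form_def
proof (intro conjI allI impI)
  fix vs :: "'a list" and i assume *: "length vs = DIM('a) \<and> i < DIM('a)"
  then have "linear (\<lambda>x. \<Omega> ((map g vs)[i := x]))"
    using \<Omega> unfolding volume_form_def by simp
  from linear_compose[OF g(1) this] show "linear (\<lambda>x. \<Omega> (map g (vs[i := x])))"
    by (simp add: o_def map_update)
next
  fix vs :: "'a list" assume "length vs = DIM('a) \<and> \<not> distinct vs"
  then show "\<Omega> (map g vs) = 0"
    using \<Omega> unfolding volume_form_def by (simp add: distinct_map)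
next
  obtain vs where vs: "length vs = DIM('a)" "\<Omega> vs \<noteq> 0"
    using \<Omega> unfolding volume_form_def by blast
  then show "\<exists>vs. length vs = DIM('a) \<and> \<Omega> (map g vs) \<noteq> 0"
    using g by (intro exI[of _ "map (inv_into UNIV g) vs"]) (simp add: o_def surj_f_inv_f[OF bij_is_surj])
qed

text \<open>
  The coordinate matrix of the arguments is lower block triangular with an identity block.
\<close>

lemma volume_form_corner_minor:
  fixes \<Omega> :: "'a::euclidean_space list \<Rightarrow> real"
  assumes \<Omega>: "volume_form \<Omega>" and es: "ordered_basis es UNIV" and k: "k \<le> DIM('a)"
  shows "\<Omega> (map x (drop (DIM('a) - k) es) @ drop k es) = corner_minor DIM('a) k (entries es x) * \<Omega> es"
proof -
  let ?n = "DIM('a)"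
  let ?vs = "map x (drop (?n - k) es) @ drop k es"
  have len: "length es = ?n" by (rule ordered_basis_length[OF es])
  let ?A = "Matrix.mat k k (\<lambda>(i, j). entries es x i (?n - k + j))"
  let ?C = "Matrix.mat (?n - k) k (\<lambda>(i, j). entries es x (k + i) (?n - k + j))"
  have "Matrix.mat ?n ?n (\<lambda>(i, j). coordinate es i (?vs ! j)) =
      four_block_mat ?A (0\<^sub>m k (?n - k)) ?C (1\<^sub>m (?n - k))"
  proof (rule eq_matI)
    fix i j assume "i < dim_row (four_block_mat ?A (0\<^sub>m k (?n - k)) ?C (1\<^sub>m (?n - k)))"
      "j < dim_col (four_block_mat ?A (0\<^sub>m k (?n - k)) ?C (1\<^sub>m (?n - k)))"
    then have ij: "i < ?n" "j < ?n" using k by auto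
    have vj: "?vs ! j = (if j < k then x (es ! (?n - k + j)) else es ! j)"
      using ij k len by (auto simp: nth_append)
    show "Matrix.mat ?n ?n (\<lambda>(i, j). coordinate es i (?vs ! j)) $$ (i, j) =
        four_block_mat ?A (0\<^sub>m k (?n - k)) ?C (1\<^sub>m (?n - k)) $$ (i, j)"
      using ij k by (simp add: vj entries_def coordinate_basis[OF es]) auto
  qed (use k in auto)
  then have "fdet ?n (\<lambda>i j. coordinate es i (?vs ! j)) = Determinant.det ?A * Determinant.det (1\<^sub>m (?n - k))"
    unfolding fdet_def by (simp only:) (rule det_four_block_mat_upper_right_zero, auto)
  moreover have "length ?vs = ?n" using k len by simp
  ultimately show ?thesis
    using volume_form_eq_fdet[OF \<Omega> es, of ?vs] by (simp add: corner_minor_def fdet_def)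
qed

lemma volume_form_corner_minor':
  fixes \<Omega> :: "'a::euclidean_space list \<Rightarrow> real"
  assumes \<Omega>: "volume_form \<Omega>" and es: "ordered_basis es UNIV" and k: "k \<le> DIM('a)"
  shows "\<Omega> (drop k es @ map x (drop (DIM('a) - k) es)) =
    corner_minor DIM('a) k (entries es x) * \<Omega> (drop k es @ take k es)"
  using volume_form_corner_minor[OF volume_form_rotate[OF \<Omega> k] es k, of x] ordered_basis_length[OF es] k
  by simp

text \<open>
  The factor is not zero: extend \<open>bs'\<close> to a basis of the whole space and change the basis back.
\<close>

lemma volume_form_change_basis_nonzero:
  fixes \<Omega> :: "'a::euclidean_space list \<Rightarrow> real"
  assumes \<Omega>: "volume_form \<Omega>" and bs: "ordered_basis bs S" and bs': "ordered_basis bs' S"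
  obtains \<kappa> where "\<kappa> \<noteq> 0"
    "\<And>ws. length bs + length ws = DIM('a) \<Longrightarrow> \<Omega> (bs @ ws) = \<kappa> * \<Omega> (bs' @ ws)"
proof -
  have len: "length bs' = length bs"
    using bs bs' dim_eq_card_independent dim_span unfolding ordered_basis_def by (metis distinct_card)
  obtain \<kappa> where \<kappa>: "\<And>ws. length bs + length ws = DIM('a) \<Longrightarrow> \<Omega> (bs @ ws) = \<kappa> * \<Omega> (bs' @ ws)"
    using volume_form_change_basis[OF \<Omega> bs bs'] by blast
  have ind: "independent (set bs')"
    using bs' by (simp add: ordered_basis_def)
  obtain B where B: "set bs' \<subseteq> B" "independent B" "UNIV \<subseteq> span B"
    by (rule maximal_independent_subset_extend[OF subset_UNIV ind])
  then have "finite (B - set bs')"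
    using independent_imp_finite by blast
  then obtain ws where ws: "set ws = B - set bs'" "distinct ws"
    using finite_distinct_list by blast
  have "ordered_basis (bs' @ ws) UNIV"
    using ws B bs' by (simp add: ordered_basis_def Un_absorb1 top.extremum_unique)
  from volume_form_nonzero[OF \<Omega> this] ordered_basis_length[OF this]
  have *: "\<Omega> (bs' @ ws) \<noteq> 0" "length bs + length ws = DIM('a)"
    using len by auto
  obtain \<mu> where "\<Omega> (bs' @ ws) = \<mu> * \<Omega> (bs @ ws)"
    using volume_form_change_basis[OF \<Omega> bs' bs] len * by metis
  with \<kappa>[OF *(2)] *(1) have "\<kappa> \<noteq> 0" by auto
  then show ?thesis using \<kappa> that by blast
qed

section \<open>The cross ratio\<close>

lemma ordered_basis_some_basis: "ordered_basis bs S \<Longrightarrow> ordered_basis (some_basis S) S"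
  unfolding some_basis_def by (rule someI)

lemma ordered_basis_flag_length:
  fixes F :: "'a::euclidean_space flag"
  assumes "ordered_basis bs (flag_space F m)" "m \<le> DIM('a)"
  shows "length bs = m"
proof -
  have "card (set bs) = dim (flag_space F m)"
    using assms(1) dim_eq_card_independent dim_span unfolding ordered_basis_def by metis
  then show ?thesis
    using assms by (simp add: ordered_basis_def distinct_card dim_flag)
qed

lemma cross_ratio_eq:
  fixes \<Omega> :: "'a::euclidean_space list \<Rightarrow> real"
  assumes \<Omega>: "volume_form \<Omega>" and k: "k \<le> DIM('a)"
    and u1: "ordered_basis u1 (flag_space F1 (DIM('a) - k))" and u2: "ordered_basis u2 (flag_space F2 (DIM('a) - k))"
    and w3: "ordered_basis w3 (flag_space F3 k)" and w4: "ordered_basis w4 (flag_space F4 k)"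
  shows "cross_ratio \<Omega> k F1 F2 F3 F4 = (\<Omega> (u2 @ w4) * \<Omega> (u1 @ w3)) / (\<Omega> (u2 @ w3) * \<Omega> (u1 @ w4))"
proof -
  have left: "\<exists>\<kappa>. \<kappa> \<noteq> 0 \<and> (\<forall>w. length w = k \<longrightarrow> \<Omega> (some_basis (flag_space F (DIM('a) - k)) @ w) = \<kappa> * \<Omega> (u @ w))"
    if u: "ordered_basis u (flag_space F (DIM('a) - k))" for u and F :: "'a flag"
  proof -
    note s = ordered_basis_some_basis[OF u]
    have len: "length (some_basis (flag_space F (DIM('a) - k))) + k = DIM('a)"
      using ordered_basis_flag_length[OF s diff_le_self] k by simp
    obtain \<kappa> where "\<kappa> \<noteq> 0" and \<kappa>: "\<And>ws. length (some_basis (flag_space F (DIM('a) - k))) + length ws = DIM('a) \<Longrightarrow>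
        \<Omega> (some_basis (flag_space F (DIM('a) - k)) @ ws) = \<kappa> * \<Omega> (u @ ws)"
      using volume_form_change_basis_nonzero[OF \<Omega> s u] by blast
    then show ?thesis
      using len by (intro exI[of _ \<kappa>]) auto
  qed
  have right: "\<exists>\<kappa>. \<kappa> \<noteq> 0 \<and> (\<forall>u. length u = DIM('a) - k \<longrightarrow> \<Omega> (u @ some_basis (flag_space F k)) = \<kappa> * \<Omega> (u @ w))"
    if w: "ordered_basis w (flag_space F k)" for w and F :: "'a flag"
  proof -
    let ?s = "some_basis (flag_space F k)"
    note s = ordered_basis_some_basis[OF w]
    have len: "length ?s = k" "length w = k"
      using ordered_basis_flag_length[OF _ k] s w by auto
    obtain \<kappa> where "\<kappa> \<noteq> 0" and \<kappa>: "\<And>ws. length ?s + length ws = DIM('a) \<Longrightarrow>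
        \<Omega> (drop k (?s @ ws) @ take k (?s @ ws)) = \<kappa> * \<Omega> (drop k (w @ ws) @ take k (w @ ws))"
      using volume_form_change_basis_nonzero[OF volume_form_rotate[OF \<Omega> k] s w] by blast
    then show ?thesis
      using len k by (intro exI[of _ \<kappa>]) auto
  qed
  have len: "length w3 = k" "length w4 = k"
    using ordered_basis_flag_length[OF w3 k] ordered_basis_flag_length[OF w4 k] .
  have len': "length (some_basis (flag_space F1 (DIM('a) - k))) = DIM('a) - k"
    "length (some_basis (flag_space F2 (DIM('a) - k))) = DIM('a) - k"
    using ordered_basis_flag_length[OF ordered_basis_some_basis[OF u1] diff_le_self]
      ordered_basis_flag_length[OF ordered_basis_some_basis[OF u2] diff_le_self] .
  obtain c1 where c1: "c1 \<noteq> 0"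
    "\<And>w. length w = k \<Longrightarrow> \<Omega> (some_basis (flag_space F1 (DIM('a) - k)) @ w) = c1 * \<Omega> (u1 @ w)"
    using left[OF u1] by blast
  obtain c2 where c2: "c2 \<noteq> 0"
    "\<And>w. length w = k \<Longrightarrow> \<Omega> (some_basis (flag_space F2 (DIM('a) - k)) @ w) = c2 * \<Omega> (u2 @ w)"
    using left[OF u2] by blast
  obtain d3 where d3: "d3 \<noteq> 0"
    "\<And>u. length u = DIM('a) - k \<Longrightarrow> \<Omega> (u @ some_basis (flag_space F3 k)) = d3 * \<Omega> (u @ w3)"
    using right[OF w3] by blast
  obtain d4 where d4: "d4 \<noteq> 0"
    "\<And>u. length u = DIM('a) - k \<Longrightarrow> \<Omega> (u @ some_basis (flag_space F4 k)) = d4 * \<Omega> (u @ w4)"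
    using right[OF w4] by blast
  show ?thesis
    unfolding cross_ratio_def Let_def using c1(1) c2(1) d3(1) d4(1)
    by (simp add: d3(2)[OF len'(1)] d3(2)[OF len'(2)] d4(2)[OF len'(1)] d4(2)[OF len'(2)]
        c1(2)[OF len(1)] c1(2)[OF len(2)] c2(2)[OF len(1)] c2(2)[OF len(2)])
qed

lemma ordered_basis_translate_flag:
  fixes F K :: "'a::euclidean_space flag" and g :: "'a \<Rightarrow> 'a"
  assumes es: "adapted_basis es F K" and g: "linear g" "bij g" and m: "m \<le> DIM('a)"
  shows "ordered_basis (map g (drop (DIM('a) - m) es)) (flag_space (flag_act g F) m)"
proof -
  have b: "ordered_basis es UNIV" using es by (simp add: adapted_basis_def)
  have len: "length es = DIM('a)" by (rule ordered_basis_length[OF b])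
  have set: "set (drop (DIM('a) - m) es) = (!) es ` {DIM('a) - m..<DIM('a)}"
  proof -
    have "drop (DIM('a) - m) es = map ((!) es) [DIM('a) - m..<DIM('a)]"
      using len by (intro nth_equalityI) auto
    then show ?thesis by simp
  qed
  have "inj_on g A" for A
    using g(2) by (auto simp: bij_def intro: inj_on_subset)
  moreover have "independent (set (drop (DIM('a) - m) es))"
    using b independent_mono[OF _ set_drop_subset] by (auto simp: ordered_basis_def)
  ultimately show ?thesis
    using b g unfolding ordered_basis_def flag_space_flag_act[OF g] adapted_flag_span(2)[OF es m] set[symmetric]
    by (simp add: distinct_map linear_independent_injective_image span_linear_image bij_is_inj)
qed

text \<open>
  Transporting the arguments by \<open>g\<close>, \<open>g \<circ> a\<close> and \<open>g \<circ> a \<circ> b\<close> turns the four volumes into corner minors.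
  The constants cancel because \<open>b\<close> has determinant 1. The first quotient grows by
  \<open>corner_minor_mult_growth\<close>, the second is at least 1.
\<close>

theorem cross_ratio_ge:
  fixes F K :: "'a::euclidean_space flag" and g :: "'a \<Rightarrow> 'a"
  assumes \<Omega>: "volume_form \<Omega>" and es: "adapted_basis es F K"
    and g: "linear g" "bij g"
    and abc: "a \<in> U_pos es" "b \<in> U_pos es" "c \<in> U_pos es"
    and k: "0 < k" "k < DIM('a)" and j: "j = DIM('a) - k"
  shows "1 + entries es b (j - 1) j / entries es a (j - 1) j \<le>
    cross_ratio \<Omega> k (flag_act (g \<circ> a \<circ> b \<circ> c) F) (flag_act g F) (flag_act (g \<circ> a) F) (flag_act (g \<circ> a \<circ> b) F)"
proof -
  let ?n = "DIM('a)"
  have bas: "ordered_basis es UNIV" using es by (simp add: adapted_basis_def)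
  note len = ordered_basis_length[OF bas]
  note a = U_posD[OF bas abc(1)] and b = U_posD[OF bas abc(2)] and c = U_posD[OF bas abc(3)]
  let ?A = "entries es a" and ?B = "entries es b" and ?C = "entries es c"
  let ?\<Omega>1 = "\<lambda>vs. \<Omega> (map g vs)"
  let ?\<Omega>2 = "\<lambda>vs. \<Omega> (map (g \<circ> a) vs)"
  let ?\<Omega>3 = "\<lambda>vs. \<Omega> (map (g \<circ> a \<circ> b) vs)"
  have ga: "linear (g \<circ> a)" "bij (g \<circ> a)" "linear (g \<circ> a \<circ> b)" "bij (g \<circ> a \<circ> b)"
    "linear (g \<circ> a \<circ> b \<circ> c)" "bij (g \<circ> a \<circ> b \<circ> c)"
    using a b c g by (auto intro!: linear_compose bij_comp)
  have \<Omega>': "volume_form ?\<Omega>1" "volume_form ?\<Omega>2" "volume_form ?\<Omega>3"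
    using volume_form_compose[OF \<Omega>] g ga by auto
  have kn: "k \<le> ?n" "j \<le> ?n" "?n - j = k" "?n - k = j" using k j by auto
  have rot: "\<Omega> (map g (drop k es @ take k es)) \<noteq> 0"
    using volume_form_nonzero[OF volume_form_rotate[OF \<Omega>'(1) kn(1)] bas] by simp
  have u2w: "\<Omega> (map g (drop k es) @ map (g \<circ> x) (drop (?n - k) es)) =
      corner_minor ?n k (entries es x) * \<Omega> (map g (drop k es @ take k es))" for x
    using volume_form_corner_minor'[OF \<Omega>'(1) bas kn(1), of x] by simp
  have u1w3: "\<Omega> (map (g \<circ> a \<circ> b \<circ> c) (drop k es) @ map (g \<circ> a) (drop (?n - k) es)) =
      corner_minor ?n j (entries es (b \<circ> c)) * ?\<Omega>2 es"
    using volume_form_corner_minor[OF \<Omega>'(2) bas kn(2), of "b \<circ> c"] unfolding kn by (simp add: o_assoc)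
  have u1w4: "\<Omega> (map (g \<circ> a \<circ> b \<circ> c) (drop k es) @ map (g \<circ> a \<circ> b) (drop (?n - k) es)) =
      corner_minor ?n j ?C * ?\<Omega>3 es"
    using volume_form_corner_minor[OF \<Omega>'(3) bas kn(2), of c] unfolding kn by (simp add: o_assoc)
  have det_b: "?\<Omega>3 es = ?\<Omega>2 es"
  proof -
    have "?\<Omega>2 (map b es) = fdet ?n (\<lambda>i j. coordinate es i (map b es ! j)) * ?\<Omega>2 es"
      by (rule volume_form_eq_fdet[OF \<Omega>'(2) bas]) (simp add: len)
    also have "fdet ?n (\<lambda>i j. coordinate es i (map b es ! j)) = fdet ?n ?B"
      by (intro fdet_cong) (simp add: len entries_def)
    also have "\<dots> = 1"
      using b(3) by (subst fdet_upper_triangular) (auto simp: unitriangular_def)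
    finally show ?thesis by (simp only: map_map mult_1)
  qed
  have nz: "?\<Omega>2 es \<noteq> 0" by (rule volume_form_nonzero[OF \<Omega>'(2) bas])
  have pos: "0 < corner_minor ?n k ?A" "0 < corner_minor ?n j ?C"
    using corner_minor_pos a(2) c(2) kn by auto
  have "cross_ratio \<Omega> k (flag_act (g \<circ> a \<circ> b \<circ> c) F) (flag_act g F) (flag_act (g \<circ> a) F) (flag_act (g \<circ> a \<circ> b) F)
      = (\<Omega> (map g (drop k es) @ map (g \<circ> (a \<circ> b)) (drop (?n - k) es)) *
         \<Omega> (map (g \<circ> a \<circ> b \<circ> c) (drop k es) @ map (g \<circ> a) (drop (?n - k) es))) /
        (\<Omega> (map g (drop k es) @ map (g \<circ> a) (drop (?n - k) es)) *
         \<Omega> (map (g \<circ> a \<circ> b \<circ> c) (drop k es) @ map (g \<circ> a \<circ> b) (drop (?n - k) es)))"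
    unfolding o_assoc
    by (rule cross_ratio_eq[OF \<Omega> kn(1)])
      (use ordered_basis_translate_flag[OF es] g ga kn in \<open>metis diff_le_self\<close>)+
  also have "\<dots> = (corner_minor ?n k (mat_times ?n ?A ?B) / corner_minor ?n k ?A) *
      (corner_minor ?n j (mat_times ?n ?B ?C) / corner_minor ?n j ?C)"
    unfolding u2w u1w3 u1w4 det_b entries_comp[OF bas a(1)] entries_comp[OF bas b(1)]
    using rot nz by (simp add: field_simps)
  also have "\<dots> \<ge> (1 + ?B (j - 1) j / ?A (j - 1) j) * 1"
  proof (rule mult_mono)
    show "1 + ?B (j - 1) j / ?A (j - 1) j \<le> corner_minor ?n k (mat_times ?n ?A ?B) / corner_minor ?n k ?A"
      using corner_minor_mult_growth[OF a(2) b(2) k j] pos by (simp add: pos_le_divide_eq mult.commute)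
    then show "0 \<le> corner_minor ?n k (mat_times ?n ?A ?B) / corner_minor ?n k ?A"
      using corner_minor_pos[OF tpos_mult[OF a(2) b(2)] kn(1)] pos by simp
    show "1 \<le> corner_minor ?n j (mat_times ?n ?B ?C) / corner_minor ?n j ?C"
      using corner_minor_mult_ge_right[OF b(2) c(2) kn(2)] pos by simp
  qed simp
  finally show ?thesis by simp
qed

section \<open>The topology of the flag space\<close>

lemma tendsto_flag_act:
  fixes c :: "nat \<Rightarrow> 'a::euclidean_space \<Rightarrow>\<^sub>L 'a"
  assumes c: "c \<longlonglongrightarrow> l" and bij: "\<And>i. bij (blinfun_apply (c i))" "bij (blinfun_apply l)"
  shows "(\<lambda>i. flag_act (blinfun_apply (c i)) F) \<longlonglongrightarrow> flag_act (blinfun_apply l) F"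
proof (rule topological_tendstoI)
  fix S :: "'a flag set" assume "open S" and l: "flag_act (blinfun_apply l) F \<in> S"
  then have "openin (top_of_set {g :: 'a \<Rightarrow>\<^sub>L 'a. bij (blinfun_apply g)})
      {g. bij (blinfun_apply g) \<and> flag_act (blinfun_apply g) F \<in> S}"
    unfolding open_flag_def by blast
  then obtain T where T: "open T" "{g. bij (blinfun_apply g) \<and> flag_act (blinfun_apply g) F \<in> S} =
      {g. bij (blinfun_apply g)} \<inter> T"
    by (auto simp: openin_open)
  then have "l \<in> T" using bij l by blast
  then have "eventually (\<lambda>i. c i \<in> T) sequentially"
    using c T(1) topological_tendstoD by blast
  then show "eventually (\<lambda>i. flag_act (blinfun_apply (c i)) F \<in> S) sequentially"
    by (rule eventually_mono) (use T(2) bij in blast)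
qed

text \<open>
  The topology is tested on orbit maps. If \<open>A m \<cdot> E = c m \<cdot> F\<close> and \<open>A m\<close> converges in the general linear
  group, pass to a subsequence along which \<open>c m\<close> converges to some \<open>l\<close> in \<open>C\<close>. The preimages under
  \<open>c m\<close> of the vectors \<open>A m x\<close> stay bounded because \<open>l\<close> is bounded below, hence the limit of
  \<open>A m x\<close> lies in the closed subspaces of \<open>l \<cdot> F\<close>.
\<close>

lemma closed_flag_act_compact:
  fixes C :: "('a::euclidean_space \<Rightarrow>\<^sub>L 'a) set"
  assumes C: "compact C" and bij: "\<And>c. c \<in> C \<Longrightarrow> bij (blinfun_apply c)"
  shows "closed ((\<lambda>c. flag_act (blinfun_apply c) F) ` C)"
proof -
  let ?S = "(\<lambda>c. flag_act (blinfun_apply c) F) ` C"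
  let ?GL = "{g :: 'a \<Rightarrow>\<^sub>L 'a. bij (blinfun_apply g)}"
  note act = flag_space_flag_act[OF bounded_linear.linear[OF blinfun.bounded_linear_right]]
  have "closedin (top_of_set ?GL) {g \<in> ?GL. flag_act (blinfun_apply g) E \<in> ?S}" for E
  proof -
    have lim: "flag_act (blinfun_apply g) E \<in> ?S"
      if A: "\<And>m. A m \<in> ?GL" "\<And>m. flag_act (blinfun_apply (A m)) E \<in> ?S" "A \<longlonglongrightarrow> g"
        and g: "g \<in> ?GL" for A :: "nat \<Rightarrow> 'a \<Rightarrow>\<^sub>L 'a" and g
    proof -
      have "\<forall>m. \<exists>c. c \<in> C \<and> flag_act (blinfun_apply (A m)) E = flag_act (blinfun_apply c) F"
        using A(2) by blast
      then obtain c where c: "\<And>m. c m \<in> C" "\<And>m. flag_act (blinfun_apply (A m)) E = flag_act (blinfun_apply (c m)) F"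
        by metis
      obtain l r where l: "l \<in> C" and r: "strict_mono r" and cl: "(c \<circ> r) \<longlonglongrightarrow> l"
        using C c(1) unfolding compact_def by metis
      have Ag: "(A \<circ> r) \<longlonglongrightarrow> g" using A(3) r by (rule LIMSEQ_subseq_LIMSEQ)
      have "inj (blinfun_apply l)" using bij[OF l] by (rule bij_is_inj)
      then obtain \<delta> where \<delta>: "\<delta> > 0" "\<And>y. \<delta> * norm y \<le> norm (blinfun_apply l y)"
        using linear_inj_bounded_below_pos[OF bounded_linear.linear[OF blinfun.bounded_linear_right]] by metis
      have "flag_act (blinfun_apply g) E = flag_act (blinfun_apply l) F"
      proof (rule flag_eqI)
        fix k
        show "flag_space (flag_act (blinfun_apply g) E) k \<subseteq> flag_space (flag_act (blinfun_apply l) F) k"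
        proof
          fix z assume "z \<in> flag_space (flag_act (blinfun_apply g) E) k"
          then obtain x where x: "x \<in> flag_space E k" "z = blinfun_apply g x"
            using g by (auto simp: act)
          have "\<forall>m. \<exists>y. y \<in> flag_space F k \<and> blinfun_apply (A m) x = blinfun_apply (c m) y"
          proof
            fix m
            have "blinfun_apply (A m) x \<in> flag_space (flag_act (blinfun_apply (A m)) E) k"
              using A(1)[of m] x by (auto simp: act)
            then show "\<exists>y. y \<in> flag_space F k \<and> blinfun_apply (A m) x = blinfun_apply (c m) y"
              unfolding c(2) using bij[OF c(1)] by (auto simp: act)
          qed
          then obtain y where y: "\<And>m. y m \<in> flag_space F k" "\<And>m. blinfun_apply (A m) x = blinfun_apply (c m) (y m)"
            by metis
          have Ax: "(\<lambda>m. blinfun_apply ((A \<circ> r) m) x) \<longlonglongrightarrow> z"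
            unfolding x(2) by (intro tendsto_intros Ag)
          have err: "norm (blinfun_apply l (y (r m)) - blinfun_apply ((A \<circ> r) m) x) \<le> norm (l - (c \<circ> r) m) * norm (y (r m))" for m
            using norm_blinfun[of "l - (c \<circ> r) m" "y (r m)"] by (simp add: y(2) blinfun.diff_left)
          have bnd: "eventually (\<lambda>m. norm (l - (c \<circ> r) m) * norm (y (r m)) \<le>
              norm (l - (c \<circ> r) m) * (2 / \<delta> * norm (blinfun_apply ((A \<circ> r) m) x))) sequentially"
          proof -
            have "eventually (\<lambda>m. dist ((c \<circ> r) m) l < \<delta> / 2) sequentially"
              by (rule tendstoD[OF cl]) (use \<delta>(1) in simp)
            then show ?thesis
            proof (rule eventually_mono)
              fix m assume m: "dist ((c \<circ> r) m) l < \<delta> / 2"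
              have "\<delta> * norm (y (r m)) \<le> norm (blinfun_apply l (y (r m)))"
                by (rule \<delta>(2))
              also have "\<dots> \<le> norm (blinfun_apply ((A \<circ> r) m) x) + norm (l - (c \<circ> r) m) * norm (y (r m))"
                using err[of m] norm_triangle_sub[of "blinfun_apply l (y (r m))" "blinfun_apply ((A \<circ> r) m) x"] by linarith
              also have "norm (l - (c \<circ> r) m) * norm (y (r m)) \<le> \<delta> / 2 * norm (y (r m))"
                using m by (intro mult_right_mono) (auto simp: dist_norm norm_minus_commute)
              finally have "norm (y (r m)) \<le> 2 / \<delta> * norm (blinfun_apply ((A \<circ> r) m) x)"
                using \<delta>(1) by (simp add: field_simps)
              then show "norm (l - (c \<circ> r) m) * norm (y (r m)) \<le>
                  norm (l - (c \<circ> r) m) * (2 / \<delta> * norm (blinfun_apply ((A \<circ> r) m) x))"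
                by (intro mult_left_mono) auto
            qed
          qed
          have "(\<lambda>m. norm (l - (c \<circ> r) m) * (2 / \<delta> * norm (blinfun_apply ((A \<circ> r) m) x)))
              \<longlonglongrightarrow> norm (l - l) * (2 / \<delta> * norm z)"
            by (intro tendsto_intros cl Ax)
          then have "(\<lambda>m. norm (l - (c \<circ> r) m) * (2 / \<delta> * norm (blinfun_apply ((A \<circ> r) m) x))) \<longlonglongrightarrow> 0"
            by simp
          then have "(\<lambda>m. blinfun_apply l (y (r m)) - blinfun_apply ((A \<circ> r) m) x) \<longlonglongrightarrow> 0"
            by (rule Lim_null_comparison[rotated])
              (use bnd err in \<open>auto elim!: eventually_mono intro: order_trans\<close>)
          from tendsto_add[OF this Ax] have "(\<lambda>m. blinfun_apply l (y (r m))) \<longlonglongrightarrow> z"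
            by simp
          moreover have "closed (flag_space (flag_act (blinfun_apply l) F) k)"
            by (rule closed_subspace[OF subspace_flag])
          moreover have "blinfun_apply l (y (r m)) \<in> flag_space (flag_act (blinfun_apply l) F) k" for m
            using y(1) bij[OF l] by (auto simp: act)
          ultimately show "z \<in> flag_space (flag_act (blinfun_apply l) F) k"
            using Lim_in_closed_set[of _ "\<lambda>m. blinfun_apply l (y (r m))" sequentially z] by simp
        qed
      qed
      then show ?thesis using l by blast
    qed
    show ?thesis
      unfolding closedin_limpt islimpt_sequential
    proof (intro conjI allI impI)
      fix g assume "(\<exists>A. (\<forall>m. A m \<in> {g \<in> ?GL. flag_act (blinfun_apply g) E \<in> ?S} - {g}) \<and> A \<longlonglongrightarrow> g) \<and> g \<in> ?GL"
      then obtain A where "\<And>m. A m \<in> {g \<in> ?GL. flag_act (blinfun_apply g) E \<in> ?S} - {g}" "A \<longlonglongrightarrow> g" "g \<in> ?GL"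
        by blast
      then show "g \<in> {g \<in> ?GL. flag_act (blinfun_apply g) E \<in> ?S}"
        using lim[of A g] by blast
    qed blast
  qed
  then have op: "openin (top_of_set ?GL) (?GL - {g \<in> ?GL. flag_act (blinfun_apply g) E \<in> ?S})" for E
    by (simp add: closedin_def)
  have eq: "?GL - {g \<in> ?GL. flag_act (blinfun_apply g) E \<in> ?S} =
      {g. bij (blinfun_apply g) \<and> flag_act (blinfun_apply g) E \<in> - ?S}" for E
    by blast
  have "open (- ?S)"
    unfolding open_flag_def by (rule allI, rule op[unfolded eq])
  then show ?thesis by (simp add: closed_def)
qed

text \<open>
  Matrix entries control the operator norm, so that entrywise bounds and limits can be used for the
  topology of the space of linear maps.
\<close>

lemma norm_blinfun_le_entries:
  fixes es :: "'a::euclidean_space list"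
  assumes es: "ordered_basis es UNIV"
  obtains \<kappa> where "\<And>c :: 'a \<Rightarrow>\<^sub>L 'a. norm c \<le> \<kappa> * (\<Sum>i<DIM('a). \<Sum>j<DIM('a). \<bar>entries es (blinfun_apply c) i j\<bar>)"
proof -
  let ?n = "DIM('a)"
  have "\<forall>j. \<exists>B>0. \<forall>x. norm (coordinate es j x) \<le> norm x * B"
    using bounded_linear.pos_bounded[OF bounded_linear_coordinate[OF es]] by blast
  then obtain B where B: "\<And>j. B j > 0" "\<And>j x. \<bar>coordinate es j x\<bar> \<le> norm x * B j"
    by (metis real_norm_def)
  define \<kappa> where "\<kappa> = (\<Sum>i<?n. \<Sum>j<?n. B j * norm (es ! i))"
  have \<kappa>0: "0 \<le> \<kappa>"
    unfolding \<kappa>_def by (intro sum_nonneg mult_nonneg_nonneg less_imp_le[OF B(1)] norm_ge_zero)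
  have le: "B j * norm (es ! i) \<le> \<kappa>" if "i < ?n" "j < ?n" for i j
  proof -
    have "B j * norm (es ! i) \<le> (\<Sum>j<?n. B j * norm (es ! i))"
      using that by (intro member_le_sum) (auto intro!: mult_nonneg_nonneg less_imp_le[OF B(1)])
    also have "\<dots> \<le> \<kappa>"
      unfolding \<kappa>_def using that
      by (intro member_le_sum[of i _ "\<lambda>i. \<Sum>j<?n. B j * norm (es ! i)"])
        (auto intro!: sum_nonneg mult_nonneg_nonneg less_imp_le[OF B(1)])
    finally show ?thesis .
  qed
  have "norm c \<le> \<kappa> * (\<Sum>i<?n. \<Sum>j<?n. \<bar>entries es (blinfun_apply c) i j\<bar>)" for c :: "'a \<Rightarrow>\<^sub>L 'a"
  proof (rule norm_blinfun_bound)
    show "0 \<le> \<kappa> * (\<Sum>i<?n. \<Sum>j<?n. \<bar>entries es (blinfun_apply c) i j\<bar>)"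
      using \<kappa>0 by (intro mult_nonneg_nonneg sum_nonneg) auto
    fix x
    let ?e = "entries es (blinfun_apply c)"
    have "linear (blinfun_apply c)" by (rule bounded_linear.linear[OF blinfun.bounded_linear_right])
    then have "blinfun_apply c x = (\<Sum>i<?n. (\<Sum>j<?n. ?e i j * coordinate es j x) *\<^sub>R es ! i)"
      by (subst coordinate_expansion[OF es, of "blinfun_apply c x"]) (simp add: coordinate_linear_image[OF es])
    also have "norm \<dots> \<le> (\<Sum>i<?n. norm ((\<Sum>j<?n. ?e i j * coordinate es j x) *\<^sub>R es ! i))"
      by (rule norm_sum)
    also have "\<dots> \<le> (\<Sum>i<?n. \<Sum>j<?n. \<kappa> * \<bar>?e i j\<bar> * norm x)"
    proof (rule sum_mono)
      fix i assume i: "i \<in> {..<?n}"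
      have "norm ((\<Sum>j<?n. ?e i j * coordinate es j x) *\<^sub>R es ! i) \<le> (\<Sum>j<?n. \<bar>?e i j * coordinate es j x\<bar>) * norm (es ! i)"
        by (simp add: mult_right_mono sum_abs)
      also have "\<dots> = (\<Sum>j<?n. \<bar>?e i j * coordinate es j x\<bar> * norm (es ! i))"
        by (rule sum_distrib_right)
      also have "\<dots> \<le> (\<Sum>j<?n. \<kappa> * \<bar>?e i j\<bar> * norm x)"
      proof (rule sum_mono)
        fix j assume j: "j \<in> {..<?n}"
        have "\<bar>?e i j * coordinate es j x\<bar> * norm (es ! i) \<le> \<bar>?e i j\<bar> * (norm x * B j) * norm (es ! i)"
          using B(2)[of j x] by (simp add: abs_mult mult_left_mono mult_right_mono)
        also have "\<dots> = (B j * norm (es ! i)) * (\<bar>?e i j\<bar> * norm x)"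
          by (simp add: mult_ac)
        also have "\<dots> \<le> \<kappa> * (\<bar>?e i j\<bar> * norm x)"
          using le i j by (intro mult_right_mono) auto
        finally show "\<bar>?e i j * coordinate es j x\<bar> * norm (es ! i) \<le> \<kappa> * \<bar>?e i j\<bar> * norm x"
          by (simp add: mult_ac)
      qed
      finally show "norm ((\<Sum>j<?n. ?e i j * coordinate es j x) *\<^sub>R es ! i) \<le> (\<Sum>j<?n. \<kappa> * \<bar>?e i j\<bar> * norm x)" .
    qed
    also have "\<dots> = \<kappa> * (\<Sum>i<?n. \<Sum>j<?n. \<bar>?e i j\<bar>) * norm x"
      by (simp add: sum_distrib_left sum_distrib_right)
    finally show "norm (blinfun_apply c x) \<le> \<kappa> * (\<Sum>i<?n. \<Sum>j<?n. \<bar>?e i j\<bar>) * norm x" .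
  qed
  then show ?thesis by (rule that)
qed

lemma tendsto_blinfun_entries:
  fixes es :: "'a::euclidean_space list" and c :: "nat \<Rightarrow> 'a \<Rightarrow>\<^sub>L 'a"
  assumes es: "ordered_basis es UNIV"
    and lim: "\<And>i j. i < DIM('a) \<Longrightarrow> j < DIM('a) \<Longrightarrow>
      (\<lambda>m. entries es (blinfun_apply (c m)) i j) \<longlonglongrightarrow> entries es (blinfun_apply l) i j"
  shows "c \<longlonglongrightarrow> l"
proof -
  obtain \<kappa> where \<kappa>: "\<And>c :: 'a \<Rightarrow>\<^sub>L 'a. norm c \<le> \<kappa> * (\<Sum>i<DIM('a). \<Sum>j<DIM('a). \<bar>entries es (blinfun_apply c) i j\<bar>)"
    using norm_blinfun_le_entries[OF es] by blast
  have diff: "entries es (blinfun_apply (c m - l)) i j = entries es (blinfun_apply (c m)) i j - entries es (blinfun_apply l) i j" for m i j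
    by (simp add: entries_def blinfun.diff_left linear_diff[OF linear_coordinate[OF es]])
  have "(\<lambda>m. \<kappa> * (\<Sum>i<DIM('a). \<Sum>j<DIM('a). \<bar>entries es (blinfun_apply (c m)) i j - entries es (blinfun_apply l) i j\<bar>))
      \<longlonglongrightarrow> \<kappa> * (\<Sum>i<DIM('a). \<Sum>j<DIM('a). \<bar>entries es (blinfun_apply l) i j - entries es (blinfun_apply l) i j\<bar>)"
    by (intro tendsto_intros lim) auto
  then have "(\<lambda>m. \<kappa> * (\<Sum>i<DIM('a). \<Sum>j<DIM('a). \<bar>entries es (blinfun_apply (c m)) i j - entries es (blinfun_apply l) i j\<bar>)) \<longlonglongrightarrow> 0"
    by simp
  then have "(\<lambda>m. c m - l) \<longlonglongrightarrow> 0"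
    by (rule Lim_null_comparison[rotated]) (use \<kappa>[of "c _ - l"] in \<open>simp add: diff\<close>)
  then show ?thesis by (simp add: LIM_zero_iff)
qed

lemma compact_entries_box:
  fixes es :: "'a::euclidean_space list"
  assumes es: "ordered_basis es UNIV"
  shows "compact {c :: 'a \<Rightarrow>\<^sub>L 'a. \<forall>i<DIM('a). \<forall>j<DIM('a).
    L i j \<le> entries es (blinfun_apply c) i j \<and> entries es (blinfun_apply c) i j \<le> M i j}"
    (is "compact ?C")
proof -
  let ?n = "DIM('a)"
  have cont: "continuous_on UNIV (\<lambda>c :: 'a \<Rightarrow>\<^sub>L 'a. entries es (blinfun_apply c) i j)" for i j
    unfolding entries_def
    by (intro bounded_linear.continuous_on[OF bounded_linear_coordinate[OF es]] continuous_intros)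
  have "?C = (\<Inter>i\<in>{..<?n}. \<Inter>j\<in>{..<?n}. {c. L i j \<le> entries es (blinfun_apply c) i j \<and> entries es (blinfun_apply c) i j \<le> M i j})"
    by auto
  moreover have "closed \<dots>"
    by (intro closed_INT ballI closed_Collect_conj closed_Collect_le cont continuous_on_const)
  ultimately have "closed ?C" by simp
  moreover have "bounded ?C"
  proof -
    obtain \<kappa> where \<kappa>: "\<And>c :: 'a \<Rightarrow>\<^sub>L 'a. norm c \<le> \<kappa> * (\<Sum>i<?n. \<Sum>j<?n. \<bar>entries es (blinfun_apply c) i j\<bar>)"
      using norm_blinfun_le_entries[OF es] by blast
    have "norm c \<le> \<bar>\<kappa>\<bar> * (\<Sum>i<?n. \<Sum>j<?n. \<bar>L i j\<bar> + \<bar>M i j\<bar>)" if c: "c \<in> ?C" for c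
    proof -
      have "norm c \<le> \<bar>\<kappa>\<bar> * (\<Sum>i<?n. \<Sum>j<?n. \<bar>entries es (blinfun_apply c) i j\<bar>)"
        by (rule order_trans[OF \<kappa>]) (intro mult_right_mono sum_nonneg, auto)
      also have "\<dots> \<le> \<bar>\<kappa>\<bar> * (\<Sum>i<?n. \<Sum>j<?n. \<bar>L i j\<bar> + \<bar>M i j\<bar>)"
      proof (intro mult_left_mono sum_mono)
        fix i j assume "i \<in> {..<?n}" "j \<in> {..<?n}"
        then have "L i j \<le> entries es (blinfun_apply c) i j" "entries es (blinfun_apply c) i j \<le> M i j"
          using c by auto
        then show "\<bar>entries es (blinfun_apply c) i j\<bar> \<le> \<bar>L i j\<bar> + \<bar>M i j\<bar>" by linarith
      qed simp
      finally show ?thesis .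
    qed
    then show ?thesis unfolding bounded_iff by blast
  qed
  ultimately show ?thesis by (simp add: compact_eq_bounded_closed)
qed

section \<open>Positive tuples in coordinates\<close>

lemma foldr_comp: "foldr (\<circ>) us u = foldr (\<circ>) us id \<circ> u"
  by (induction us) (simp_all add: o_assoc)

lemma foldr_comp_take_Suc:
  "p < length us \<Longrightarrow> foldr (\<circ>) (take (Suc p) us) id = foldr (\<circ>) (take p us) id \<circ> us ! p"
  by (simp add: take_Suc_conv_app_nth foldr_comp[of _ "us ! p"])

lemma foldr_comp_take_less:
  fixes es :: "'a::euclidean_space list"
  assumes es: "ordered_basis es UNIV" and us: "set us \<subseteq> U_pos es" and "p + Suc d \<le> length us"
  shows "\<exists>v\<in>U_pos es. foldr (\<circ>) (take (p + Suc d) us) id = foldr (\<circ>) (take p us) id \<circ> v"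
  using assms(3)
proof (induction d)
  case 0
  then show ?case
  proof (intro bexI[of _ "us ! p"])
    show "us ! p \<in> U_pos es" using us 0 by auto
    show "foldr (\<circ>) (take (p + Suc 0) us) id = foldr (\<circ>) (take p us) id \<circ> us ! p"
      using foldr_comp_take_Suc[of p us] 0 unfolding add_Suc_right add_0_right by (simp only: Suc_le_eq)
  qed
next
  case (Suc d)
  then obtain v where v: "v \<in> U_pos es"
    "foldr (\<circ>) (take (p + Suc d) us) id = foldr (\<circ>) (take p us) id \<circ> v"
    using Suc.IH Suc.prems by (metis Suc_leD add_Suc_right)
  have "us ! (p + Suc d) \<in> U_pos es"
    using us Suc.prems by auto
  then show ?case
  proof (intro bexI[of _ "v \<circ> us ! (p + Suc d)"] U_pos_comp[OF es])
    have "p + Suc d < length us" using Suc.prems by linarith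
    from foldr_comp_take_Suc[OF this]
    show "foldr (\<circ>) (take (p + Suc (Suc d)) us) id = foldr (\<circ>) (take p us) id \<circ> (v \<circ> us ! (p + Suc d))"
      unfolding v(2) by (simp only: o_assoc add_Suc_right)
    show "v \<in> U_pos es" by (rule v(1))
    show "us ! (p + Suc d) \<in> U_pos es" by fact
  qed
qed

lemma unitriangular_id:
  fixes es :: "'a::euclidean_space list"
  assumes "ordered_basis es UNIV"
  shows "unitriangular DIM('a) (entries es id)"
  using assms by (auto simp: unitriangular_def entries_def coordinate_basis)

lemma unitriangular_comp:
  fixes es :: "'a::euclidean_space list"
  assumes "ordered_basis es UNIV" "linear u" "unitriangular DIM('a) (entries es u)"
    "unitriangular DIM('a) (entries es v)"
  shows "unitriangular DIM('a) (entries es (u \<circ> v))"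
  using assms by (simp add: entries_comp unitriangular_mult)

lemma foldr_comp_unitriangular:
  fixes es :: "'a::euclidean_space list"
  assumes es: "ordered_basis es UNIV" and us: "set us \<subseteq> U_pos es"
  shows "linear (foldr (\<circ>) us id) \<and> unitriangular DIM('a) (entries es (foldr (\<circ>) us id))"
  using us
proof (induction us)
  case Nil
  have "linear (id :: 'a \<Rightarrow> 'a)" by (simp add: linear_iff)
  then show ?case using unitriangular_id[OF es] unfolding foldr.simps id_apply by blast
next
  case (Cons u us)
  then have u: "u \<in> U_pos es"
    and "set us \<subseteq> U_pos es"
    by auto
  then have us: "linear (foldr (\<circ>) us id)" "unitriangular DIM('a) (entries es (foldr (\<circ>) us id))"
    using Cons.IH by blast+
  note u' = U_posD[OF es u]
  have eq: "foldr (\<circ>) (u # us) id = u \<circ> foldr (\<circ>) us id" by (simp only: foldr.simps o_apply)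
  show ?case
    unfolding eq using linear_compose[OF us(1) u'(1)] unitriangular_comp[OF es u'(1,3) us(2)] by blast
qed

text \<open>
  Each length \<open>l\<close> comes with its own basis and factors. All these bases give the same positive
  unipotents, because the second flag of every tuple is \<open>F 2\<close>. The partial products of the factors are
  determined by the flags, so they do not depend on \<open>l\<close> either.
\<close>

lemma nested_tuples_coordinates:
  fixes F H :: "nat \<Rightarrow> 'a::euclidean_space flag" and K :: "'a flag"
  assumes tuple: "\<And>l. l \<ge> 2 \<Longrightarrow> positive_tuple (map F [1..<Suc l] @ map H (rev [1..<Suc l]) @ [K])"
  obtains es g h where "adapted_basis es (F 1) K" "g 1 = id"
    "\<And>i. 1 \<le> i \<Longrightarrow> linear (g i) \<and> unitriangular DIM('a) (entries es (g i))"
    "\<And>i. 1 \<le> i \<Longrightarrow> F i = flag_act (g i) (F 1) \<and> H i = flag_act (h i) (F 1)"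
    "\<And>i. 1 \<le> i \<Longrightarrow> \<exists>a\<in>U_pos es. g (Suc i) = g i \<circ> a"
    "\<And>i. 1 \<le> i \<Longrightarrow> \<exists>b\<in>U_pos es. h i = g i \<circ> b"
    "\<And>i. 1 \<le> i \<Longrightarrow> \<exists>c\<in>U_pos es. h i = h (Suc i) \<circ> c"
proof -
  \<comment> \<open>in \<open>T l\<close>, position \<open>p < l\<close> holds \<open>F (p + 1)\<close> and position \<open>p\<close> with \<open>l \<le> p < 2 * l\<close> holds \<open>H (2 * l - p)\<close>\<close>
  define T where "T l = map F [1..<Suc l] @ map H (rev [1..<Suc l]) @ [K]" for l
  have len: "length (T l) = Suc (2 * l)" and last: "last (T l) = K" for l
    by (auto simp: T_def)
  have hd: "hd (T l) = F 1" if "1 \<le> l" for l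
  proof -
    have "map F [1..<Suc l] = F 1 # map F [2..<Suc l]"
      using that by (simp add: upt_conv_Cons numeral_2_eq_2 del: upt_Suc)
    then show ?thesis by (simp add: T_def del: upt_Suc)
  qed
  have T_F: "T l ! p = F (Suc p)" if "p < l" for l p
    using that by (simp add: T_def nth_append del: upt_Suc)
  have T_H: "T l ! p = H (2 * l - p)" if "l \<le> p" "p < 2 * l" for l p
  proof -
    have "T l ! p = map H (rev [1..<Suc l]) ! (p - l)"
    proof -
      have "p - l < length (map H (rev [1..<Suc l]))" using that by (simp del: upt_Suc)
      then show ?thesis using that by (simp add: T_def nth_append del: upt_Suc)
    qed
    also have "\<dots> = H (rev [1..<Suc l] ! (p - l))"
      using that by (intro nth_map) (simp del: upt_Suc)
    also have "rev [1..<Suc l] ! (p - l) = 2 * l - p"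
      using that by (subst rev_nth) (auto simp del: upt_Suc)
    finally show ?thesis .
  qed
  have ex: "\<exists>es us. adapted_basis es (F 1) K \<and> length us = 2 * l - 1 \<and> set us \<subseteq> U_pos es \<and>
      (\<forall>p<2 * l. T l ! p = flag_act (foldr (\<circ>) (take p us) id) (F 1))" if "2 \<le> l" for l
    using tuple[OF that] that unfolding T_def[symmetric] positive_tuple_def adapted_basis_def len last
    by (simp add: hd)
  obtain es us2 where es: "adapted_basis es (F 1) K" and us2: "length us2 = 3" "set us2 \<subseteq> U_pos es"
    "\<forall>p<4. T 2 ! p = flag_act (foldr (\<circ>) (take p us2) id) (F 1)"
    using ex[of 2] by auto
  have b: "ordered_basis es UNIV" using es by (simp add: adapted_basis_def)
  have first: "take 1 us = [us ! 0]" if "us \<noteq> []" for us :: "('a \<Rightarrow> 'a) list"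
    using that by (cases us) auto
  have "\<exists>us. length us = 2 * l - 1 \<and> set us \<subseteq> U_pos es \<and>
      (\<forall>p<2 * l. T l ! p = flag_act (foldr (\<circ>) (take p us) id) (F 1))" if l: "2 \<le> l" for l
  proof -
    obtain es' us where es': "adapted_basis es' (F 1) K" and us: "length us = 2 * l - 1" "set us \<subseteq> U_pos es'"
      "\<forall>p<2 * l. T l ! p = flag_act (foldr (\<circ>) (take p us) id) (F 1)"
      using ex[OF l] by blast
    have "us2 \<noteq> []" "us \<noteq> []" using us2 us l by auto
    have "F 2 = flag_act (us2 ! 0) (F 1)"
      using us2(3)[rule_format, of 1] T_F[of 1 2] first[OF \<open>us2 \<noteq> []\<close>] by (simp add: numeral_2_eq_2)
    moreover have "F 2 = flag_act (us ! 0) (F 1)"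
      using us(3)[rule_format, of 1] T_F[of 1 l] first[OF \<open>us \<noteq> []\<close>] l by (simp add: numeral_2_eq_2)
    moreover have "us2 ! 0 \<in> U_pos es" "us ! 0 \<in> U_pos es'"
      using us2(2) us(2) nth_mem[of 0 us2] nth_mem[of 0 us] \<open>us2 \<noteq> []\<close> \<open>us \<noteq> []\<close>
      by (blast intro: length_greater_0_conv[THEN iffD2])+
    ultimately have "U_pos es' \<subseteq> U_pos es"
      using U_pos_adapted_mono[OF es es', of "us2 ! 0" "us ! 0"] by metis
    then show ?thesis using us by blast
  qed
  then obtain us where us: "\<And>l. 2 \<le> l \<Longrightarrow> length (us l) = 2 * l - 1"
    "\<And>l. 2 \<le> l \<Longrightarrow> set (us l) \<subseteq> U_pos es"
    "\<And>l p. 2 \<le> l \<Longrightarrow> p < 2 * l \<Longrightarrow> T l ! p = flag_act (foldr (\<circ>) (take p (us l)) id) (F 1)"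
    by metis
  define P where "P l p = foldr (\<circ>) (take p (us l)) id" for l p
  have P: "linear (P l p) \<and> unitriangular DIM('a) (entries es (P l p))" if "2 \<le> l" for l p
    unfolding P_def by (rule foldr_comp_unitriangular[OF b order_trans[OF set_take_subset us(2)[OF that]]])
  have P_step: "\<exists>v\<in>U_pos es. P l q = P l p \<circ> v" if "2 \<le> l" "p < q" "q < 2 * l" for l p q
  proof -
    have "p + Suc (q - p - 1) = q" "q \<le> length (us l)"
      using that us(1)[OF that(1)] by auto
    then show ?thesis
      unfolding P_def using foldr_comp_take_less[OF b us(2)[OF that(1)], of p "q - p - 1"] by simp
  qed
  have P_F: "F i = flag_act (P l (i - 1)) (F 1)" if "2 \<le> l" "1 \<le> i" "i \<le> l" for l i
    unfolding P_def using us(3)[OF that(1), of "i - 1"] T_F[of "i - 1" l] that by simp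
  have P_H: "H i = flag_act (P l (2 * l - i)) (F 1)" if "2 \<le> l" "1 \<le> i" "i \<le> l" for l i
    unfolding P_def using us(3)[OF that(1), of "2 * l - i"] T_H[of l "2 * l - i"] that by simp
  \<comment> \<open>tuples have length at least \<open>2 * 2 + 1\<close>, so for \<open>i = 1\<close> the tuple with \<open>l = 2\<close> is used\<close>
  define g where "g i = P (max 2 i) (i - 1)" for i
  define h where "h i = P (max 2 i) (2 * max 2 i - i)" for i
  have g: "g i = P l (i - 1)" and h: "h i = P l (2 * l - i)" if "2 \<le> l" "1 \<le> i" "i \<le> l" for l i
  proof -
    show "g i = P l (i - 1)"
      unfolding g_def using that P_F[of l i] P_F[of "max 2 i" i] P[of l] P[of "max 2 i"]
      by (intro unitriangular_flag_act_inj[OF es]) auto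
    show "h i = P l (2 * l - i)"
      unfolding h_def using that P_H[of l i] P_H[of "max 2 i" i] P[of l] P[of "max 2 i"]
      by (intro unitriangular_flag_act_inj[OF es]) auto
  qed
  show ?thesis
  proof (rule that[of es g h])
    show "adapted_basis es (F 1) K" by fact
    show "g 1 = id" by (simp add: g_def P_def)
    fix i :: nat assume i: "1 \<le> i"
    show "linear (g i) \<and> unitriangular DIM('a) (entries es (g i))"
      unfolding g_def by (rule P) simp
    show "F i = flag_act (g i) (F 1) \<and> H i = flag_act (h i) (F 1)"
      unfolding g_def h_def using P_F[of "max 2 i" i] P_H[of "max 2 i" i] i by simp
    let ?l = "Suc i"
    have l: "2 \<le> ?l" using i by simp
    show "\<exists>a\<in>U_pos es. g (Suc i) = g i \<circ> a"
      using g[of ?l "Suc i"] g[of ?l i] P_step[of ?l "i - 1" i] i by simp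
    show "\<exists>b\<in>U_pos es. h i = g i \<circ> b"
      using g[of ?l i] h[of ?l i] P_step[of ?l "i - 1" "2 * ?l - i"] i by simp
    show "\<exists>c\<in>U_pos es. h i = h (Suc i) \<circ> c"
      using h[of ?l i] h[of ?l "Suc i"] P_step[of ?l "2 * ?l - Suc i" "2 * ?l - i"] i by simp
  qed
qed

section \<open>Intervals of flags\<close>

text \<open>
  The interval is defined with some basis adapted to its left end and \<open>K\<close>; the translate of \<open>es\<close> by \<open>g\<close>
  is one, and \<open>b\<close> conjugated by \<open>g\<close> is a positive element taking the left end to the right end. So the
  two factors given by positivity are conjugates by \<open>g\<close> of positive elements for \<open>es\<close>.
\<close>

lemma flag_interval_factor:
  fixes F K :: "'a::euclidean_space flag"
  assumes es: "adapted_basis es F K" and g: "linear g" "unitriangular DIM('a) (entries es g)"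
    and b: "b \<in> U_pos es" and G: "G \<in> flag_interval (flag_act g F) (flag_act (g \<circ> b) F) K"
  obtains q r where "q \<in> U_pos es" "r \<in> U_pos es" "b = q \<circ> r" "G = flag_act (g \<circ> q) F"
proof -
  have bas: "ordered_basis es UNIV" using es by (simp add: adapted_basis_def)
  note b' = U_posD[OF bas b]
  have g': "bij g" by (rule unitriangular_bij[OF bas g])
  let ?i = "inv_into UNIV g"
  have inv: "linear ?i" "bij ?i"
    using inj_linear_imp_inv_linear[OF g(1) bij_is_inj[OF g']] bij_imp_bij_inv[OF g'] .
  have cancel: "?i \<circ> g = id" "g \<circ> ?i = id"
    using g' by (auto simp: fun_eq_iff inv_f_f[OF bij_is_inj] surj_f_inv_f[OF bij_is_surj])
  let ?es = "map g es"
  have es_g: "adapted_basis ?es (flag_act g F) K" by (rule adapted_basis_translate[OF es g])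
  have bas_g: "ordered_basis ?es UNIV" using es_g by (simp add: adapted_basis_def)
  obtain es' us where es': "adapted_basis es' (flag_act g F) K" and us: "length us = 2" "set us \<subseteq> U_pos es'"
    and act: "\<forall>j<3. [flag_act g F, G, flag_act (g \<circ> b) F, K] ! j = flag_act (foldr (\<circ>) (take j us) id) (flag_act g F)"
  proof -
    have "length [flag_act g F, G, flag_act (g \<circ> b) F, K] - 2 = 2" "length [flag_act g F, G, flag_act (g \<circ> b) F, K] - 1 = 3"
      "hd [flag_act g F, G, flag_act (g \<circ> b) F, K] = flag_act g F" "last [flag_act g F, G, flag_act (g \<circ> b) F, K] = K"
      by simp_all
    then show ?thesis
      using G that unfolding flag_interval_def positive_tuple_def adapted_basis_def mem_Collect_eq by metis
  qed
  obtain u1 u2 where us_eq: "us = [u1, u2]"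
    using us(1) by (auto simp: numeral_2_eq_2 length_Suc_conv)
  have bas': "ordered_basis es' UNIV" using es' by (simp add: adapted_basis_def)
  have u: "u1 \<in> U_pos es'" "u2 \<in> U_pos es'" using us us_eq by auto
  have G_eq: "G = flag_act u1 (flag_act g F)"
    using act[rule_format, of 1] by (simp add: us_eq)
  have H_eq: "flag_act (g \<circ> b) F = flag_act (u1 \<circ> u2) (flag_act g F)"
    using act[rule_format, of 2] by (simp add: us_eq)
  let ?p = "g \<circ> b \<circ> ?i"
  have p: "?p \<in> U_pos ?es"
    using U_pos_map_iff[OF bas g(1) g' b'(1)] b by simp
  note p' = U_posD[OF bas_g p]
  have p_eq: "flag_act ?p (flag_act g F) = flag_act (u1 \<circ> u2) (flag_act g F)"
  proof -
    have "?p \<circ> g = g \<circ> b" by (simp only: o_assoc[symmetric] cancel comp_id)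
    then show ?thesis
      using flag_act_comp[OF p'(1,4) g(1) g', of F] H_eq by simp
  qed
  have sub: "U_pos es' \<subseteq> U_pos ?es"
    by (rule U_pos_adapted_mono[OF es_g es' p U_pos_comp[OF bas' u] p_eq])
  have u': "u1 \<in> U_pos ?es" "u2 \<in> U_pos ?es" using u sub by auto
  note u1 = U_posD[OF bas_g u'(1)] and u2 = U_posD[OF bas_g u'(2)] and u12 = U_posD[OF bas_g U_pos_comp[OF bas_g u']]
  have p_u: "?p = u1 \<circ> u2"
    by (rule unitriangular_flag_act_inj[OF es_g p'(1,3) u12(1,3) p_eq])
  have conj: "g \<circ> (?i \<circ> v \<circ> g) \<circ> ?i = v" for v
    by (simp only: o_assoc cancel id_comp) (simp only: o_assoc[symmetric] cancel comp_id)
  show ?thesis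
  proof (rule that[of "?i \<circ> u1 \<circ> g" "?i \<circ> u2 \<circ> g"])
    show "?i \<circ> u1 \<circ> g \<in> U_pos es" "?i \<circ> u2 \<circ> g \<in> U_pos es"
      using U_pos_map_iff[OF bas g(1) g', of "?i \<circ> u1 \<circ> g"] U_pos_map_iff[OF bas g(1) g', of "?i \<circ> u2 \<circ> g"]
        u' u1 u2 g inv unfolding conj by (auto intro: linear_compose)
    have "b = ?i \<circ> ?p \<circ> g"
      by (simp only: o_assoc cancel id_comp) (simp only: o_assoc[symmetric] cancel comp_id)
    also have "\<dots> = ?i \<circ> u1 \<circ> (g \<circ> ?i) \<circ> u2 \<circ> g"
      unfolding p_u by (simp only: cancel comp_id o_assoc)
    finally show "b = (?i \<circ> u1 \<circ> g) \<circ> (?i \<circ> u2 \<circ> g)"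
      by (simp only: o_assoc)
    have "g \<circ> (?i \<circ> u1 \<circ> g) = u1 \<circ> g"
      by (simp only: o_assoc cancel id_comp)
    then show "G = flag_act (g \<circ> (?i \<circ> u1 \<circ> g)) F"
      using flag_act_comp[OF u1(1,4) g(1) g', of F] G_eq by simp
  qed
qed

lemma flag_interval_memI:
  fixes F K :: "'a::euclidean_space flag"
  assumes es: "adapted_basis es F K" and g: "linear g" "unitriangular DIM('a) (entries es g)"
    and q: "q \<in> U_pos es" and r: "r \<in> U_pos es"
  shows "flag_act (g \<circ> q) F \<in> flag_interval (flag_act g F) (flag_act (g \<circ> q \<circ> r) F) K"
proof -
  have bas: "ordered_basis es UNIV" using es by (simp add: adapted_basis_def)
  note q' = U_posD[OF bas q] and r' = U_posD[OF bas r]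
  have g': "bij g" by (rule unitriangular_bij[OF bas g])
  let ?i = "inv_into UNIV g"
  have cancel: "?i \<circ> g = id"
    using g' by (auto simp: fun_eq_iff inv_f_f[OF bij_is_inj])
  let ?es = "map g es"
  have es_g: "adapted_basis ?es (flag_act g F) K" by (rule adapted_basis_translate[OF es g])
  have bas_g: "ordered_basis ?es UNIV" using es_g by (simp add: adapted_basis_def)
  let ?u1 = "g \<circ> q \<circ> ?i" and ?u2 = "g \<circ> r \<circ> ?i"
  have u: "?u1 \<in> U_pos ?es" "?u2 \<in> U_pos ?es"
    using U_pos_map_iff[OF bas g(1) g' q'(1)] U_pos_map_iff[OF bas g(1) g' r'(1)] q r by auto
  note u1 = U_posD[OF bas_g u(1)] and u2 = U_posD[OF bas_g u(2)] and u12 = U_posD[OF bas_g U_pos_comp[OF bas_g u]]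
  have "?u1 \<circ> g = g \<circ> q"
    by (simp only: o_assoc[symmetric] cancel comp_id)
  then have 1: "flag_act (g \<circ> q) F = flag_act ?u1 (flag_act g F)"
    using flag_act_comp[OF u1(1,4) g(1) g', of F] by simp
  have "(?u1 \<circ> ?u2) \<circ> g = g \<circ> q \<circ> (?i \<circ> g) \<circ> r \<circ> (?i \<circ> g)"
    by (simp only: o_assoc)
  also have "\<dots> = g \<circ> q \<circ> r"
    by (simp only: cancel comp_id)
  finally have 2: "flag_act (g \<circ> q \<circ> r) F = flag_act (?u1 \<circ> ?u2) (flag_act g F)"
    using flag_act_comp[OF u12(1,4) g(1) g', of F] by simp
  have "[flag_act g F, flag_act (g \<circ> q) F, flag_act (g \<circ> q \<circ> r) F, K] ! j =
      flag_act (foldr (\<circ>) (take j [?u1, ?u2]) id) (flag_act g F)" if "j < 3" for j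
  proof -
    consider "j = 0" | "j = 1" | "j = 2" using \<open>j < 3\<close> by linarith
    then show ?thesis
      by cases (simp_all only: 1 2, simp_all add: flag_act_id)
  qed
  then show ?thesis
    unfolding flag_interval_def positive_tuple_def mem_Collect_eq
    using adapted_transverse[OF es_g] es_g u unfolding adapted_basis_def
    by (intro conjI exI[of _ ?es] exI[of _ "[?u1, ?u2]"]) auto
qed

section \<open>Shrinking intervals\<close>

lemma mat_times_ge_left:
  assumes A: "\<And>r s. r < n \<Longrightarrow> s < n \<Longrightarrow> 0 \<le> A r s" and B: "tpos n B" and rs: "r < n" "c < n"
  shows "A r c \<le> mat_times n A B r c"
proof -
  have "(\<Sum>s\<in>{c}. A r s * B s c) \<le> (\<Sum>s<n. A r s * B s c)"
    using A rs tpos_entry_nonneg[OF B] by (intro sum_mono2) auto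
  then show ?thesis
    using tpos_unitriangular[OF B] rs by (simp add: mat_times_def unitriangular_def)
qed

text \<open>
  The bound gives \<open>\<beta> (i+1) \<le> (D - 1) \<alpha> i \<le> (D - 1) (\<beta> i - \<beta> (i+1))\<close>, and the differences of a decreasing
  positive sequence tend to zero.
\<close>

lemma gap_tendsto_zero:
  fixes \<alpha> \<beta> \<gamma> :: "nat \<Rightarrow> real"
  assumes pos: "\<And>i. 0 < \<alpha> i" "\<And>i. 0 < \<beta> i" "\<And>i. 0 < \<gamma> i"
    and sum: "\<And>i. \<beta> i = \<alpha> i + \<beta> (Suc i) + \<gamma> i"
    and bound: "\<And>i. 1 + \<beta> (Suc i) / \<alpha> i \<le> D"
  shows "\<beta> \<longlonglongrightarrow> 0"
proof -
  have dec: "decseq \<beta>"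
    using sum pos by (intro decseq_SucI) (metis add.commute add_increasing less_imp_le order_refl add_mono_thms_linordered_semiring(1) add_0)
  have "bdd_below (range \<beta>)"
    using pos(2) by (intro bdd_belowI2[of _ 0]) (simp add: less_imp_le)
  then obtain L where L: "\<beta> \<longlonglongrightarrow> L"
    using dec decseq_convergent[of \<beta> 0] pos(2) less_imp_le by metis
  have "(\<lambda>i. (D - 1) * (\<beta> i - \<beta> (Suc i))) \<longlonglongrightarrow> (D - 1) * (L - L)"
    by (intro tendsto_intros L LIMSEQ_Suc)
  then have lim: "(\<lambda>i. (D - 1) * (\<beta> i - \<beta> (Suc i))) \<longlonglongrightarrow> 0" by simp
  have "\<beta> (Suc i) \<le> (D - 1) * (\<beta> i - \<beta> (Suc i))" for i
  proof -
    have "0 < \<beta> (Suc i) / \<alpha> i" using pos by simp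
    then have "0 \<le> D - 1" using bound[of i] by linarith
    have "\<beta> (Suc i) / \<alpha> i \<le> D - 1" using bound[of i] by linarith
    then have "\<beta> (Suc i) \<le> (D - 1) * \<alpha> i" using pos(1)[of i] by (simp add: divide_le_eq)
    also have "\<dots> \<le> (D - 1) * (\<beta> i - \<beta> (Suc i))"
      using sum[of i] pos(3)[of i] \<open>0 \<le> D - 1\<close> by (intro mult_left_mono) auto
    finally show ?thesis .
  qed
  then have "(\<lambda>i. \<beta> (Suc i)) \<longlonglongrightarrow> 0"
    using less_imp_le[OF pos(2)] by (intro tendsto_sandwich[OF _ _ tendsto_const lim] always_eventually allI)
  then show ?thesis by (simp add: filterlim_sequentially_Suc)
qed

text \<open>
  By \<open>tpos_entry_submult\<close>, each entry above the diagonal is at most a product of its left neighbour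
  and a superdiagonal entry; induct on the distance from the diagonal.
\<close>

lemma tpos_tendsto_identity:
  assumes B: "\<And>i. tpos n (B i)"
    and super: "\<And>j. Suc j < n \<Longrightarrow> (\<lambda>i. B i j (Suc j)) \<longlonglongrightarrow> 0"
    and rc: "r < n" "c < n"
  shows "(\<lambda>i. B i r c) \<longlonglongrightarrow> (if r = c then 1 else 0)"
proof -
  have above: "(\<lambda>i. B i r (r + Suc d)) \<longlonglongrightarrow> 0" if "r + Suc d < n" for d
    using that
  proof (induction d)
    case 0
    then show ?case using super by simp
  next
    case (Suc d)
    have "(\<lambda>i. B i r (r + Suc d) * B i (r + Suc d) (Suc (r + Suc d))) \<longlonglongrightarrow> 0 * 0"
      using Suc by (intro tendsto_mult super) auto
    then have lim: "(\<lambda>i. B i r (r + Suc d) * B i (r + Suc d) (Suc (r + Suc d))) \<longlonglongrightarrow> 0" by simp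
    have "B i r (r + Suc (Suc d)) \<le> B i r (r + Suc d) * B i (r + Suc d) (Suc (r + Suc d))" for i
      using tpos_entry_submult[OF B, of r "r + Suc d" i] Suc.prems by simp
    moreover have "0 \<le> B i r (r + Suc (Suc d))" for i
      using tpos_entry_nonneg[OF B] Suc.prems by simp
    ultimately show ?case
      by (intro tendsto_sandwich[OF _ _ tendsto_const lim]) auto
  qed
  have uni: "unitriangular n (B i)" for i by (rule tpos_unitriangular[OF B])
  consider "c < r" | "r = c" | "r < c" by linarith
  then show ?thesis
  proof cases
    case 1
    then show ?thesis using uni rc by (simp add: unitriangular_def)
  next
    case 2
    then show ?thesis using uni rc by (simp add: unitriangular_def)
  next
    case 3
    then obtain d where "c = r + Suc d" using less_imp_Suc_add by force
    then show ?thesis using above rc by simp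
  qed
qed

lemma linear_with_entries:
  fixes es :: "'a::euclidean_space list"
  assumes es: "ordered_basis es UNIV"
  obtains u where "linear u" "\<And>i j. i < DIM('a) \<Longrightarrow> j < DIM('a) \<Longrightarrow> entries es u i j = M i j"
proof
  let ?u = "\<lambda>x. \<Sum>i<DIM('a). (\<Sum>j<DIM('a). M i j * coordinate es j x) *\<^sub>R es ! i"
  note lin = linear_coordinate[OF es]
  show "linear ?u"
    by (rule linearI)
      (simp_all add: linear_add[OF lin] linear_scale[OF lin] distrib_left sum.distrib scaleR_add_left
        scaleR_right.sum sum_distrib_left mult_ac)
  fix i j assume ij: "i < DIM('a)" "j < DIM('a)"
  have "entries es ?u i j = (\<Sum>k<DIM('a). M i k * coordinate es k (es ! j))"
    using ij by (simp add: entries_def coordinate_sum[OF es])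
  also have "\<dots> = (\<Sum>k<DIM('a). if k = j then M i k else 0)"
    using ij by (intro sum.cong refl) (simp add: coordinate_basis[OF es])
  finally show "entries es ?u i j = M i j"
    using ij by simp
qed

text \<open>
  The \<open>i\<close>-th interval lies in the image of the box of linear maps whose entries are between \<open>L i\<close> and
  \<open>M i\<close>. Both bounds are unitriangular, so the box consists of bijections; it is compact, so its image
  is closed. The bounds converge to the same matrix.
\<close>

theorem nested_flag_intervals_converge:
  fixes F K :: "'a::euclidean_space flag" and g a b c :: "nat \<Rightarrow> 'a \<Rightarrow> 'a"
  assumes es: "adapted_basis es F K"
    and abc: "\<And>i. a i \<in> U_pos es" "\<And>i. b i \<in> U_pos es" "\<And>i. c i \<in> U_pos es"
    and g: "g 0 = id" "\<And>i. g (Suc i) = g i \<circ> a i"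
    and b_eq: "\<And>i. b i = a i \<circ> (b (Suc i) \<circ> c i)"
    and gap: "\<And>s. Suc s < DIM('a) \<Longrightarrow> (\<lambda>i. entries es (b i) s (Suc s)) \<longlonglongrightarrow> 0"
  defines "I \<equiv> \<lambda>i. flag_interval (flag_act (g i) F) (flag_act (g i \<circ> b i) F) K"
  obtains G where "\<And>i. I i \<noteq> {}" "\<And>Gs. (\<And>i. Gs i \<in> closure (I i)) \<Longrightarrow> Gs \<longlonglongrightarrow> G"
proof -
  let ?n = "DIM('a)"
  have bas: "ordered_basis es UNIV" using es by (simp add: adapted_basis_def)
  note a = U_posD[OF bas abc(1)] and b = U_posD[OF bas abc(2)] and c = U_posD[OF bas abc(3)]
  define L where "L i = entries es (g i)" for i
  define M where "M i = entries es (g i \<circ> b i)" for i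
  have g_uni: "linear (g i) \<and> unitriangular ?n (L i)" for i
  proof (induction i)
    case 0
    have "linear (id :: 'a \<Rightarrow> 'a)" by (simp add: linear_iff)
    then show ?case unfolding L_def g(1) using unitriangular_id[OF bas] by blast
  next
    case (Suc i)
    then show ?case
      unfolding L_def g(2) using linear_compose[OF a(1)[of i], of "g i"] unitriangular_comp[OF bas _ _ a(3)[of i], of "g i"] by blast
  qed
  have L_Suc: "L (Suc i) = mat_times ?n (L i) (entries es (a i))" for i
    unfolding L_def g(2) using g_uni by (intro entries_comp[OF bas]) blast
  have M_eq: "M i = mat_times ?n (L i) (entries es (b i))" for i
    unfolding L_def M_def using g_uni by (intro entries_comp[OF bas]) blast
  have gb_lin: "linear (g i \<circ> b i)" for i
    using g_uni b(1) by (intro linear_compose) auto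
  have M_step: "M i = mat_times ?n (M (Suc i)) (entries es (c i))" for i
  proof -
    have "g i \<circ> b i = (g (Suc i) \<circ> b (Suc i)) \<circ> c i"
      unfolding g(2) by (subst b_eq) (simp only: o_assoc)
    then show ?thesis
      unfolding M_def by (simp only: entries_comp[OF bas gb_lin])
  qed
  have M_uni: "unitriangular ?n (M i)" for i
    unfolding M_eq using g_uni b(3) by (intro unitriangular_mult) auto
  have L_nonneg: "0 \<le> L i r s" if "r < ?n" "s < ?n" for i r s
    using that
  proof (induction i arbitrary: r s)
    case 0
    then show ?case by (simp add: L_def g(1) entries_def coordinate_basis[OF bas])
  next
    case (Suc i)
    have "L i r s \<le> L (Suc i) r s"
      unfolding L_Suc by (rule mat_times_ge_left) (use Suc a(2) in auto)
    then show ?case using Suc.IH[OF Suc.prems] by simp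
  qed
  have L_mono: "L i r s \<le> L (Suc i) r s" if "r < ?n" "s < ?n" for i r s
    unfolding L_Suc by (rule mat_times_ge_left) (use L_nonneg a(2) that in auto)
  have L_le_M: "L i r s \<le> M i r s" if "r < ?n" "s < ?n" for i r s
    unfolding M_eq by (rule mat_times_ge_left) (use L_nonneg b(2) that in auto)
  have M_nonneg: "0 \<le> M i r s" if "r < ?n" "s < ?n" for i r s
    using L_nonneg[OF that] L_le_M[OF that] by (rule order_trans)
  have M_anti: "M (Suc i) r s \<le> M i r s" if "r < ?n" "s < ?n" for i r s
    unfolding M_step[of i] by (rule mat_times_ge_left) (use M_nonneg c(2) that in auto)
  have M_le: "M i r s \<le> M 0 r s" if "r < ?n" "s < ?n" for i r s
    by (induction i) (use M_anti[OF that] order_trans in blast)+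
  have "\<exists>x. (\<lambda>i. L i r s) \<longlonglongrightarrow> x" if rs: "r < ?n" "s < ?n" for r s
  proof -
    have "incseq (\<lambda>i. L i r s)"
      using L_mono[OF rs] by (intro incseq_SucI)
    then show ?thesis
      using incseq_convergent[of "\<lambda>i. L i r s" "M 0 r s"] order_trans[OF L_le_M[OF rs] M_le[OF rs]] by blast
  qed
  then obtain Linf where Linf: "\<And>r s. r < ?n \<Longrightarrow> s < ?n \<Longrightarrow> (\<lambda>i. L i r s) \<longlonglongrightarrow> Linf r s"
    by metis
  have Minf: "(\<lambda>i. M i r s) \<longlonglongrightarrow> Linf r s" if rs: "r < ?n" "s < ?n" for r s
  proof -
    have "(\<lambda>i. \<Sum>t<?n. L i r t * entries es (b i) t s) \<longlonglongrightarrow> (\<Sum>t<?n. Linf r t * (if t = s then 1 else 0))"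
      by (intro tendsto_sum tendsto_mult Linf tpos_tendsto_identity[OF b(2) gap]) (use rs in auto)
    moreover have "(\<Sum>t<?n. Linf r t * (if t = s then 1 else 0)) = Linf r s"
      using sum_unit_column[OF rs(2), of "Linf r"] by (simp only: unit_column_def)
    ultimately show ?thesis
      unfolding M_eq mat_times_def by simp
  qed
  obtain u where u: "linear u" "\<And>i j. i < ?n \<Longrightarrow> j < ?n \<Longrightarrow> entries es u i j = Linf i j"
    using linear_with_entries[OF bas] by blast
  have "unitriangular ?n (entries es u)"
    unfolding unitriangular_def
  proof (intro allI impI conjI)
    fix i j assume ij: "i < ?n" "j < i"
    have "(\<lambda>m. L m i j) = (\<lambda>_. 0)"
      using g_uni ij by (auto simp: unitriangular_def)
    then show "entries es u i j = 0"
      using Linf[of i j] ij by (simp add: u(2) LIMSEQ_const_iff)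
  next
    fix i assume i: "i < ?n"
    have "(\<lambda>m. L m i i) = (\<lambda>_. 1)"
      using g_uni i by (auto simp: unitriangular_def)
    then show "entries es u i i = 1"
      using Linf[of i i] i by (simp add: u(2) LIMSEQ_const_iff)
  qed
  then have u_bij: "bij u" by (rule unitriangular_bij[OF bas u(1)])
  have blin: "blinfun_apply (Blinfun v) = v" if "linear v" for v :: "'a \<Rightarrow> 'a"
    using that by (simp add: bounded_linear_Blinfun_apply linear_conv_bounded_linear)
  define C where "C i = {d :: 'a \<Rightarrow>\<^sub>L 'a. \<forall>r<?n. \<forall>s<?n.
      L i r s \<le> entries es (blinfun_apply d) r s \<and> entries es (blinfun_apply d) r s \<le> M i r s}" for i
  have C_bij: "bij (blinfun_apply d)" if "d \<in> C i" for d i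
  proof (rule unitriangular_bij[OF bas])
    show "linear (blinfun_apply d)" by (rule bounded_linear.linear[OF blinfun.bounded_linear_right])
    have le: "L i r s \<le> entries es (blinfun_apply d) r s" "entries es (blinfun_apply d) r s \<le> M i r s"
      if "r < ?n" "s < ?n" for r s
      using \<open>d \<in> C i\<close> that by (auto simp: C_def)
    show "unitriangular ?n (entries es (blinfun_apply d))"
      unfolding unitriangular_def
    proof (intro allI impI conjI antisym)
      fix r s assume rs: "r < ?n" "s < r"
      show "entries es (blinfun_apply d) r s \<le> 0" "0 \<le> entries es (blinfun_apply d) r s"
        using le[of r s] rs g_uni[of i] M_uni[of i] by (auto simp: unitriangular_def)
    next
      fix r assume r: "r < ?n"
      show "entries es (blinfun_apply d) r r \<le> 1" "1 \<le> entries es (blinfun_apply d) r r"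
        using le[of r r] r g_uni[of i] M_uni[of i] by (auto simp: unitriangular_def)
    qed
  qed
  let ?C = "\<lambda>i. (\<lambda>d. flag_act (blinfun_apply d) F) ` C i"
  have "I i \<subseteq> ?C i" for i
  proof
    fix G assume "G \<in> I i"
    then obtain q r where qr: "q \<in> U_pos es" "r \<in> U_pos es" "b i = q \<circ> r" "G = flag_act (g i \<circ> q) F"
      using flag_interval_factor[OF es _ _ abc(2)[of i], of "g i" G] g_uni[of i] unfolding I_def L_def by metis
    note q = U_posD[OF bas qr(1)] and r = U_posD[OF bas qr(2)]
    have lin: "linear (g i \<circ> q)" using g_uni q by (intro linear_compose) auto
    have e1: "entries es (g i \<circ> q) = mat_times ?n (L i) (entries es q)"
      unfolding L_def using g_uni by (intro entries_comp[OF bas]) blast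
    have e2: "M i = mat_times ?n (entries es (g i \<circ> q)) (entries es r)"
      unfolding M_def qr(3) o_assoc by (rule entries_comp[OF bas lin])
    have le1: "L i x y \<le> entries es (g i \<circ> q) x y" if "x < ?n" "y < ?n" for x y
      unfolding e1 by (rule mat_times_ge_left) (use L_nonneg q(2) that in auto)
    have le2: "entries es (g i \<circ> q) x y \<le> M i x y" if "x < ?n" "y < ?n" for x y
      unfolding e2 by (rule mat_times_ge_left) (use order_trans[OF L_nonneg le1] r(2) that in auto)
    have "Blinfun (g i \<circ> q) \<in> C i"
      unfolding C_def mem_Collect_eq blin[OF lin] using le1 le2 by blast
    moreover have "G = flag_act (blinfun_apply (Blinfun (g i \<circ> q))) F"
      unfolding blin[OF lin] by (rule qr(4))
    ultimately show "G \<in> ?C i" by (rule rev_image_eqI)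
  qed
  moreover have "closed (?C i)" for i
  proof (rule closed_flag_act_compact)
    show "compact (C i)" unfolding C_def by (rule compact_entries_box[OF bas])
  qed (rule C_bij)
  ultimately have cl: "closure (I i) \<subseteq> ?C i" for i
    by (simp add: closure_minimal)
  show ?thesis
  proof (rule that)
    fix i
    have "flag_act (g i \<circ> a i) F \<in> I i"
    proof -
      have "g i \<circ> b i = g i \<circ> a i \<circ> (b (Suc i) \<circ> c i)"
        by (subst b_eq) (simp only: o_assoc)
      then show ?thesis
        using flag_interval_memI[OF es _ _ abc(1)[of i] U_pos_comp[OF bas abc(2)[of "Suc i"] abc(3)[of i]], of "g i"] g_uni[of i]
        unfolding I_def L_def by simp
    qed
    then show "I i \<noteq> {}" by blast
  next
    fix Gs :: "nat \<Rightarrow> 'a flag" assume "\<And>i. Gs i \<in> closure (I i)"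
    then have "\<forall>i. \<exists>d. d \<in> C i \<and> Gs i = flag_act (blinfun_apply d) F"
      using cl by blast
    then obtain d where d: "\<And>i. d i \<in> C i" "\<And>i. Gs i = flag_act (blinfun_apply (d i)) F"
      by metis
    have "d \<longlonglongrightarrow> Blinfun u"
    proof (rule tendsto_blinfun_entries[OF bas])
      fix r s assume rs: "r < ?n" "s < ?n"
      have "L i r s \<le> entries es (blinfun_apply (d i)) r s" "entries es (blinfun_apply (d i)) r s \<le> M i r s" for i
        using d(1)[of i] rs by (auto simp: C_def)
      then show "(\<lambda>i. entries es (blinfun_apply (d i)) r s) \<longlonglongrightarrow> entries es (blinfun_apply (Blinfun u)) r s"
        unfolding blin[OF u(1)] u(2)[OF rs]
        by (intro tendsto_sandwich[OF _ _ Linf[OF rs] Minf[OF rs]] always_eventually allI)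
    qed
    then have "(\<lambda>i. flag_act (blinfun_apply (d i)) F) \<longlonglongrightarrow> flag_act (blinfun_apply (Blinfun u)) F"
      by (rule tendsto_flag_act) (use d(1) C_bij blin[OF u(1)] u_bij in auto)
    then show "Gs \<longlonglongrightarrow> flag_act u F"
      unfolding blin[OF u(1)] by (simp add: d(2)[abs_def])
  qed
qed

theorem theorem1p9:
  fixes F H :: "nat \<Rightarrow> 'v::euclidean_space flag" and K :: "'v flag"
    and \<Omega> :: "'v list \<Rightarrow> real"
  assumes "DIM('v) \<ge> 2"
    and "volume_form \<Omega>"
    and "\<And>l. l \<ge> 2 \<Longrightarrow> positive_tuple (map F [1..<Suc l] @ map H (rev [1..<Suc l]) @ [K])"
    and "\<exists>D>1. \<forall>i>0. \<forall>k\<in>{1..DIM('v) - 1}.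
           cross_ratio \<Omega> k (H i) (F i) (F (Suc i)) (H (Suc i)) \<le> D"
  shows "\<exists>G. sets_converge_to_point (\<lambda>i. closure (flag_interval (F i) (H i) K)) G"
proof -
  obtain es g h where es: "adapted_basis es (F 1) K" and g1: "g 1 = id"
    and g: "\<And>i. 1 \<le> i \<Longrightarrow> linear (g i) \<and> unitriangular DIM('v) (entries es (g i))"
    and FH: "\<And>i. 1 \<le> i \<Longrightarrow> F i = flag_act (g i) (F 1) \<and> H i = flag_act (h i) (F 1)"
    and ex: "\<And>i. 1 \<le> i \<Longrightarrow> \<exists>a\<in>U_pos es. g (Suc i) = g i \<circ> a"
      "\<And>i. 1 \<le> i \<Longrightarrow> \<exists>b\<in>U_pos es. h i = g i \<circ> b"
      "\<And>i. 1 \<le> i \<Longrightarrow> \<exists>c\<in>U_pos es. h i = h (Suc i) \<circ> c"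
    using nested_tuples_coordinates[OF assms(3)] by blast
  have bas: "ordered_basis es UNIV" using es by (simp add: adapted_basis_def)
  \<comment> \<open>the tuples are indexed from 1, the nested intervals from 0\<close>
  define g' h' where "g' i = g (Suc i)" and "h' i = h (Suc i)" for i
  have "\<forall>i. \<exists>a\<in>U_pos es. g' (Suc i) = g' i \<circ> a" "\<forall>i. \<exists>b\<in>U_pos es. h' i = g' i \<circ> b"
    "\<forall>i. \<exists>c\<in>U_pos es. h' i = h' (Suc i) \<circ> c"
    using ex unfolding g'_def h'_def by simp_all
  then obtain a b c where abc: "\<And>i. a i \<in> U_pos es" "\<And>i. b i \<in> U_pos es" "\<And>i. c i \<in> U_pos es"
    and eqs: "\<And>i. g' (Suc i) = g' i \<circ> a i" "\<And>i. h' i = g' i \<circ> b i" "\<And>i. h' i = h' (Suc i) \<circ> c i"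
    by metis
  note a = U_posD[OF bas abc(1)] and b = U_posD[OF bas abc(2)] and c = U_posD[OF bas abc(3)]
  have g': "linear (g' i)" "bij (g' i)" for i
    using g[of "Suc i"] unitriangular_bij[OF bas] by (auto simp: g'_def)
  have flags: "F (Suc i) = flag_act (g' i) (F 1)" "H (Suc i) = flag_act (g' i \<circ> b i) (F 1)" for i
    using FH[of "Suc i"] eqs(2)[of i] by (simp_all add: g'_def h'_def)
  have b_eq: "b i = a i \<circ> (b (Suc i) \<circ> c i)" for i
  proof -
    have "g' i \<circ> b i = g' i \<circ> (a i \<circ> (b (Suc i) \<circ> c i))"
      using eqs(2)[of i] eqs(3)[of i] eqs(2)[of "Suc i"] eqs(1)[of i] by (simp only: o_assoc)
    then show ?thesis
      using bij_is_inj[OF g'(2)[of i]] by (simp add: fun_eq_iff inj_eq)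
  qed
  obtain D where D: "\<And>i k. 0 < i \<Longrightarrow> k \<in> {1..DIM('v) - 1} \<Longrightarrow>
      cross_ratio \<Omega> k (H i) (F i) (F (Suc i)) (H (Suc i)) \<le> D"
    using assms(4) by blast
  have gap: "(\<lambda>i. entries es (b i) s (Suc s)) \<longlonglongrightarrow> 0" if s: "Suc s < DIM('v)" for s
  proof (rule gap_tendsto_zero)
    fix i
    show "0 < entries es (a i) s (Suc s)" "0 < entries es (b i) s (Suc s)" "0 < entries es (c i) s (Suc s)"
      using tpos_entry_pos[OF a(2)] tpos_entry_pos[OF b(2)] tpos_entry_pos[OF c(2)] s by auto
    have "entries es (b i) = mat_times DIM('v) (entries es (a i)) (mat_times DIM('v) (entries es (b (Suc i))) (entries es (c i)))"
      by (subst b_eq) (simp only: entries_comp[OF bas a(1)] entries_comp[OF bas b(1)])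
    then show "entries es (b i) s (Suc s) =
        entries es (a i) s (Suc s) + entries es (b (Suc i)) s (Suc s) + entries es (c i) s (Suc s)"
      using superdiagonal_mult[OF a(3) unitriangular_mult[OF b(3) c(3)] s] superdiagonal_mult[OF b(3) c(3) s]
      by simp
    let ?k = "DIM('v) - Suc s"
    have k: "0 < ?k" "?k < DIM('v)" "Suc s = DIM('v) - ?k" using s by auto
    have H_i: "H (Suc i) = flag_act (g' i \<circ> a i \<circ> b (Suc i) \<circ> c i) (F 1)"
      unfolding flags(2) by (subst b_eq) (simp only: o_assoc)
    have "1 + entries es (b (Suc i)) s (Suc s) / entries es (a i) s (Suc s) \<le>
        cross_ratio \<Omega> ?k (H (Suc i)) (F (Suc i)) (F (Suc (Suc i))) (H (Suc (Suc i)))"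
      using cross_ratio_ge[OF assms(2) es g' abc(1)[of i] abc(2)[of "Suc i"] abc(3)[of i] k, of i]
      unfolding H_i by (simp only: flags(1) flags(2)[of "Suc i"] eqs(1) diff_Suc_1)
    also have "\<dots> \<le> D"
      using k by (intro D) auto
    finally show "1 + entries es (b (Suc i)) s (Suc s) / entries es (a i) s (Suc s) \<le> D" .
  qed
  have "g' 0 = id" using g1 by (simp add: g'_def)
  from nested_flag_intervals_converge[OF es abc this eqs(1) b_eq gap]
  obtain G where ne: "\<And>i. flag_interval (F (Suc i)) (H (Suc i)) K \<noteq> {}"
    and lim: "\<And>Gs. (\<And>i. Gs i \<in> closure (flag_interval (F (Suc i)) (H (Suc i)) K)) \<Longrightarrow> Gs \<longlonglongrightarrow> G"
    unfolding flags[symmetric] by blast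
  have "sets_converge_to_point (\<lambda>i. closure (flag_interval (F i) (H i) K)) G"
    unfolding sets_converge_to_point_def
  proof (intro conjI allI impI)
    fix i :: nat assume "1 \<le> i"
    then show "closure (flag_interval (F i) (H i) K) \<noteq> {}"
      using ne[of "i - 1"] by simp
  next
    fix Gs assume "\<forall>i\<ge>1. Gs i \<in> closure (flag_interval (F i) (H i) K)"
    then have "(\<lambda>i. Gs (Suc i)) \<longlonglongrightarrow> G"
      by (intro lim) simp
    then show "Gs \<longlonglongrightarrow> G"
      by (simp add: filterlim_sequentially_Suc)
  qed
  then show ?thesis by blast
qed

end
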